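(* Let $n\ge3$ and $(a_1,\dots,a_n) \in \Gamma_n$. Let $f : D \to (\mathbb{N}\setminus\{0\})^n$ be the map determined by $(a_1,\dots,a_n)$ as defined in the context. Assume that one of the following holds: (i) the statement $\mathcal{P}(n)$ is true; (ii) $B_{\mathbb{C};f(d)}$ is rigid for each $d \in D$ such that $f(d) \in \Gamma_n$ (note that (i) implies (ii)). For each $\nu = 1,2$, let $I_\nu$ be the set of all $i \in \{1,\dots,n\}$ satisfying $\gcd(a_i,L_i) = \nu$. Then at most one element $i_0 \in I_2$ is such that $a_{i_0}=2$, and $$M( B_{\mathbb{C}; a_1, \dots, a_n} ) = \begin{cases} \{ a_i : i \in I_1 \} \cup \{ \tfrac{a_ia_j}{4} : i,j \in I_2 \text{ and } i \neq j\} & \text{if } i_0 \text{ does not exist,} \\ \{ a_i : i \in I_1 \} \cup \{ \tfrac{a_i}{2} : i \in I_2 \setminus \{i_0\} \} & \text{if } i_0 \text{ exists.} \end{cases}$$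
   Context: Given $(a_1,\dots,a_n)\in(\mathbb{N}\setminus\{0\})^n$ with $n\ge3$: $L=\mathrm{lcm}(a_1,\dots,a_n)$, and $L_i=\mathrm{lcm}\{a_j : 1\le j\le n,\ j\neq i\}$ for each $i$. Let $D$ be the set of positive divisors of $\prod_{i=1}^n \frac{L}{L_i}$ and define $f:D\to(\mathbb{N}\setminus\{0\})^n$ by $f(d)=(a_1',\dots,a_n')$ where $a_i'=\gcd(a_i,L_i)\cdot\frac{L/L_i}{\gcd(d,\,L/L_i)}$ for $1\le i\le n$. For a field $\mathbf{k}$ of characteristic $0$, the Pham-Brieskorn ring is $B_{\mathbf{k};a_1,\dots,a_n}=\mathbf{k}[X_1,\dots,X_n]/(X_1^{a_1}+\cdots+X_n^{a_n})$, which is a normal domain. It is $\mathbb{N}$-graded by declaring that $X_i$ is homogeneous of degree $L/a_i$ for each $i$ (with $\mathbf{k}$ in degree $0$). $\Gamma_n$ is the set of $(a_1,\dots,a_n)\in(\mathbb{N}\setminus\{0\})^n$ such that $\min(a_1,\dots,a_n)>1$ and at most one $i\in\{1,\dots,n\}$ satisfies $a_i=2$. $\mathcal{P}(n)$ is the statement: for every $(a_1,\dots,a_n)\in\Gamma_n$, the ring $B_{\mathbb{C};a_1,\dots,a_n}$ is rigid. A derivation $\delta$ of a ring $R$ is locally nilpotent if for each $b\in R$ there is $m>0$ with $\delta^m(b)=0$; a ring is rigid if its only locally nilpotent derivation is $0$. For a $\mathbb{Z}$-graded ring $B=\bigoplus_{i\in\mathbb{Z}}B_i$ and $d\ge1$,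 $B^{(d)}=\bigoplus_{i\in d\mathbb{Z}}B_i$. For a $\mathbb{Z}$-graded domain $B$ of characteristic $0$, $\mathrm{NR}(B)=\{d\in\mathbb{N}\setminus\{0\}: B^{(d)}\text{ is non-rigid}\}$, and $M(B)$ is the set of maximal elements of the poset $(\mathrm{NR}(B),\preceq)$, where $d_1\preceq d_2\Leftrightarrow d_2\mid d_1$ (i.e. $M(B)$ consists of the elements of $\mathrm{NR}(B)$ that are minimal with respect to divisibility). *)

theory Defs
  imports
    "HOL.Complex"
    "HOL-Library.Poly_Mapping"
    "HOL-Algebra.QuotRing"
begin

section \<open>Locally nilpotent derivations and rigid rings\<close>

text \<open>
  Derivations are derivations of the underlying ring: additive maps satisfying the Leibniz rule,
  with no linearity over a base field imposed.  A map of the carrier to itself is represented by a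
  HOL function whose values outside the carrier are irrelevant.
\<close>

definition derivation :: "('a, 'b) ring_scheme \<Rightarrow> ('a \<Rightarrow> 'a) \<Rightarrow> bool" where
  "derivation R \<delta> \<longleftrightarrow>
     \<delta> \<in> carrier R \<rightarrow> carrier R \<and>
     (\<forall>x\<in>carrier R. \<forall>y\<in>carrier R. \<delta> (x \<oplus>\<^bsub>R\<^esub> y) = \<delta> x \<oplus>\<^bsub>R\<^esub> \<delta> y) \<and>
     (\<forall>x\<in>carrier R. \<forall>y\<in>carrier R.
        \<delta> (x \<otimes>\<^bsub>R\<^esub> y) = (\<delta> x \<otimes>\<^bsub>R\<^esub> y) \<oplus>\<^bsub>R\<^esub> (x \<otimes>\<^bsub>R\<^esub> \<delta> y))"

definition locally_nilpotent :: "('a, 'b) ring_scheme \<Rightarrow> ('a \<Rightarrow> 'a) \<Rightarrow> bool" where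
  "locally_nilpotent R \<delta> \<longleftrightarrow> (\<forall>b\<in>carrier R. \<exists>m>0. (\<delta> ^^ m) b = \<zero>\<^bsub>R\<^esub>)"

definition rigid :: "('a, 'b) ring_scheme \<Rightarrow> bool" where
  "rigid R \<longleftrightarrow>
     (\<forall>\<delta>. derivation R \<delta> \<and> locally_nilpotent R \<delta> \<longrightarrow> (\<forall>b\<in>carrier R. \<delta> b = \<zero>\<^bsub>R\<^esub>))"

section \<open>Veronese subrings of a graded ring\<close>

text \<open>
  A grading is given by its family of homogeneous components \<open>G :: int \<Rightarrow> 'a set\<close>; an element of
  the direct sum of the components with index in \<open>d\<int>\<close> is a finite sum of elements of them.
\<close>

definition veronese :: "'a ring \<Rightarrow> (int \<Rightarrow> 'a set) \<Rightarrow> nat \<Rightarrow> 'a ring" where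
  "veronese R G d = R\<lparr>carrier :=
     {\<Oplus>\<^bsub>R\<^esub>i\<in>S. x i | S x. finite S \<and> (\<forall>i\<in>S. int d dvd i \<and> x i \<in> G i)}\<rparr>"

definition NR :: "'a ring \<Rightarrow> (int \<Rightarrow> 'a set) \<Rightarrow> nat set" where
  "NR R G = {d. d > 0 \<and> \<not> rigid (veronese R G d)}"

definition M_set :: "'a ring \<Rightarrow> (int \<Rightarrow> 'a set) \<Rightarrow> nat set" where
  "M_set R G = {d \<in> NR R G. \<forall>e\<in>NR R G. e dvd d \<longrightarrow> e = d}"

section \<open>Pham--Brieskorn rings\<close>

text \<open>
  An \<open>n\<close>-tuple is a function on \<open>nat\<close> of which only the values on \<open>{1..n}\<close> are used.
  A polynomial is a finitely supported function from exponent vectors to coefficients.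
\<close>

type_synonym 'k mpoly = "(nat \<Rightarrow>\<^sub>0 nat) \<Rightarrow>\<^sub>0 'k"

definition poly_ring_vars :: "nat \<Rightarrow> 'k::field_char_0 mpoly ring" where
  "poly_ring_vars n =
     \<lparr>carrier = {p. \<forall>m\<in>Poly_Mapping.keys p. Poly_Mapping.keys m \<subseteq> {1..n}},
      mult = (*), one = 1, zero = 0, add = (+)\<rparr>"

definition pham_brieskorn_poly :: "nat \<Rightarrow> (nat \<Rightarrow> nat) \<Rightarrow> 'k::field_char_0 mpoly" where
  "pham_brieskorn_poly n a = (\<Sum>i=1..n. Poly_Mapping.single (Poly_Mapping.single i (a i)) 1)"

definition pham_brieskorn_ideal :: "nat \<Rightarrow> (nat \<Rightarrow> nat) \<Rightarrow> 'k::field_char_0 mpoly set" where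
  "pham_brieskorn_ideal n a = PIdl\<^bsub>poly_ring_vars n\<^esub> (pham_brieskorn_poly n a)"

definition pham_brieskorn :: "nat \<Rightarrow> (nat \<Rightarrow> nat) \<Rightarrow> 'k::field_char_0 mpoly set ring" where
  "pham_brieskorn n a = poly_ring_vars n Quot pham_brieskorn_ideal n a"

definition L_all :: "nat \<Rightarrow> (nat \<Rightarrow> nat) \<Rightarrow> nat" where
  "L_all n a = Lcm (a ` {1..n})"

definition L_omit :: "nat \<Rightarrow> (nat \<Rightarrow> nat) \<Rightarrow> nat \<Rightarrow> nat" where
  "L_omit n a i = Lcm (a ` ({1..n} - {i}))"

text \<open>
  The degree of the variable with index \<open>i\<close> is \<open>L_all n a div a i\<close>, and a homogeneous component
  of the quotient consists of the classes of the weighted homogeneous polynomials of that degree.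
\<close>

definition weighted_degree :: "nat \<Rightarrow> (nat \<Rightarrow> nat) \<Rightarrow> (nat \<Rightarrow>\<^sub>0 nat) \<Rightarrow> nat" where
  "weighted_degree n a m = (\<Sum>i=1..n. Poly_Mapping.lookup m i * (L_all n a div a i))"

definition pham_brieskorn_grading ::
    "nat \<Rightarrow> (nat \<Rightarrow> nat) \<Rightarrow> int \<Rightarrow> 'k::field_char_0 mpoly set set" where
  "pham_brieskorn_grading n a k =
     {pham_brieskorn_ideal n a +>\<^bsub>poly_ring_vars n\<^esub> p | p.
        p \<in> carrier (poly_ring_vars n) \<and>
        (\<forall>m\<in>Poly_Mapping.keys p. int (weighted_degree n a m) = k)}"

section \<open>The set of tuples, the rigidity statement and the map on divisors\<close>

definition Gamma_tuples :: "nat \<Rightarrow> (nat \<Rightarrow> nat) set" where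
  "Gamma_tuples n = {a. (\<forall>i\<in>{1..n}. a i > 1) \<and> (\<exists>\<^sub>\<le>\<^sub>1 i. i \<in> {1..n} \<and> a i = 2)}"

definition P_statement :: "nat \<Rightarrow> bool" where
  "P_statement n \<longleftrightarrow>
     (\<forall>a\<in>Gamma_tuples n. rigid (pham_brieskorn n a :: complex mpoly set ring))"

definition D_set :: "nat \<Rightarrow> (nat \<Rightarrow> nat) \<Rightarrow> nat set" where
  "D_set n a = {d. d > 0 \<and> d dvd (\<Prod>i=1..n. L_all n a div L_omit n a i)}"

definition f_map :: "nat \<Rightarrow> (nat \<Rightarrow> nat) \<Rightarrow> nat \<Rightarrow> (nat \<Rightarrow> nat)" where
  "f_map n a d =
     (\<lambda>i. gcd (a i) (L_omit n a i) *
          ((L_all n a div L_omit n a i) div gcd d (L_all n a div L_omit n a i)))"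

definition I_set :: "nat \<Rightarrow> (nat \<Rightarrow> nat) \<Rightarrow> nat \<Rightarrow> nat set" where
  "I_set n a \<nu> = {i \<in> {1..n}. gcd (a i) (L_omit n a i) = \<nu>}"

section \<open>Basic facts\<close>

lemma P_statement_imp_f_map_rigid:
  assumes "P_statement n"
  shows "\<forall>d\<in>D_set n a. f_map n a d \<in> Gamma_tuples n \<longrightarrow>
           rigid (pham_brieskorn n (f_map n a d) :: complex mpoly set ring)"
  using assms by (simp add: P_statement_def)

lemma poly_ring_vars_cring: "cring (poly_ring_vars n :: 'k::field_char_0 mpoly ring)"
proof -
  let ?R = "poly_ring_vars n :: 'k mpoly ring"
  have add: "p + q \<in> carrier ?R" if "p \<in> carrier ?R" "q \<in> carrier ?R" for p q
    using that keys_add[of p q] by (force simp: poly_ring_vars_def)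
  have mult: "p * q \<in> carrier ?R" if p: "p \<in> carrier ?R" and q: "q \<in> carrier ?R" for p q
  proof -
    have "Poly_Mapping.keys m \<subseteq> {1..n}" if m: "m \<in> Poly_Mapping.keys (p * q)" for m
    proof -
      obtain u v where uv: "m = u + v" "u \<in> Poly_Mapping.keys p" "v \<in> Poly_Mapping.keys q"
        using keys_mult[of p q] m by blast
      with p q have "Poly_Mapping.keys u \<subseteq> {1..n}" "Poly_Mapping.keys v \<subseteq> {1..n}"
        by (auto simp: poly_ring_vars_def)
      with keys_add[of u v] show ?thesis
        unfolding uv(1) by blast
    qed
    then show ?thesis by (auto simp: poly_ring_vars_def)
  qed
  have minus: "- p \<in> carrier ?R" if "p \<in> carrier ?R" for p
    using that by (simp add: poly_ring_vars_def)
  show ?thesis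
  proof (rule cringI)
    show "abelian_group ?R"
    proof (rule abelian_groupI)
      show "\<exists>y\<in>carrier ?R. y \<oplus>\<^bsub>?R\<^esub> x = \<zero>\<^bsub>?R\<^esub>" if "x \<in> carrier ?R" for x
        using minus[OF that] by (intro bexI[of _ "- x"]) (simp_all add: poly_ring_vars_def)
      show "x \<oplus>\<^bsub>?R\<^esub> y \<in> carrier ?R" if "x \<in> carrier ?R" "y \<in> carrier ?R" for x y
        using add[OF that] by (simp add: poly_ring_vars_def)
    qed (simp_all add: poly_ring_vars_def add_ac)
    show "comm_monoid ?R"
    proof (rule comm_monoidI)
      show "x \<otimes>\<^bsub>?R\<^esub> y \<in> carrier ?R" if "x \<in> carrier ?R" "y \<in> carrier ?R" for x y
        using mult[OF that] by (simp add: poly_ring_vars_def)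
    qed (simp_all add: poly_ring_vars_def mult_ac)
  qed (simp add: poly_ring_vars_def distrib_right)
qed

lemma pham_brieskorn_poly_in_carrier: "pham_brieskorn_poly n a \<in> carrier (poly_ring_vars n)"
proof -
  let ?t = "\<lambda>i. Poly_Mapping.single (Poly_Mapping.single i (a i)) (1::'a)"
  have "Poly_Mapping.keys (sum ?t {1..n}) \<subseteq> (\<Union>i\<in>{1..n}. Poly_Mapping.keys (?t i))"
    by (rule keys_sum)
  also have "\<dots> \<subseteq> (\<lambda>i. Poly_Mapping.single i (a i)) ` {1..n}"
    by auto
  finally have sub: "Poly_Mapping.keys (sum ?t {1..n}) \<subseteq>
      (\<lambda>i. Poly_Mapping.single i (a i)) ` {1..n}" .
  have "Poly_Mapping.keys m \<subseteq> {1..n}" if m: "m \<in> Poly_Mapping.keys (sum ?t {1..n})" for m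
  proof -
    obtain i where "i \<in> {1..n}" "m = Poly_Mapping.single i (a i)"
      using subsetD[OF sub m] by blast
    then show ?thesis
      by (simp split: if_splits)
  qed
  then show ?thesis
    unfolding pham_brieskorn_poly_def poly_ring_vars_def by simp
qed

lemma pham_brieskorn_cring: "cring (pham_brieskorn n a)"
  unfolding pham_brieskorn_def pham_brieskorn_ideal_def
  by (intro ideal.quotient_is_cring cring.cgenideal_ideal poly_ring_vars_cring
      pham_brieskorn_poly_in_carrier)

end

theory Submission
  imports Defs "HOL-Algebra.Algebraic_Closure_Type" "HOL-Number_Theory.Cong"
begin

text \<open>
  Put \<open>e\<^sub>i = L / L\<^sub>i\<close>, \<open>g\<^sub>i = gcd(d, e\<^sub>i)\<close> and let \<open>G\<close> be the product of the \<open>g\<^sub>i\<close>.  As \<open>e\<^sub>i\<close> divides the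
  degree of \<open>X\<^sub>j\<close> for all \<open>j \<noteq> i\<close> and is coprime to the degree of \<open>X\<^sub>i\<close>, every monomial of degree
  divisible by \<open>d\<close> is a monomial in the powers \<open>X\<^sub>i ^ g\<^sub>i\<close>.  These powers generate a copy \<open>B'\<close> of the
  Pham--Brieskorn ring of \<open>f(d)\<close>, and \<open>B\<^sup>(\<^sup>d\<^sup>)\<close> is the part of \<open>B'\<close> of degree zero for a grading by the
  integers modulo \<open>m = d / G\<close> in which the degrees of any \<open>n - 1\<close> of the variables generate.

  A locally nilpotent derivation \<open>\<delta>\<close> of the degree zero part extends to \<open>B'\<close>: on a homogeneous \<open>b\<close> it
  has to be \<open>D b = \<delta>(b ^ m) / (m b ^ (m - 1))\<close>, and for every \<open>i\<close> some monomial \<open>u\<close> not involving \<open>X\<^sub>i\<close>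
  has degree opposite to that of \<open>b\<close>, so that \<open>D b\<close> is an element of \<open>B'\<close> divided by a power of \<open>u\<close>.
  Since any two variables form a regular sequence, \<open>D b\<close> lies in \<open>B'\<close>.  Counting degrees with respect to
  \<open>\<delta>\<close>, \<open>D\<close> is again locally nilpotent.  Hence \<open>B\<^sup>(\<^sup>d\<^sup>)\<close> is rigid whenever \<open>B'\<close> is.  Conversely, for \<open>d \<in> D\<close>
  we have \<open>B\<^sup>(\<^sup>d\<^sup>) = B'\<close>, and \<open>B'\<close> has explicit locally nilpotent derivations when \<open>f(d)\<close> is not in \<open>\<Gamma>\<^sub>n\<close>.
  Finally the \<open>e\<^sub>i\<close> are pairwise coprime, so the minimal \<open>d\<close> with \<open>f(d)\<close> outside \<open>\<Gamma>\<^sub>n\<close> can be read off.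

  All computations take place in a field containing the Pham--Brieskorn ring.
\<close>

section \<open>Evaluation of polynomials\<close>

text \<open>Homomorphisms between whole types. Apart from the passage to and from the quotient rings
  of the statement, the work is done in commutative rings given by type classes.\<close>

definition ring_map :: "('a::comm_ring_1 \<Rightarrow> 'b::comm_ring_1) \<Rightarrow> bool" where
  "ring_map f \<longleftrightarrow> f 1 = 1 \<and> (\<forall>x y. f (x + y) = f x + f y) \<and> (\<forall>x y. f (x * y) = f x * f y)"

lemma ring_mapI:
  "f 1 = 1 \<Longrightarrow> (\<And>x y. f (x + y) = f x + f y) \<Longrightarrow> (\<And>x y. f (x * y) = f x * f y) \<Longrightarrow> ring_map f"
  by (simp add: ring_map_def)

lemma ring_map_one: "ring_map f \<Longrightarrow> f 1 = 1"
  and ring_map_add: "ring_map f \<Longrightarrow> f (x + y) = f x + f y"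
  and ring_map_mult: "ring_map f \<Longrightarrow> f (x * y) = f x * f y"
  by (simp_all add: ring_map_def)

lemma ring_map_zero: "ring_map f \<Longrightarrow> f 0 = 0"
  using ring_map_add[of f 0 0] by simp

lemma ring_map_uminus: "ring_map f \<Longrightarrow> f (- x) = - f x"
  using ring_map_add[of f x "- x"] by (simp add: ring_map_zero eq_neg_iff_add_eq_0 add.commute)

lemma ring_map_diff: "ring_map f \<Longrightarrow> f (x - y) = f x - f y"
  using ring_map_add[of f x "- y"] by (simp add: ring_map_uminus)

lemma ring_map_power: "ring_map f \<Longrightarrow> f (x ^ k) = f x ^ k"
  by (induction k) (simp_all add: ring_map_one ring_map_mult)

lemma ring_map_sum: "ring_map f \<Longrightarrow> f (sum g A) = (\<Sum>x\<in>A. f (g x))"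
  by (induction A rule: infinite_finite_induct) (simp_all add: ring_map_zero ring_map_add)

lemma ring_map_prod: "ring_map f \<Longrightarrow> f (prod g A) = (\<Prod>x\<in>A. f (g x))"
  by (induction A rule: infinite_finite_induct) (simp_all add: ring_map_one ring_map_mult)

lemmas ring_map_simps = ring_map_zero ring_map_one ring_map_add ring_map_mult ring_map_uminus
  ring_map_diff ring_map_power ring_map_sum ring_map_prod

lemma ring_map_comp: "ring_map f \<Longrightarrow> ring_map g \<Longrightarrow> ring_map (\<lambda>x. f (g x))"
  by (simp add: ring_map_def)

definition Var :: "nat \<Rightarrow> 'k::comm_ring_1 mpoly" where
  "Var i = Poly_Mapping.single (Poly_Mapping.single i 1) 1"

definition Const :: "'k::comm_ring_1 \<Rightarrow> 'k mpoly" where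
  "Const c = Poly_Mapping.single 0 c"

definition mono_val :: "(nat \<Rightarrow> 'b::comm_ring_1) \<Rightarrow> (nat \<Rightarrow>\<^sub>0 nat) \<Rightarrow> 'b" where
  "mono_val x m = (\<Prod>i\<in>Poly_Mapping.keys m. x i ^ Poly_Mapping.lookup m i)"

text \<open>The coefficients are moved by \<open>c\<close> as well, so that one definition serves
  for substituting polynomials, for evaluating in a field and for singling out one variable.\<close>

definition insertion :: "('k::comm_ring_1 \<Rightarrow> 'b::comm_ring_1) \<Rightarrow> (nat \<Rightarrow> 'b) \<Rightarrow> 'k mpoly \<Rightarrow> 'b" where
  "insertion c x p = (\<Sum>m\<in>Poly_Mapping.keys p. c (Poly_Mapping.lookup p m) * mono_val x m)"

lemma ring_map_Const: "ring_map (Const :: 'k::comm_ring_1 \<Rightarrow> 'k mpoly)"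
  by (auto simp: ring_map_def Const_def single_add mult_single)

lemma Var_power: "Var i ^ k = Poly_Mapping.single (Poly_Mapping.single i k) 1"
  by (induction k) (simp_all add: Var_def mult_single flip: single_add)

lemma mono_val_superset:
  assumes "finite S" "Poly_Mapping.keys m \<subseteq> S"
  shows "mono_val x m = (\<Prod>i\<in>S. x i ^ Poly_Mapping.lookup m i)"
  unfolding mono_val_def using assms
  by (intro prod.mono_neutral_left) (auto simp: in_keys_iff)

lemma mono_val_add: "mono_val x (m + m') = mono_val x m * mono_val x m'"
proof -
  let ?S = "Poly_Mapping.keys m \<union> Poly_Mapping.keys m'"
  have "mono_val x (m + m') = (\<Prod>i\<in>?S. x i ^ Poly_Mapping.lookup (m + m') i)"
    using keys_add[of m m'] by (intro mono_val_superset) auto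
  also have "\<dots> = (\<Prod>i\<in>?S. x i ^ Poly_Mapping.lookup m i) * (\<Prod>i\<in>?S. x i ^ Poly_Mapping.lookup m' i)"
    by (simp add: lookup_add power_add prod.distrib)
  also have "\<dots> = mono_val x m * mono_val x m'"
    by (simp add: mono_val_superset[of ?S])
  finally show ?thesis .
qed

lemma mono_val_zero [simp]: "mono_val x 0 = 1"
  by (simp add: mono_val_def)

lemma mono_val_single [simp]: "mono_val x (Poly_Mapping.single i k) = x i ^ k"
  by (cases "k = 0") (simp_all add: mono_val_def)

lemma sum_single_keys:
  "(\<Sum>m\<in>Poly_Mapping.keys p. Poly_Mapping.single m (Poly_Mapping.lookup p m)) = p"
  by (rule poly_mapping_eqI)
    (simp add: lookup_sum lookup_single when_def in_keys_iff)

lemma single_sum_exponents: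
  "Poly_Mapping.single (\<Sum>i\<in>A. f i) (1::'k::comm_ring_1) = (\<Prod>i\<in>A. Poly_Mapping.single (f i :: nat \<Rightarrow>\<^sub>0 nat) 1)"
proof (induction A rule: infinite_finite_induct)
  case (insert x F)
  then show ?case
    using mult_single[of "f x" "1::'k" "sum f F" 1] by simp
qed simp_all

lemma mono_val_Var: "mono_val Var m = Poly_Mapping.single m 1"
  using single_sum_exponents[of "\<lambda>i. Poly_Mapping.single i (Poly_Mapping.lookup m i)" "Poly_Mapping.keys m"]
  unfolding sum_single_keys mono_val_def Var_power by (rule sym)

lemma single_eq_mono: "Poly_Mapping.single m c = Const c * mono_val Var m"
  by (simp add: mono_val_Var Const_def mult_single)

lemma insertion_superset:
  assumes "c 0 = 0" "finite S" "Poly_Mapping.keys p \<subseteq> S"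
  shows "insertion c x p = (\<Sum>m\<in>S. c (Poly_Mapping.lookup p m) * mono_val x m)"
  unfolding insertion_def using assms
  by (intro sum.mono_neutral_left) (auto simp: in_keys_iff)

lemma insertion_add:
  assumes "ring_map c"
  shows "insertion c x (p + q) = insertion c x p + insertion c x q"
proof -
  let ?S = "Poly_Mapping.keys p \<union> Poly_Mapping.keys q"
  have "insertion c x (p + q) = (\<Sum>m\<in>?S. c (Poly_Mapping.lookup (p + q) m) * mono_val x m)"
    using keys_add[of p q] assms by (intro insertion_superset) (auto simp: ring_map_zero)
  also have "\<dots> = (\<Sum>m\<in>?S. c (Poly_Mapping.lookup p m) * mono_val x m)
      + (\<Sum>m\<in>?S. c (Poly_Mapping.lookup q m) * mono_val x m)"
    using assms by (simp add: lookup_add ring_map_add distrib_right sum.distrib)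
  also have "\<dots> = insertion c x p + insertion c x q"
    using assms by (simp add: insertion_superset[of c ?S] ring_map_zero)
  finally show ?thesis .
qed

lemma insertion_sum: "ring_map c \<Longrightarrow> insertion c x (sum f A) = (\<Sum>i\<in>A. insertion c x (f i))"
  by (induction A rule: infinite_finite_induct) (simp_all add: insertion_add, simp_all add: insertion_def)

lemma insertion_single: "ring_map c \<Longrightarrow> insertion c x (Poly_Mapping.single m k) = c k * mono_val x m"
  by (cases "k = 0") (simp_all add: insertion_def ring_map_zero)

lemma mult_eq_sum_single:
  "p * q = (\<Sum>m\<in>Poly_Mapping.keys p. \<Sum>m'\<in>Poly_Mapping.keys q.
     Poly_Mapping.single (m + m') (Poly_Mapping.lookup p m * Poly_Mapping.lookup q m'))"
proof -
  have "p * q = (\<Sum>m\<in>Poly_Mapping.keys p. Poly_Mapping.single m (Poly_Mapping.lookup p m)) *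
      (\<Sum>m\<in>Poly_Mapping.keys q. Poly_Mapping.single m (Poly_Mapping.lookup q m))"
    by (simp only: sum_single_keys)
  then show ?thesis
    by (simp only: sum_product mult_single)
qed

lemma insertion_mult:
  assumes "ring_map c"
  shows "insertion c x (p * q) = insertion c x p * insertion c x q"
proof -
  have "insertion c x (p * q) = (\<Sum>m\<in>Poly_Mapping.keys p. \<Sum>m'\<in>Poly_Mapping.keys q.
     c (Poly_Mapping.lookup p m * Poly_Mapping.lookup q m') * mono_val x (m + m'))"
    using assms by (simp add: mult_eq_sum_single[of p q] insertion_sum insertion_single)
  also have "\<dots> = insertion c x p * insertion c x q"
    using assms by (simp add: insertion_def sum_product mono_val_add ring_map_mult algebra_simps)
  finally show ?thesis .
qed

lemma ring_map_insertion:
  assumes "ring_map c"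
  shows "ring_map (insertion c x)"
proof (rule ring_mapI)
  show "insertion c x 1 = 1"
    using insertion_single[OF assms, of x 0 1] assms by (simp add: ring_map_one)
qed (simp_all add: assms insertion_add insertion_mult)

lemma insertion_Var [simp]: "ring_map c \<Longrightarrow> insertion c x (Var i) = x i"
  by (simp add: Var_def insertion_single ring_map_one)

lemma insertion_Const [simp]: "ring_map c \<Longrightarrow> insertion c x (Const k) = c k"
  by (simp add: Const_def insertion_single)

lemma ring_map_eq_insertion:
  assumes "ring_map f"
  shows "f p = insertion (\<lambda>k. f (Const k)) (\<lambda>i. f (Var i)) p"
proof -
  have "f p = f (\<Sum>m\<in>Poly_Mapping.keys p. Poly_Mapping.single m (Poly_Mapping.lookup p m))"
    by (simp only: sum_single_keys)
  then show ?thesis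
    by (simp add: single_eq_mono ring_map_simps[OF assms] insertion_def mono_val_def)
qed

text \<open>Constants and variables generate the polynomial ring. Only the variables that occur in
  \<open>p\<close> are compared, because some of the maps below agree only on polynomials free of
  one variable.\<close>

lemma ring_map_eqI:
  assumes "ring_map f" "ring_map g" "\<And>k. f (Const k) = g (Const k)"
    and "\<And>m i. m \<in> Poly_Mapping.keys p \<Longrightarrow> i \<in> Poly_Mapping.keys m \<Longrightarrow> f (Var i) = g (Var i)"
  shows "f p = g p"
  unfolding ring_map_eq_insertion[OF assms(1), of p] ring_map_eq_insertion[OF assms(2), of p]
  using assms(3,4) by (auto simp: insertion_def mono_val_def intro!: sum.cong prod.cong)

section \<open>Polynomials supported on a set of monomials\<close>

text \<open>One notion for restrictions on the variables, on the degree modulo an integer and on the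
  divisibility of exponents.\<close>

definition supp_on :: "((nat \<Rightarrow>\<^sub>0 nat) \<Rightarrow> bool) \<Rightarrow> 'k::comm_ring_1 mpoly set" where
  "supp_on Q = {p. \<forall>m\<in>Poly_Mapping.keys p. Q m}"

definition part :: "((nat \<Rightarrow>\<^sub>0 nat) \<Rightarrow> bool) \<Rightarrow> 'k::comm_ring_1 mpoly \<Rightarrow> 'k mpoly" where
  "part Q p = (\<Sum>m | m \<in> Poly_Mapping.keys p \<and> Q m. Poly_Mapping.single m (Poly_Mapping.lookup p m))"

lemma lookup_part: "Poly_Mapping.lookup (part Q p) m = (if Q m then Poly_Mapping.lookup p m else 0)"
proof -
  have "finite {m. m \<in> Poly_Mapping.keys p \<and> Q m}"
    by simp
  then show ?thesis
    by (simp add: part_def lookup_sum lookup_single when_def in_keys_iff)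
qed

lemma keys_part: "Poly_Mapping.keys (part Q p) = {m \<in> Poly_Mapping.keys p. Q m}"
  by (auto simp: in_keys_iff lookup_part split: if_splits)

lemma part_in_supp_on: "part Q p \<in> supp_on Q"
  by (simp add: supp_on_def keys_part)

lemma part_id: "p \<in> supp_on Q \<Longrightarrow> part Q p = p"
  by (rule poly_mapping_eqI) (auto simp: lookup_part supp_on_def in_keys_iff)

lemma part_add: "part Q (p + q) = part Q p + part Q q"
  by (rule poly_mapping_eqI) (simp add: lookup_part lookup_add)

lemma part_diff: "part Q (p - q) = part Q p - part Q q"
  by (rule poly_mapping_eqI) (simp add: lookup_part lookup_minus)

lemma part_zero [simp]: "part Q 0 = 0"
  by (rule poly_mapping_eqI) (simp add: lookup_part)

lemma part_sum: "part Q (sum f A) = (\<Sum>i\<in>A. part Q (f i))"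
  by (induction A rule: infinite_finite_induct) (simp_all add: part_add)

lemma part_single: "part Q (Poly_Mapping.single m c) = (if Q m then Poly_Mapping.single m c else 0)"
  by (rule poly_mapping_eqI) (auto simp: lookup_part lookup_single when_def)

text \<open>If multiplication by any monomial of \<open>f\<close> turns the condition
  \<open>Q'\<close> into \<open>Q\<close>, then \<open>f\<close> can be pulled out of the
  projection. Hence the cofactor of a homogeneous divisor may be cut down to its part of the right
  degree.\<close>

lemma part_mult:
  assumes "\<And>m m'. m \<in> Poly_Mapping.keys f \<Longrightarrow> Q (m + m') \<longleftrightarrow> Q' m'"
  shows "part Q (f * q) = f * part Q' q"
proof -
  have "part Q (f * q) = (\<Sum>m\<in>Poly_Mapping.keys f. \<Sum>m'\<in>Poly_Mapping.keys q.
     Poly_Mapping.single m (Poly_Mapping.lookup f m) *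
     part Q' (Poly_Mapping.single m' (Poly_Mapping.lookup q m')))"
    unfolding mult_eq_sum_single[of f q] part_sum
    by (intro sum.cong refl) (simp add: part_single mult_single assms)
  also have "\<dots> = (\<Sum>m\<in>Poly_Mapping.keys f. Poly_Mapping.single m (Poly_Mapping.lookup f m)) *
     part Q' (\<Sum>m'\<in>Poly_Mapping.keys q. Poly_Mapping.single m' (Poly_Mapping.lookup q m'))"
    by (simp only: part_sum sum_product)
  finally show ?thesis
    by (simp only: sum_single_keys)
qed

lemma supp_on_zero: "0 \<in> supp_on Q"
  by (simp add: supp_on_def)

lemma supp_on_add: "p \<in> supp_on Q \<Longrightarrow> q \<in> supp_on Q \<Longrightarrow> p + q \<in> supp_on Q"
  using keys_add[of p q] by (auto simp: supp_on_def)

lemma supp_on_diff: "p \<in> supp_on Q \<Longrightarrow> q \<in> supp_on Q \<Longrightarrow> p - q \<in> supp_on Q"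
  using keys_diff[of p q] by (auto simp: supp_on_def)

lemma supp_on_mult:
  assumes "p \<in> supp_on Q" "q \<in> supp_on Q'" "\<And>m m'. Q m \<Longrightarrow> Q' m' \<Longrightarrow> Q'' (m + m')"
  shows "p * q \<in> supp_on Q''"
  using keys_mult[of p q] assms by (force simp: supp_on_def)

lemma supp_on_sum: "(\<And>i. i \<in> A \<Longrightarrow> f i \<in> supp_on Q) \<Longrightarrow> sum f A \<in> supp_on Q"
  by (induction A rule: infinite_finite_induct) (auto intro: supp_on_add supp_on_zero)

lemma supp_on_single: "Q m \<Longrightarrow> Poly_Mapping.single m c \<in> supp_on Q"
  by (simp add: supp_on_def)

lemma supp_on_part: "p \<in> supp_on Q \<Longrightarrow> part Q' p \<in> supp_on Q"
  by (simp add: supp_on_def keys_part)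

lemma sum_part_residues:
  assumes "finite K" "\<And>m. m \<in> Poly_Mapping.keys p \<Longrightarrow> w m \<in> K"
  shows "(\<Sum>k\<in>K. part (\<lambda>m. w m = k) p) = p"
proof (rule poly_mapping_eqI)
  fix m
  have "Poly_Mapping.lookup (\<Sum>k\<in>K. part (\<lambda>m. w m = k) p) m =
      (\<Sum>k\<in>K. if w m = k then Poly_Mapping.lookup p m else 0)"
    by (simp add: lookup_sum lookup_part)
  also have "\<dots> = (if w m \<in> K then Poly_Mapping.lookup p m else 0)"
    using assms(1) by simp
  also have "\<dots> = Poly_Mapping.lookup p m"
    using assms(2)[of m] by (auto simp: in_keys_iff)
  finally show "Poly_Mapping.lookup (\<Sum>k\<in>K. part (\<lambda>m. w m = k) p) m = Poly_Mapping.lookup p m" .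
qed

abbreviation vars_in :: "nat set \<Rightarrow> 'k::comm_ring_1 mpoly set" where
  "vars_in V \<equiv> supp_on (\<lambda>m. Poly_Mapping.keys m \<subseteq> V)"

lemma vars_in_mult: "p \<in> vars_in V \<Longrightarrow> q \<in> vars_in V \<Longrightarrow> p * q \<in> vars_in V"
proof (rule supp_on_mult)
  show "Poly_Mapping.keys (m + m') \<subseteq> V"
    if "Poly_Mapping.keys m \<subseteq> V" "Poly_Mapping.keys m' \<subseteq> V" for m m'
    using keys_add[of m m'] that by auto
qed

lemma vars_in_Const: "Const c \<in> vars_in V"
  by (simp add: Const_def supp_on_single)

lemma vars_in_one: "1 \<in> vars_in V"
  using vars_in_Const[of 1 V] by (simp add: Const_def)

lemma vars_in_Var: "i \<in> V \<Longrightarrow> Var i \<in> vars_in V"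
  by (simp add: Var_def supp_on_single)

lemma vars_in_power: "p \<in> vars_in V \<Longrightarrow> p ^ k \<in> vars_in V"
  by (induction k) (simp_all add: vars_in_one vars_in_mult)

lemma vars_in_prod: "(\<And>i. i \<in> A \<Longrightarrow> f i \<in> vars_in V) \<Longrightarrow> prod f A \<in> vars_in V"
  by (induction A rule: infinite_finite_induct) (simp_all add: vars_in_one vars_in_mult)

lemma carrier_poly_ring_vars: "carrier (poly_ring_vars n) = vars_in {1..n}"
  by (simp add: poly_ring_vars_def supp_on_def)

lemma insertion_in_vars_in:
  assumes "\<And>m i. m \<in> Poly_Mapping.keys p \<Longrightarrow> i \<in> Poly_Mapping.keys m \<Longrightarrow> x i \<in> vars_in V"
  shows "insertion Const x p \<in> vars_in V"
  unfolding insertion_def mono_val_def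
  using assms by (intro supp_on_sum vars_in_mult vars_in_Const vars_in_prod vars_in_power)

lemma ring_map_eq_on_vars_in:
  assumes "ring_map f" "ring_map g" "\<And>k. f (Const k) = g (Const k)"
    and "\<And>i. i \<in> V \<Longrightarrow> f (Var i) = g (Var i)" "p \<in> vars_in V"
  shows "f p = g p"
  by (rule ring_map_eqI[of f g]) (use assms in \<open>auto simp: supp_on_def\<close>)

lemma insertion_id_on_vars_in:
  assumes "\<And>i. i \<in> V \<Longrightarrow> x i = Var i" "p \<in> vars_in V"
  shows "insertion Const x p = p"
  using ring_map_eq_on_vars_in[of "insertion Const x" "\<lambda>p. p" V p] assms
  by (simp add: ring_map_Const ring_map_insertion ring_map_def[of "\<lambda>p. p"])

section \<open>Extending locally nilpotent derivations along a cyclic grading\<close>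

text \<open>Derivations on subsets of a ring type. All rings in question will be subsets of one
  field, where quotients can be formed.\<close>

definition lnd_on :: "'a::comm_ring_1 set \<Rightarrow> ('a \<Rightarrow> 'a) \<Rightarrow> bool" where
  "lnd_on A \<delta> \<longleftrightarrow> \<delta> \<in> A \<rightarrow> A \<and> (\<forall>x\<in>A. \<forall>y\<in>A. \<delta> (x + y) = \<delta> x + \<delta> y) \<and>
     (\<forall>x\<in>A. \<forall>y\<in>A. \<delta> (x * y) = \<delta> x * y + x * \<delta> y) \<and> (\<forall>x\<in>A. \<exists>N>0. (\<delta> ^^ N) x = 0)"

definition rigid_on :: "'a::comm_ring_1 set \<Rightarrow> bool" where
  "rigid_on A \<longleftrightarrow> (\<forall>\<delta>. lnd_on A \<delta> \<longrightarrow> (\<forall>x\<in>A. \<delta> x = 0))"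

section \<open>The degree function of a locally nilpotent derivation\<close>

locale lnd_subring =
  fixes A :: "'a::field_char_0 set" and \<delta> :: "'a \<Rightarrow> 'a"
  assumes zero_mem: "0 \<in> A" and one_mem: "1 \<in> A"
    and add_mem: "x \<in> A \<Longrightarrow> y \<in> A \<Longrightarrow> x + y \<in> A"
    and mult_mem: "x \<in> A \<Longrightarrow> y \<in> A \<Longrightarrow> x * y \<in> A"
    and lnd: "lnd_on A \<delta>"
begin

lemma delta_mem: "x \<in> A \<Longrightarrow> \<delta> x \<in> A"
  and delta_add: "x \<in> A \<Longrightarrow> y \<in> A \<Longrightarrow> \<delta> (x + y) = \<delta> x + \<delta> y"
  and delta_mult: "x \<in> A \<Longrightarrow> y \<in> A \<Longrightarrow> \<delta> (x * y) = \<delta> x * y + x * \<delta> y"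
  using lnd by (auto simp: lnd_on_def)

lemma delta_zero: "\<delta> 0 = 0"
  using delta_add[of 0 0] zero_mem by simp

lemma delta_one: "\<delta> 1 = 0"
  using delta_mult[of 1 1] one_mem by simp

lemma power_mem: "x \<in> A \<Longrightarrow> x ^ k \<in> A"
  by (induction k) (simp_all add: one_mem mult_mem)

lemma of_nat_mem: "of_nat k \<in> A"
  by (induction k) (simp_all add: one_mem zero_mem add_mem)

lemma sum_mem: "(\<And>i. i \<in> I \<Longrightarrow> f i \<in> A) \<Longrightarrow> sum f I \<in> A"
  by (induction I rule: infinite_finite_induct) (simp_all add: zero_mem add_mem)

lemma delta_sum: "(\<And>i. i \<in> I \<Longrightarrow> f i \<in> A) \<Longrightarrow> \<delta> (sum f I) = (\<Sum>i\<in>I. \<delta> (f i))"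
  by (induction I rule: infinite_finite_induct) (simp_all add: delta_zero delta_add sum_mem)

lemma delta_of_nat: "\<delta> (of_nat k) = 0"
  by (induction k) (simp_all add: delta_zero delta_add delta_one one_mem of_nat_mem)

lemma delta_power: "x \<in> A \<Longrightarrow> \<delta> (x ^ k) = of_nat k * x ^ (k - 1) * \<delta> x"
proof (induction k)
  case (Suc k)
  then show ?case
    by (cases k) (simp_all add: delta_mult power_mem mult_mem algebra_simps)
qed (simp add: delta_one)

lemma iter_mem: "x \<in> A \<Longrightarrow> (\<delta> ^^ k) x \<in> A"
  by (induction k) (simp_all add: delta_mem)

lemma iter_zero: "(\<delta> ^^ k) 0 = 0"
  by (induction k) (simp_all add: delta_zero)

lemma iter_zero_mono:
  assumes "(\<delta> ^^ k) x = 0" "k \<le> l"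
  shows "(\<delta> ^^ l) x = 0"
proof -
  have "(\<delta> ^^ l) x = (\<delta> ^^ (l - k)) ((\<delta> ^^ k) x)"
    using assms(2) by (simp flip: funpow_add comp_apply[of "\<delta> ^^ (l - k)"])
  then show ?thesis
    using assms(1) by (simp add: iter_zero)
qed

lemma iter_mult:
  assumes "x \<in> A" "y \<in> A"
  shows "(\<delta> ^^ N) (x * y) = (\<Sum>i\<le>N. of_nat (N choose i) * (\<delta> ^^ i) x * (\<delta> ^^ (N - i)) y)"
proof (induction N)
  case (Suc N)
  let ?X = "\<lambda>i. (\<delta> ^^ i) x" and ?Y = "\<lambda>i. (\<delta> ^^ i) y"
  have mem: "?X i \<in> A" "?Y i \<in> A" for i
    using assms by (simp_all add: iter_mem)
  have "(\<delta> ^^ Suc N) (x * y) = \<delta> (\<Sum>i\<le>N. of_nat (N choose i) * ?X i * ?Y (N - i))"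
    by (simp add: Suc)
  also have "\<dots> = (\<Sum>i\<le>N. \<delta> (of_nat (N choose i) * ?X i * ?Y (N - i)))"
    by (intro delta_sum mult_mem of_nat_mem mem)
  also have "\<dots> = (\<Sum>i\<le>N. of_nat (N choose i) * ?X (Suc i) * ?Y (N - i)
       + of_nat (N choose i) * ?X i * ?Y (Suc (N - i)))"
    by (intro sum.cong refl) (simp add: delta_mult mult_mem of_nat_mem mem delta_of_nat)
  also have "\<dots> = (\<Sum>i\<le>N. of_nat (N choose i) * ?X (Suc i) * ?Y (N - i))
       + (\<Sum>i\<le>N. of_nat (N choose i) * ?X i * ?Y (Suc N - i))"
    unfolding sum.distrib by (intro arg_cong2[of _ _ _ _ plus] sum.cong refl) (simp add: Suc_diff_le)
  also have "(\<Sum>i\<le>N. of_nat (N choose i) * ?X (Suc i) * ?Y (N - i)) =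
      (\<Sum>i\<in>{1..Suc N}. of_nat (N choose (i - 1)) * ?X i * ?Y (Suc N - i))"
    by (rule sum.reindex_bij_witness[of _ "\<lambda>i. i - 1" Suc]) auto
  also have "\<dots> = (\<Sum>i\<le>Suc N. (if i = 0 then 0 else of_nat (N choose (i - 1))) * ?X i * ?Y (Suc N - i))"
    by (intro sum.mono_neutral_cong_left) auto
  also have "(\<Sum>i\<le>N. of_nat (N choose i) * ?X i * ?Y (Suc N - i)) =
      (\<Sum>i\<le>Suc N. of_nat (N choose i) * ?X i * ?Y (Suc N - i))"
    by (intro sum.mono_neutral_left) (auto simp: binomial_eq_0)
  \<comment> \<open>With the first sum shifted by one, the coefficients add up by Pascal's rule; the
    \<open>if\<close> stands for the missing binomial coefficient at index -1.\<close>
  also have "(\<Sum>i\<le>Suc N. (if i = 0 then 0 else of_nat (N choose (i - 1))) * ?X i * ?Y (Suc N - i)) + \<dots>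
      = (\<Sum>i\<le>Suc N. of_nat (Suc N choose i) * ?X i * ?Y (Suc N - i))"
    unfolding sum.distrib[symmetric]
  proof (intro sum.cong refl)
    fix i
    show "(if i = 0 then 0 else of_nat (N choose (i - 1))) * ?X i * ?Y (Suc N - i)
        + of_nat (N choose i) * ?X i * ?Y (Suc N - i)
        = of_nat (Suc N choose i) * ?X i * ?Y (Suc N - i)"
      by (cases i) (simp_all add: algebra_simps)
  qed
  finally show ?case .
qed simp

text \<open>For nonzero \<open>x\<close> this is the last order at which the iterate of
  \<open>\<delta>\<close> does not vanish. The value at 0 is 0 instead of minus infinity, hence the
  hypotheses that elements are nonzero.\<close>

definition ddeg :: "'a \<Rightarrow> nat" where
  "ddeg x = (LEAST k. (\<delta> ^^ Suc k) x = 0)"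

lemma iter_Suc_ddeg:
  assumes "x \<in> A"
  shows "(\<delta> ^^ Suc (ddeg x)) x = 0"
proof -
  obtain N where "N > 0" "(\<delta> ^^ N) x = 0"
    using lnd assms by (auto simp: lnd_on_def)
  then have "(\<delta> ^^ Suc (N - 1)) x = 0"
    by simp
  then show ?thesis
    unfolding ddeg_def by (rule LeastI)
qed

lemma iter_ddeg:
  assumes "x \<noteq> 0"
  shows "(\<delta> ^^ ddeg x) x \<noteq> 0"
proof (cases "ddeg x")
  case (Suc k)
  show ?thesis
  proof
    assume "(\<delta> ^^ ddeg x) x = 0"
    then have "(LEAST k. (\<delta> ^^ Suc k) x = 0) \<le> k"
      unfolding Suc by (rule Least_le)
    then have "ddeg x \<le> k"
      by (simp only: ddeg_def)
    with Suc show False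
      by simp
  qed
qed (simp add: assms)

lemma ddeg_eqI:
  assumes "(\<delta> ^^ k) x \<noteq> 0" "(\<delta> ^^ Suc k) x = 0"
  shows "ddeg x = k"
  unfolding ddeg_def
proof (rule Least_equality)
  show "k \<le> l" if "(\<delta> ^^ Suc l) x = 0" for l
    using iter_zero_mono[OF that, of k] assms(1) by (meson not_less_eq_eq)
qed (rule assms(2))

lemma ddeg_of_nat: "k > 0 \<Longrightarrow> ddeg (of_nat k) = 0"
  by (rule ddeg_eqI) (simp_all add: delta_of_nat)

text \<open>In the general Leibniz rule of order \<open>ddeg x + ddeg y\<close> only the term with
  \<open>i = ddeg x\<close> survives. It is nonzero because the values lie in a field of
  characteristic zero. One order higher, every term vanishes.\<close>

lemma ddeg_mult:
  assumes "x \<in> A" "y \<in> A" "x \<noteq> 0" "y \<noteq> 0"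
  shows "ddeg (x * y) = ddeg x + ddeg y"
proof (rule ddeg_eqI)
  have van: "(\<delta> ^^ i) x * (\<delta> ^^ j) y = 0" if "i > ddeg x \<or> j > ddeg y" for i j
    using that iter_zero_mono[OF iter_Suc_ddeg[OF assms(1)], of i]
      iter_zero_mono[OF iter_Suc_ddeg[OF assms(2)], of j] by auto
  let ?t = "\<lambda>N i. of_nat (N choose i) * (\<delta> ^^ i) x * (\<delta> ^^ (N - i)) y"
  have "(\<Sum>i\<le>ddeg x + ddeg y. ?t (ddeg x + ddeg y) i) =
      (\<Sum>i\<in>{ddeg x}. ?t (ddeg x + ddeg y) i)"
  proof (intro sum.mono_neutral_right ballI)
    fix i assume "i \<in> {..ddeg x + ddeg y} - {ddeg x}"
    then have "i > ddeg x \<or> ddeg x + ddeg y - i > ddeg y"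
      by auto
    then show "?t (ddeg x + ddeg y) i = 0"
      by (simp only: van mult.assoc mult_zero_right)
  qed auto
  then show "(\<delta> ^^ (ddeg x + ddeg y)) (x * y) \<noteq> 0"
    using iter_ddeg assms by (simp add: iter_mult)
  have "(\<Sum>i\<le>Suc (ddeg x + ddeg y). ?t (Suc (ddeg x + ddeg y)) i) = 0"
  proof (rule sum.neutral, rule ballI)
    fix i assume "i \<in> {..Suc (ddeg x + ddeg y)}"
    then have "i > ddeg x \<or> Suc (ddeg x + ddeg y) - i > ddeg y"
      by auto
    then show "?t (Suc (ddeg x + ddeg y)) i = 0"
      by (simp only: van mult.assoc mult_zero_right)
  qed
  then show "(\<delta> ^^ Suc (ddeg x + ddeg y)) (x * y) = 0"
    unfolding iter_mult[OF assms(1,2)] .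
qed

lemma ddeg_power:
  assumes "x \<in> A" "x \<noteq> 0"
  shows "ddeg (x ^ k) = k * ddeg x"
  using assms
proof (induction k)
  case 0
  show ?case
    using ddeg_of_nat[of 1] by simp
qed (simp add: ddeg_mult power_mem)

lemma ddeg_delta:
  assumes "x \<in> A" "\<delta> x \<noteq> 0"
  shows "ddeg x = Suc (ddeg (\<delta> x))"
proof (rule ddeg_eqI)
  show "(\<delta> ^^ Suc (ddeg (\<delta> x))) x \<noteq> 0"
    using iter_ddeg[OF assms(2)] by (simp add: funpow_swap1)
  show "(\<delta> ^^ Suc (Suc (ddeg (\<delta> x)))) x = 0"
    using iter_Suc_ddeg[of "\<delta> x"] assms delta_mem by (simp add: funpow_swap1)
qed

end

text \<open>A grading by the integers modulo \<open>m\<close>, encoded as a family on the integers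
  that depends only on the residue. Division by \<open>m\<close> has to stay inside the components
  since the extended derivation has this denominator.\<close>

locale cyclic_grading =
  fixes S :: "int \<Rightarrow> 'a::field_char_0 set" and m :: nat
  assumes m_pos: "m > 0"
    and S_mod: "S (k mod int m) = S k"
    and S_zero: "0 \<in> S k" and S_one: "1 \<in> S 0"
    and S_add: "x \<in> S k \<Longrightarrow> y \<in> S k \<Longrightarrow> x + y \<in> S k"
    and S_diff: "x \<in> S k \<Longrightarrow> y \<in> S k \<Longrightarrow> x - y \<in> S k"
    and S_mult: "x \<in> S k \<Longrightarrow> y \<in> S l \<Longrightarrow> x * y \<in> S (k + l)"
    and S_divide: "x \<in> S k \<Longrightarrow> x / of_nat m \<in> S k"
    and S_direct: "(\<Sum>k\<in>{0..<int m}. s k) = 0 \<Longrightarrow> (\<And>k. s k \<in> S k) \<Longrightarrow>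
      l \<in> {0..<int m} \<Longrightarrow> s l = 0"
begin

definition total :: "'a set" where
  "total = {\<Sum>k\<in>{0..<int m}. s k | s. \<forall>k. s k \<in> S k}"

lemma S_cong: "[k = l] (mod int m) \<Longrightarrow> S k = S l"
  using S_mod[of k] S_mod[of l] by (simp add: cong_def)

lemma S_power: "x \<in> S k \<Longrightarrow> x ^ j \<in> S (int j * k)"
proof (induction j)
  case (Suc j)
  then show ?case
    using S_mult[of x k "x ^ j" "int j * k"] by (simp add: algebra_simps)
qed (simp add: S_one)

lemma S_power_m: "x \<in> S k \<Longrightarrow> x ^ m \<in> S 0"
  using S_power[of x k m] S_cong[of "int m * k" 0] by (simp add: cong_def)

text \<open>Modulo \<open>m\<close>, \<open>(m - 1) * k\<close> is \<open>- k\<close>. So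
  \<open>x ^ (m - 1)\<close> is a factor that brings elements of degree \<open>k\<close> into the
  degree zero part.\<close>

lemma S_power_m1: "x \<in> S k \<Longrightarrow> x ^ (m - 1) \<in> S (- k)"
  using S_power[of x k "m - 1"] S_cong[of "int (m - 1) * k" "- k"] m_pos
  by (simp add: cong_iff_dvd_diff of_nat_diff algebra_simps)

lemma S_mult0: "x \<in> S k \<Longrightarrow> y \<in> S (- k) \<Longrightarrow> x * y \<in> S 0"
  using S_mult[of x k y "- k"] by simp

lemma S_subset_total:
  assumes "x \<in> S k"
  shows "x \<in> total"
proof -
  let ?s = "\<lambda>j. if j = k mod int m then x else 0"
  have "x = (\<Sum>j\<in>{0..<int m}. ?s j)"
    using m_pos by simp
  moreover have "\<forall>j. ?s j \<in> S j"
    using assms by (simp add: S_zero S_mod)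
  ultimately show ?thesis
    unfolding total_def by blast
qed

lemma total_add: "x \<in> total \<Longrightarrow> y \<in> total \<Longrightarrow> x + y \<in> total"
proof -
  assume "x \<in> total" "y \<in> total"
  then obtain s t where "x = (\<Sum>k\<in>{0..<int m}. s k)" "\<forall>k. s k \<in> S k"
    "y = (\<Sum>k\<in>{0..<int m}. t k)" "\<forall>k. t k \<in> S k"
    by (auto simp: total_def)
  then have "x + y = (\<Sum>k\<in>{0..<int m}. s k + t k)" "\<forall>k. s k + t k \<in> S k"
    by (auto simp: sum.distrib S_add)
  then show ?thesis
    unfolding total_def by blast
qed

lemma total_sum: "(\<And>i. i \<in> I \<Longrightarrow> f i \<in> total) \<Longrightarrow> sum f I \<in> total"
  by (induction I rule: infinite_finite_induct) (auto intro: total_add S_subset_total S_zero)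

end

text \<open>\<open>V\<close> indexes the variables, with values \<open>v\<close> and degrees
  \<open>w\<close>. \<open>reach\<close> says that every residue is the degree of a monomial
  avoiding a given variable, and \<open>regular\<close> that any two variables form a regular
  sequence, stated for homogeneous elements with the quotient taken in the field.\<close>

locale cyclic_grading_lnd = cyclic_grading S m + lnd_subring "S 0" \<delta>
  for S :: "int \<Rightarrow> 'a::field_char_0 set" and m :: nat and \<delta> :: "'a \<Rightarrow> 'a" +
  fixes V :: "'i set" and v :: "'i \<Rightarrow> 'a" and w :: "'i \<Rightarrow> int"
  assumes V_nonempty: "V \<noteq> {}" and V_two: "i \<in> V \<Longrightarrow> \<exists>j\<in>V. j \<noteq> i"
    and v_mem: "i \<in> V \<Longrightarrow> v i \<in> S (w i)" and v_nonzero: "i \<in> V \<Longrightarrow> v i \<noteq> 0"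
    and reach: "i \<in> V \<Longrightarrow> \<exists>js. set js \<subseteq> V - {i} \<and> [sum_list (map w js) = k] (mod int m)"
    and regular: "i \<in> V \<Longrightarrow> j \<in> V \<Longrightarrow> i \<noteq> j \<Longrightarrow> b \<in> S k \<Longrightarrow> c \<in> S l \<Longrightarrow> v j * b = v i * c \<Longrightarrow>
      b / v i \<in> S (k - w i)"
begin

text \<open>Forced by the Leibniz rule, since \<open>b ^ m\<close> lies in the degree zero part.\<close>

definition ext :: "'a \<Rightarrow> 'a" where
  "ext b = (if b = 0 then 0 else \<delta> (b ^ m) / (of_nat m * b ^ (m - 1)))"

lemma ext_zero [simp]: "ext 0 = 0"
  by (simp add: ext_def)

lemma power_m_eq: "b ^ m = b * b ^ (m - 1)"
  using m_pos by (simp add: power_eq_if)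

lemma ext_power_m: "b \<in> S k \<Longrightarrow> of_nat m * b ^ (m - 1) * ext b = \<delta> (b ^ m)"
  using m_pos by (auto simp: ext_def delta_zero power_0_left split: if_splits)

lemma ext_eq_delta:
  assumes "b \<in> S 0"
  shows "ext b = \<delta> b"
  using assms m_pos by (simp add: ext_def delta_power delta_zero)

text \<open>For nonzero \<open>b\<close> the quotient \<open>ext b / b\<close> is
  \<open>\<delta> (b ^ m)\<close> divided by \<open>m * b ^ m\<close>, a logarithmic derivative, and
  these add up on products.\<close>

lemma ext_mult:
  assumes "b \<in> S k" "c \<in> S l"
  shows "ext (b * c) = ext b * c + b * ext c"
proof (cases "b = 0 \<or> c = 0")
  case False
  have "\<delta> ((b * c) ^ m) = \<delta> (b ^ m) * c ^ m + b ^ m * \<delta> (c ^ m)"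
    using assms by (simp add: power_mult_distrib delta_mult S_power_m)
  then show ?thesis
    using False m_pos unfolding ext_def by (simp add: power_m_eq field_simps)
qed auto

text \<open>After multiplication by \<open>b ^ (m - 1)\<close> both summands have degree zero, where
  \<open>ext\<close> is the additive \<open>\<delta>\<close>. The product rule then allows this
  factor to be cancelled.\<close>

lemma ext_add:
  assumes "b \<in> S k" "c \<in> S k"
  shows "ext (b + c) = ext b + ext c"
proof (cases "b = 0")
  case False
  define u where "u = b ^ (m - 1)"
  have u: "u \<in> S (- k)" "u \<noteq> 0"
    unfolding u_def using assms(1) False by (blast intro: S_power_m1, simp)
  have "ext ((b + c) * u) = ext (b * u) + ext (c * u)"
    using assms u by (simp add: ext_eq_delta S_mult0 S_add distrib_right delta_add)
  then have "ext (b + c) * u = (ext b + ext c) * u"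
    unfolding ext_mult[OF S_add[OF assms] u(1)] ext_mult[OF assms(1) u(1)] ext_mult[OF assms(2) u(1)]
    by (simp add: algebra_simps)
  then show ?thesis
    using u by simp
qed simp

section \<open>Clearing denominators with monomials\<close>

definition mon :: "'i list \<Rightarrow> 'a" where "mon js = prod_list (map v js)"
definition wt :: "'i list \<Rightarrow> int" where "wt js = sum_list (map w js)"

lemma mon_simps [simp]: "mon [] = 1" "mon (j # js) = v j * mon js" "mon (is @ js) = mon is * mon js"
  and wt_simps [simp]: "wt [] = 0" "wt (j # js) = w j + wt js" "wt (is @ js) = wt is + wt js"
  by (simp_all add: mon_def wt_def)

lemma mon_mem: "set js \<subseteq> V \<Longrightarrow> mon js \<in> S (wt js)"
  by (induction js) (auto intro: S_one S_mult v_mem)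

lemma mon_nonzero: "set js \<subseteq> V \<Longrightarrow> mon js \<noteq> 0"
  by (induction js) (auto simp: v_nonzero)

lemma mon_replicate: "mon (concat (replicate j js)) = mon js ^ j"
  and wt_replicate: "wt (concat (replicate j js)) = int j * wt js"
  by (induction j) (simp_all add: algebra_simps)

lemma regular_mon:
  assumes "i \<in> V" "set js \<subseteq> V - {i}" "b \<in> S k" "c \<in> S l" "mon js * b = v i * c"
  shows "b / v i \<in> S (k - w i)"
  using assms
proof (induction js arbitrary: c l)
  \<comment> \<open>The quotient is \<open>c\<close>, but its degree is only known as
    \<open>l\<close>. Multiplying the equation by a second variable lets \<open>regular\<close>
    supply the degree \<open>k - w i\<close>.\<close>
  case Nil
  obtain j where j: "j \<in> V" "i \<noteq> j"
    using V_two[OF assms(1)] by auto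
  show ?case
    by (rule regular[of i j b k "v j * c" "w j + l"])
      (use j Nil in \<open>auto intro: S_mult v_mem\<close>)
next
  case (Cons j js)
  have j: "j \<in> V" "j \<noteq> i" "set js \<subseteq> V"
    using Cons.prems by auto
  have "mon js * b / v i \<in> S (wt js + k - w i)"
    by (rule regular[of i j _ _ c l]) (use Cons.prems j in \<open>auto intro: S_mult mon_mem simp: mult.assoc\<close>)
  then show ?case
    by (rule Cons.IH[rotated 3]) (use Cons.prems v_nonzero in auto)
qed

text \<open>The factors of \<open>mon is\<close> are cancelled one at a time. When
  \<open>v i\<close> is to go, \<open>z\<close> has another multiple in the ring by a monomial
  without \<open>v i\<close>, so that \<open>regular_mon\<close> applies.\<close>

lemma mem_if_multiples_mem:
  assumes "set is \<subseteq> V" "z * mon is \<in> S (k + wt is)"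
    and "\<And>i. i \<in> V \<Longrightarrow> \<exists>js l. set js \<subseteq> V - {i} \<and> z * mon js \<in> S l"
  shows "z \<in> S k"
  using assms(1,2)
proof (induction "is")
  case (Cons i "is")
  then have i: "i \<in> V" "set is \<subseteq> V"
    by auto
  obtain js l where js: "set js \<subseteq> V - {i}" "z * mon js \<in> S l"
    using assms(3)[OF i(1)] by blast
  have "(z * mon (i # is)) / v i \<in> S (k + wt (i # is) - w i)"
  proof (rule regular_mon[OF i(1) js(1) Cons.prems(2)])
    show "mon is * (z * mon js) \<in> S (wt is + l)"
      using js i by (intro S_mult mon_mem)
  qed (simp add: algebra_simps)
  then have "z * mon is \<in> S (k + wt is)"
    using v_nonzero[OF i(1)] by simp
  then show ?case
    by (rule Cons.IH[OF i(2)])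
qed simp

text \<open>For a monomial \<open>u\<close> of degree \<open>- k\<close>, the product rule for
  \<open>b * u\<close> expresses \<open>ext b * u ^ m\<close> through values of
  \<open>\<delta>\<close>, so this multiple of \<open>ext b\<close> lies in \<open>S k\<close>. As
  \<open>u\<close> can avoid any given variable, the denominators cancel.\<close>

lemma ext_mem:
  assumes b: "b \<in> S k"
  shows "ext b \<in> S k"
proof -
  have ex: "\<exists>js. set js \<subseteq> V - {i} \<and> ext b * mon js \<in> S k \<and> [wt js = 0] (mod int m)"
    if i: "i \<in> V" for i
  proof -
    obtain js where js: "set js \<subseteq> V - {i}" "[wt js = - k] (mod int m)"
      using reach[OF i] unfolding wt_def by blast
    define u where "u = mon js"
    have u: "u \<in> S (- k)" "u \<noteq> 0"
      using mon_mem[of js] mon_nonzero[of js] js S_cong[OF js(2)] by (auto simp: u_def)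
    have "\<delta> (b * u) = ext b * u + b * ext u"
      using ext_mult[OF b u(1)] ext_eq_delta[OF S_mult0[OF b u(1)]] by simp
    moreover have "ext u = \<delta> (u ^ m) / (of_nat m * u ^ (m - 1))"
      using u by (simp add: ext_def)
    ultimately have "ext b * u ^ m = u ^ (m - 1) * \<delta> (b * u) - b * \<delta> (u ^ m) / of_nat m"
      using u m_pos by (simp add: power_m_eq field_simps)
    also have "\<dots> \<in> S k"
    proof (intro S_diff S_divide)
      show "u ^ (m - 1) * \<delta> (b * u) \<in> S k"
        using S_mult[OF S_power_m1[OF u(1)] delta_mem[OF S_mult0[OF b u(1)]]] by simp
      show "b * \<delta> (u ^ m) \<in> S k"
        using S_mult[OF b delta_mem[OF S_power_m[OF u(1)]]] by simp
    qed
    finally have "ext b * mon (concat (replicate m js)) \<in> S k"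
      by (simp add: mon_replicate u_def)
    moreover have "[wt (concat (replicate m js)) = 0] (mod int m)"
      by (simp add: wt_replicate cong_def)
    moreover have "set (concat (replicate m js)) \<subseteq> V - {i}"
      using js by auto
    ultimately show ?thesis
      by blast
  qed
  obtain i where i: "i \<in> V"
    using V_nonempty by blast
  obtain js where js: "set js \<subseteq> V - {i}" "ext b * mon js \<in> S k" "[wt js = 0] (mod int m)"
    using ex[OF i] by blast
  show ?thesis
  proof (rule mem_if_multiples_mem)
    show "set js \<subseteq> V"
      using js by blast
    have "[k + wt js = k] (mod int m)"
      using js(3) by (simp add: cong_iff_dvd_diff)
    then show "ext b * mon js \<in> S (k + wt js)"
      using js S_cong by blast
  qed (use ex in blast)
qed

text \<open>The degree function of \<open>\<delta>\<close> drops by \<open>m\<close> from \<open>b ^ m\<close> to \<open>ext b ^ m\<close>.\<close>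

lemma ext_nilpotent:
  assumes "b \<in> S k"
  shows "\<exists>N. (ext ^^ N) b = 0"
  using assms
proof (induction "ddeg (b ^ m)" arbitrary: b rule: less_induct)
  case less
  show ?case
  proof (cases "ext b = 0")
    case True
    then show ?thesis
      by (intro exI[of _ 1]) simp
  next
    case False
    then have b0: "b \<noteq> 0"
      by auto
    have mem: "b ^ m \<in> S 0" "ext b ^ m \<in> S 0"
      using less.prems ext_mem by (auto intro: S_power_m)
    have eq: "\<delta> (b ^ m) = of_nat m * b ^ (m - 1) * ext b"
      using ext_power_m[OF less.prems] by simp
    have d0: "\<delta> (b ^ m) \<noteq> 0"
      using False b0 m_pos by (simp add: eq)
    \<comment> \<open>\<open>ext b\<close> need not have degree zero in the grading, so its
      \<open>m\<close>-th power is measured. If \<open>b ^ m\<close> and \<open>ext b ^ m\<close>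
      have degrees D and D' with respect to \<open>\<delta>\<close>, this equation gives m (D - 1) =
      (m - 1) D + D', so D' = D - m.\<close>
    have "\<delta> (b ^ m) ^ m = of_nat (m ^ m) * ((b ^ m) ^ (m - 1) * ext b ^ m)"
      by (simp add: eq power_mult_distrib mult.commute flip: power_mult)
    moreover have "ddeg (\<delta> (b ^ m) ^ m) = m * ddeg (\<delta> (b ^ m))"
      by (intro ddeg_power delta_mem mem d0)
    moreover have "ddeg (of_nat (m ^ m) * ((b ^ m) ^ (m - 1) * ext b ^ m)) =
        0 + ((m - 1) * ddeg (b ^ m) + ddeg (ext b ^ m))"
    proof -
      have "ddeg (of_nat (m ^ m) * ((b ^ m) ^ (m - 1) * ext b ^ m)) =
          ddeg (of_nat (m ^ m)) + ddeg ((b ^ m) ^ (m - 1) * ext b ^ m)"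
        using mem b0 False m_pos by (intro ddeg_mult of_nat_mem mult_mem power_mem[of "b ^ m"]) auto
      also have "ddeg (of_nat (m ^ m)) = 0"
        using m_pos by (intro ddeg_of_nat) simp
      also have "ddeg ((b ^ m) ^ (m - 1) * ext b ^ m) = ddeg ((b ^ m) ^ (m - 1)) + ddeg (ext b ^ m)"
        using mem b0 False by (intro ddeg_mult power_mem[of "b ^ m"]) auto
      also have "ddeg ((b ^ m) ^ (m - 1)) = (m - 1) * ddeg (b ^ m)"
        using mem b0 by (intro ddeg_power) auto
      finally show ?thesis .
    qed
    ultimately have "m * ddeg (\<delta> (b ^ m)) = (m - 1) * ddeg (b ^ m) + ddeg (ext b ^ m)"
      by simp
    moreover have "ddeg (b ^ m) = Suc (ddeg (\<delta> (b ^ m)))"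
      using mem(1) d0 by (rule ddeg_delta)
    ultimately have "ddeg (ext b ^ m) < ddeg (b ^ m)"
      using m_pos by (cases m) (auto simp: algebra_simps)
    then obtain N where "(ext ^^ N) (ext b) = 0"
      using less.hyps[of "ext b"] ext_mem[OF less.prems] by blast
    then have "(ext ^^ Suc N) b = 0"
      by (simp add: funpow_swap1)
    then show ?thesis
      by blast
  qed
qed

section \<open>From homogeneous elements to the whole ring\<close>

definition comps :: "'a \<Rightarrow> int \<Rightarrow> 'a" where
  "comps r = (SOME s. r = (\<Sum>k\<in>{0..<int m}. s k) \<and> (\<forall>k. s k \<in> S k))"

definition ext_total :: "'a \<Rightarrow> 'a" where
  "ext_total r = (\<Sum>k\<in>{0..<int m}. ext (comps r k))"

lemma ext_total_sum:
  assumes "\<And>k. s k \<in> S k"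
  shows "ext_total (\<Sum>k\<in>{0..<int m}. s k) = (\<Sum>k\<in>{0..<int m}. ext (s k))"
proof -
  let ?r = "\<Sum>k\<in>{0..<int m}. s k"
  have "?r = (\<Sum>k\<in>{0..<int m}. comps ?r k) \<and> (\<forall>k. comps ?r k \<in> S k)"
    unfolding comps_def by (rule someI[of _ s]) (simp add: assms)
  then have "(\<Sum>k\<in>{0..<int m}. s k - comps ?r k) = 0" "\<And>k. s k - comps ?r k \<in> S k"
    using assms by (simp_all add: sum_subtractf S_diff)
  from S_direct[OF this] have "s k = comps ?r k" if "k \<in> {0..<int m}" for k
    using that by simp
  then show ?thesis
    unfolding ext_total_def by simp
qed

lemma ext_total_eq_ext:
  assumes "b \<in> S k"
  shows "ext_total b = ext b"
proof -
  let ?s = "\<lambda>j. if j = k mod int m then b else 0"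
  have "ext_total (\<Sum>j\<in>{0..<int m}. ?s j) = (\<Sum>j\<in>{0..<int m}. ext (?s j))"
    by (rule ext_total_sum) (use assms in \<open>simp add: S_zero S_mod\<close>)
  then show ?thesis
    using m_pos by (simp add: if_distrib[of ext] cong: if_cong)
qed

lemma ext_total_add:
  assumes "x \<in> total" "y \<in> total"
  shows "ext_total (x + y) = ext_total x + ext_total y"
proof -
  obtain s t where st: "x = (\<Sum>k\<in>{0..<int m}. s k)" "\<And>k. s k \<in> S k"
    "y = (\<Sum>k\<in>{0..<int m}. t k)" "\<And>k. t k \<in> S k"
    using assms by (auto simp: total_def)
  have "ext_total (\<Sum>k\<in>{0..<int m}. s k + t k) = (\<Sum>k\<in>{0..<int m}. ext (s k + t k))"
    by (intro ext_total_sum S_add st)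
  also have "\<dots> = (\<Sum>k\<in>{0..<int m}. ext (s k)) + (\<Sum>k\<in>{0..<int m}. ext (t k))"
    by (simp add: ext_add[OF st(2) st(4)] sum.distrib)
  also have "\<dots> = ext_total x + ext_total y"
    using st by (simp add: ext_total_sum)
  finally show ?thesis
    by (simp add: st sum.distrib)
qed

lemma ext_total_zero: "ext_total 0 = 0"
  using ext_total_eq_ext[OF S_zero] by simp

lemma ext_total_sum_total:
  "(\<And>i. i \<in> I \<Longrightarrow> f i \<in> total) \<Longrightarrow> ext_total (sum f I) = (\<Sum>i\<in>I. ext_total (f i))"
  by (induction I rule: infinite_finite_induct) (simp_all add: ext_total_zero ext_total_add total_sum)

lemma ext_total_mem: "x \<in> total \<Longrightarrow> ext_total x \<in> total"
proof -
  assume "x \<in> total"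
  then obtain s where s: "x = (\<Sum>k\<in>{0..<int m}. s k)" "\<And>k. s k \<in> S k"
    by (auto simp: total_def)
  then have "ext_total x = (\<Sum>k\<in>{0..<int m}. ext (s k))" "\<forall>k. ext (s k) \<in> S k"
    by (simp_all add: ext_total_sum ext_mem)
  then show ?thesis
    unfolding total_def by blast
qed

lemma ext_total_mult:
  assumes "x \<in> total" "y \<in> total"
  shows "ext_total (x * y) = ext_total x * y + x * ext_total y"
proof -
  let ?I = "{0..<int m}"
  obtain s t where st: "x = (\<Sum>k\<in>?I. s k)" "\<And>k. s k \<in> S k"
    "y = (\<Sum>k\<in>?I. t k)" "\<And>k. t k \<in> S k"
    using assms by (auto simp: total_def)
  have mem: "s i * t j \<in> S (i + j)" for i j
    using st by (intro S_mult)
  have "ext_total (x * y) = ext_total (\<Sum>i\<in>?I. \<Sum>j\<in>?I. s i * t j)"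
    by (simp add: st sum_product)
  also have "\<dots> = (\<Sum>i\<in>?I. \<Sum>j\<in>?I. ext_total (s i * t j))"
    using S_subset_total[OF mem] by (simp add: ext_total_sum_total total_sum)
  also have "\<dots> = (\<Sum>i\<in>?I. \<Sum>j\<in>?I. ext (s i) * t j + s i * ext (t j))"
    by (simp add: ext_total_eq_ext[OF mem] ext_mult[OF st(2) st(4)])
  also have "\<dots> = (\<Sum>i\<in>?I. ext (s i)) * y + x * (\<Sum>i\<in>?I. ext (t i))"
    by (simp add: st sum_product sum.distrib)
  finally show ?thesis
    using st by (simp add: ext_total_sum)
qed

lemma ext_total_iter_sum:
  assumes "\<And>k. s k \<in> S k"
  shows "(ext_total ^^ N) (\<Sum>k\<in>{0..<int m}. s k) = (\<Sum>k\<in>{0..<int m}. (ext ^^ N) (s k))"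
proof (induction N)
  case (Suc N)
  have "(ext ^^ N) (s k) \<in> S k" for k
    by (induction N) (simp_all add: assms ext_mem)
  then show ?case
    using ext_total_sum[of "\<lambda>k. (ext ^^ N) (s k)"] Suc by simp
qed simp

lemma lnd_on_ext_total: "lnd_on total ext_total"
  unfolding lnd_on_def
proof (intro conjI ballI)
  fix x assume "x \<in> total"
  then obtain s where s: "x = (\<Sum>k\<in>{0..<int m}. s k)" "\<And>k. s k \<in> S k"
    by (auto simp: total_def)
  have "\<exists>N. (ext ^^ N) (s k) = 0" for k
    using s by (intro ext_nilpotent)
  then obtain N where N: "(ext ^^ N k) (s k) = 0" for k
    by metis
  \<comment> \<open>At least as large as every \<open>N k\<close>, and positive as
    \<open>lnd_on\<close> demands.\<close>
  define M where "M = Suc (\<Sum>k\<in>{0..<int m}. N k)"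
  have "(ext ^^ M) (s k) = 0" if "k \<in> {0..<int m}" for k
  proof -
    have "N k \<le> (\<Sum>k\<in>{0..<int m}. N k)"
      using that by (intro member_le_sum) auto
    then obtain d where "M = d + N k"
      unfolding M_def by (metis le_SucI le_add_diff_inverse2)
    moreover have "(ext ^^ d) 0 = 0"
      by (induction d) simp_all
    ultimately show ?thesis
      by (simp add: funpow_add N)
  qed
  then have "(ext_total ^^ M) x = 0" "M > 0"
    unfolding s(1) ext_total_iter_sum[OF s(2)] by (blast intro: sum.neutral, simp add: M_def)
  then show "\<exists>N>0. (ext_total ^^ N) x = 0"
    by blast
qed (auto simp: ext_total_mem ext_total_add ext_total_mult)

text \<open>\<open>\<delta>\<close> is the restriction of \<open>ext_total\<close>, which has to
  vanish if the whole ring is rigid.\<close>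

lemma rigid_on_total_imp_delta_zero:
  assumes "rigid_on total" "x \<in> S 0"
  shows "\<delta> x = 0"
  using assms lnd_on_ext_total ext_total_eq_ext[of x 0] ext_eq_delta[of x] S_subset_total[of x 0]
  by (auto simp: rigid_on_def)

end

section \<open>A field containing the Pham--Brieskorn ring\<close>

text \<open>Carries characteristic zero from the polynomial ring to its field of fractions, and so
  to the coefficient field of the series below.\<close>

instance fract :: ("{idom, ring_char_0}") field_char_0
proof
  show "inj (of_nat :: nat \<Rightarrow> 'a fract)"
    by (rule injI) (simp add: of_nat_fract eq_fract)
qed

lemma ring_map_map_poly:
  assumes f: "ring_map f"
  shows "ring_map (map_poly f)"
proof (rule ring_mapI)
  show "map_poly f 1 = 1"
    by (simp add: map_poly_1' ring_map_one[OF f])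
  show "map_poly f (p + q) = map_poly f p + map_poly f q" for p q
    by (rule poly_eqI) (simp add: coeff_map_poly ring_map_simps[OF f])
  show "map_poly f (p * q) = map_poly f p * map_poly f q" for p q
    by (rule poly_eqI) (simp add: coeff_map_poly coeff_mult ring_map_simps[OF f])
qed

lemma ring_map_poly_at: "ring_map (\<lambda>p. poly p x)"
  by (simp add: ring_map_def)

lemma ring_map_fps_const: "ring_map fps_const"
  by (simp add: ring_map_def)

lemma ring_map_fps_compose:
  assumes "c $ 0 = (0::'a::idom)"
  shows "ring_map (\<lambda>f. f oo c)"
  using assms by (simp add: ring_map_def fps_compose_add_distrib fps_compose_mult_distrib)

lemma ring_map_fps_to_fls: "ring_map (fps_to_fls :: 'a::field fps \<Rightarrow> 'a fls)"
  by (simp add: ring_map_def fls_times_fps_to_fls)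

lemma ring_map_pCons_const: "ring_map (\<lambda>c. [:c:])"
  by (auto simp: ring_map_def one_pCons)

text \<open>Pseudo-division multiplies the dividend by powers of the leading coefficient, which is 1
  here.\<close>

lemma monic_division:
  fixes f g :: "'a::idom poly"
  assumes "lead_coeff g = 1" "degree g > 0"
  obtains q r where "f = g * q + r" "degree r < degree g"
proof -
  obtain q r where qr: "pseudo_divmod f g = (q, r)"
    by (cases "pseudo_divmod f g") auto
  have "g \<noteq> 0"
    using assms by auto
  from pseudo_divmod[OF this qr] assms have "f = g * q + r" "degree r < degree g"
    by auto
  then show ?thesis
    using that by blast
qed

text \<open>\<open>p\<close> as a polynomial in the variable \<open>l\<close>. The coefficients stay
  in the same type although this variable no longer occurs in them, a fact recorded by
  \<open>map_poly_kill_univ_var\<close>.\<close>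

definition univ_var :: "nat \<Rightarrow> 'k::field mpoly \<Rightarrow> 'k mpoly poly" where
  "univ_var l = insertion (\<lambda>c. [:Const c:]) (\<lambda>i. if i = l then [:0, 1:] else [:Var i:])"

lemma ring_map_pCons_Const: "ring_map (\<lambda>c. [:Const c:])"
  by (rule ring_map_comp[OF ring_map_pCons_const ring_map_Const])

lemma ring_map_univ_var: "ring_map (univ_var l)"
  unfolding univ_var_def by (rule ring_map_insertion[OF ring_map_pCons_Const])

lemma univ_var_simps [simp]:
  "univ_var l (Const c) = [:Const c:]" "univ_var l (Var i) = (if i = l then [:0, 1:] else [:Var i:])"
  by (simp_all add: univ_var_def ring_map_pCons_Const)

lemma poly_univ_var: "poly (univ_var l p) (Var l) = p"
  by (rule ring_map_eqI[OF ring_map_comp[OF ring_map_poly_at ring_map_univ_var], of "\<lambda>p. p"])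
    (simp_all add: ring_map_def)

text \<open>Reduction modulo the variables in \<open>A\<close>. With the complement of
  \<open>{1..n}\<close> for \<open>A\<close>, it also removes foreign variables from
  cofactors.\<close>

definition kill :: "nat set \<Rightarrow> 'k::field mpoly \<Rightarrow> 'k mpoly" where
  "kill A = insertion Const (\<lambda>i. if i \<in> A then 0 else Var i)"

lemma ring_map_kill: "ring_map (kill A)"
  unfolding kill_def by (rule ring_map_insertion[OF ring_map_Const])

lemma kill_simps [simp]:
  "kill A (Const c) = Const c" "kill A (Var i) = (if i \<in> A then 0 else Var i)"
  by (simp_all add: kill_def ring_map_Const)

lemma kill_in_vars_in: "p \<in> vars_in V \<Longrightarrow> kill A p \<in> vars_in (V - A)"
  unfolding kill_def
proof (rule insertion_in_vars_in)
  fix m i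
  assume "p \<in> vars_in V" "m \<in> Poly_Mapping.keys p" "i \<in> Poly_Mapping.keys m"
  then have "i \<in> V"
    by (auto simp: supp_on_def)
  then show "(if i \<in> A then 0 else Var i) \<in> vars_in (V - A)"
    by (simp add: supp_on_zero vars_in_Var)
qed

lemma kill_id: "p \<in> vars_in V \<Longrightarrow> V \<inter> A = {} \<Longrightarrow> kill A p = p"
  unfolding kill_def by (rule insertion_id_on_vars_in[of V]) auto

lemma map_poly_kill_univ_var: "map_poly (kill {l}) (univ_var l p) = univ_var l p"
  by (rule ring_map_eqI[OF ring_map_comp[OF ring_map_map_poly[OF ring_map_kill] ring_map_univ_var] ring_map_univ_var])
    (simp_all add: map_poly_pCons ring_map_simps[OF ring_map_kill])

text \<open>Positive exponents keep the powers of distinct variables distinct monomials, so nothing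
  cancels or merges.\<close>

lemma keys_power_sum:
  fixes a :: "nat \<Rightarrow> nat"
  assumes "finite A" "\<And>i. i \<in> A \<Longrightarrow> a i > 0"
  shows "Poly_Mapping.keys (\<Sum>i\<in>A. Var i ^ a i :: 'k::field mpoly) = (\<lambda>i. Poly_Mapping.single i (a i)) ` A"
proof -
  have inj: "Poly_Mapping.single i (a i) = Poly_Mapping.single j (a j) \<longleftrightarrow> i = j"
    if "i \<in> A" "j \<in> A" for i j
  proof
    assume "Poly_Mapping.single i (a i) = Poly_Mapping.single j (a j)"
    then have "Poly_Mapping.keys (Poly_Mapping.single i (a i)) = Poly_Mapping.keys (Poly_Mapping.single j (a j))"
      by simp
    then show "i = j"
      using assms(2)[OF that(1)] assms(2)[OF that(2)] by simp
  qed simp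
  have "Poly_Mapping.lookup (\<Sum>i\<in>A. Var i ^ a i :: 'k mpoly) m =
      (\<Sum>i\<in>A. if Poly_Mapping.single i (a i) = m then 1 else 0)" for m
    by (simp add: lookup_sum Var_power lookup_single when_def)
  moreover have "(\<Sum>i\<in>A. if Poly_Mapping.single i (a i) = m then 1 else 0 :: 'k) =
      (if m \<in> (\<lambda>i. Poly_Mapping.single i (a i)) ` A then 1 else 0)" for m
  proof (cases "m \<in> (\<lambda>i. Poly_Mapping.single i (a i)) ` A")
    case True
    then obtain j where j: "j \<in> A" "m = Poly_Mapping.single j (a j)"
      by blast
    then have "(\<Sum>i\<in>A. if Poly_Mapping.single i (a i) = m then 1 else 0 :: 'k) =
        (\<Sum>i\<in>A. if i = j then 1 else 0)"
      using inj by (intro sum.cong) auto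
    then show ?thesis
      using True j assms(1) by simp
  qed (auto intro!: sum.neutral)
  ultimately show ?thesis
    by (auto simp: in_keys_iff split: if_splits)
qed

lemma power_sum_nonzero:
  assumes "finite A" "A \<noteq> {}" "\<And>i. i \<in> A \<Longrightarrow> a i > 0"
  shows "(\<Sum>i\<in>A. Var i ^ a i :: 'k::field mpoly) \<noteq> 0"
  using keys_power_sum[of A a, where 'k='k] assms by auto

lemma pham_brieskorn_poly_eq: "pham_brieskorn_poly n a = (\<Sum>i=1..n. Var i ^ a i)"
  by (simp add: pham_brieskorn_poly_def Var_power)

text \<open>A nonconstant series is transcendental over an algebraically closed coefficient field:
  \<open>q\<close> splits into linear factors, and no \<open>h - fps_const c\<close>
  vanishes.\<close>

lemma poly_fps_nonconstant_nonzero: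
  fixes q :: "'e::alg_closed_field poly" and h :: "'e fps"
  assumes "\<And>c. h \<noteq> fps_const c" "q \<noteq> 0"
  shows "poly (map_poly fps_const q) h \<noteq> 0"
  using assms(2)
proof (induction "degree q" arbitrary: q rule: less_induct)
  case less
  show ?case
  proof (cases "degree q = 0")
    case True
    then obtain c where "q = [:c:]"
      using degree_eq_zeroE by blast
    then show ?thesis
      using less.prems by (simp add: map_poly_pCons)
  next
    case False
    then obtain c where "poly q c = 0"
      using alg_closed_imp_poly_has_root by blast
    then obtain q' where q': "q = [:- c, 1:] * q'"
      by (meson dvdE poly_eq_0_iff_dvd)
    with less.prems have nz: "q' \<noteq> 0"
      by auto
    then have "degree q = Suc (degree q')"
      unfolding q' by (subst degree_mult_eq) auto
    then have "poly (map_poly fps_const q') h \<noteq> 0"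
      using less.hyps nz by simp
    moreover have "h - fps_const c \<noteq> 0"
      using assms(1) by simp
    moreover have "poly (map_poly fps_const q) h = (h - fps_const c) * poly (map_poly fps_const q') h"
      unfolding q' ring_map_mult[OF ring_map_map_poly[OF ring_map_fps_const]]
      by (simp add: map_poly_pCons left_diff_distrib flip: fps_const_neg)
    ultimately show ?thesis
      by simp
  qed
qed

text \<open>
  \<open>X\<^sub>1\<close> is sent to a uniformizer \<open>t\<close>, the variables other than \<open>X\<^sub>1, X\<^sub>2\<close> to
  independent constants, and \<open>X\<^sub>2\<close> to a root lying in the series in \<open>t ^ a\<^sub>1\<close>.  Modulo the
  Pham--Brieskorn polynomial every element has degree less than \<open>a\<^sub>1\<close> in \<open>X\<^sub>1\<close>,
  so that its coefficients can be read off from the residues of the exponents of \<open>t\<close> modulo \<open>a\<^sub>1\<close>.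
\<close>

lemma pham_brieskorn_embedding:
  fixes a :: "nat \<Rightarrow> nat"
  assumes n: "n \<ge> 3" and a: "\<And>i. i \<in> {1..n} \<Longrightarrow> a i > 0"
  obtains \<theta> :: "'k::field_char_0 mpoly \<Rightarrow> 'k mpoly fract alg_closure fls"
  where "ring_map \<theta>" "\<And>p. \<theta> p = 0 \<longleftrightarrow> pham_brieskorn_poly n a dvd p"
proof -
  let ?F = "pham_brieskorn_poly n a :: 'k mpoly"
  define \<iota> :: "'k mpoly \<Rightarrow> 'k mpoly fract alg_closure" where "\<iota> p = to_ac (Fract p 1)" for p
  have \<iota>: "ring_map \<iota>"
    by (auto simp: ring_map_def \<iota>_def simp flip: One_fract_def to_ac_add to_ac_mult)
  have \<iota>_0: "\<iota> p = 0 \<longleftrightarrow> p = 0" for p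
    by (simp add: \<iota>_def Zero_fract_def eq_fract)
  define H where "H = (\<Sum>i\<in>{3..n}. Var i ^ a i :: 'k mpoly)"
  have "H \<noteq> 0"
    unfolding H_def using n a by (intro power_sum_nonzero) auto
  have a1: "a 1 > 0" and a2: "a 2 > 0"
    using a n by auto
  have split: "{1..n} = {1, 2} \<union> {3..n}"
    using n by auto
  have F: "?F = Var 1 ^ a 1 + Var 2 ^ a 2 + H"
    unfolding pham_brieskorn_poly_eq split H_def by (subst sum.union_disjoint) auto
  obtain \<alpha> where \<alpha>: "\<alpha> ^ a 2 = - \<iota> H"
    using nth_root_exists[OF a2, of "- \<iota> H"] by blast
  with \<open>H \<noteq> 0\<close> have "\<alpha> \<noteq> 0"
    using a2 by (auto simp: power_0_left \<iota>_0)
  \<comment> \<open>Replacing the series variable by \<open>fps_X ^ a 1\<close> turns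
    \<open>s\<close> into the value that the relation prescribes for the power \<open>a 2\<close> of
    the second variable. The nonzero constant term guarantees a root.\<close>
  define s where "s = fps_const (\<alpha> ^ a 2) - fps_X"
  define h where "h = fps_radical (\<lambda>_ _. \<alpha>) (a 2) s"
  have h: "h ^ a 2 = s"
    using power_radical[of s "\<lambda>_ _. \<alpha>" "a 2 - 1"] \<open>\<alpha> \<noteq> 0\<close> a2 by (simp add: h_def s_def)
  have h_nonconst: "h \<noteq> fps_const c" for c
  proof
    assume "h = fps_const c"
    then have "s = fps_const (c ^ a 2)"
      using h by (simp add: fps_const_power)
    then have "s $ 1 = 0"
      by simp
    then show False
      by (simp add: s_def)
  qed

  let ?c = "\<lambda>k. fps_const (\<iota> (Const k))"
  have c: "ring_map ?c"
    by (intro ring_map_comp[OF ring_map_fps_const] ring_map_comp[OF \<iota>] ring_map_Const)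
  \<comment> \<open>\<open>\<rho>\<close> sends the second variable to the root before the series
    variable is replaced by its power. It is compared with \<open>\<Theta>\<close> only on
    polynomials free of the first variable.\<close>
  define \<rho> where "\<rho> = insertion ?c (\<lambda>i. if i = 2 then h else fps_const (\<iota> (Var i)))"
  define \<Theta> where "\<Theta> = insertion ?c (\<lambda>i. if i = 1 then fps_X else
      if i = 2 then h oo fps_X ^ a 1 else fps_const (\<iota> (Var i)))"
  have \<rho>: "ring_map \<rho>" and \<Theta>: "ring_map \<Theta>"
    unfolding \<rho>_def \<Theta>_def by (intro ring_map_insertion c)+
  have \<rho>_simps: "\<rho> (Const k) = ?c k" "\<rho> (Var i) = (if i = 2 then h else fps_const (\<iota> (Var i)))" for k i
    by (simp_all add: \<rho>_def c)
  have \<Theta>_simps: "\<Theta> (Const k) = ?c k" "\<Theta> (Var i) = (if i = 1 then fps_X else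
      if i = 2 then h oo fps_X ^ a 1 else fps_const (\<iota> (Var i)))" for k i
    by (simp_all add: \<Theta>_def c)
  have comp: "ring_map (\<lambda>f :: 'k mpoly fract alg_closure fps. f oo fps_X ^ a 1)"
    using a1 by (intro ring_map_fps_compose) simp
  have comp_nth: "(f oo fps_X ^ a 1) $ N = (if a 1 dvd N then f $ (N div a 1) else 0)"
    for f :: "'k mpoly fract alg_closure fps" and N
  proof -
    have "(f oo fps_X ^ a 1) $ N = (\<Sum>i=0..N. if N = a 1 * i then f $ i else 0)"
      by (simp add: fps_compose_nth fps_X_power_nth if_distrib[of "(*) _"] flip: power_mult cong: if_cong)
    also have "\<dots> = (\<Sum>i=0..N. if i = N div a 1 then (if a 1 dvd N then f $ i else 0) else 0)"
      using a1 by (intro sum.cong) auto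
    finally show ?thesis
      by simp
  qed

  \<comment> \<open>Under \<open>\<rho>\<close> every variable but the second becomes a constant
    series, so \<open>\<rho> p\<close> is a nonzero polynomial with constant coefficients, evaluated
    at the transcendental \<open>h\<close>.\<close>
  have \<rho>_inj: "p = 0" if "\<rho> p = 0" for p
  proof (rule ccontr)
    assume "p \<noteq> 0"
    have "univ_var 2 p \<noteq> 0"
      using poly_univ_var[of 2 p] \<open>p \<noteq> 0\<close> by auto
    then have nz: "map_poly \<iota> (univ_var 2 p) \<noteq> 0"
      using \<iota>_0 by (subst map_poly_eq_0_iff) (auto simp: ring_map_zero[OF \<iota>])
    have "\<rho> p = poly (map_poly fps_const (map_poly \<iota> (univ_var 2 p))) h"
      by (rule ring_map_eqI[OF \<rho>])
        (auto intro!: ring_map_comp[OF ring_map_poly_at] ring_map_comp[OF ring_map_map_poly]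
           ring_map_fps_const \<iota> ring_map_univ_var
         simp: \<rho>_simps map_poly_pCons ring_map_simps[OF \<iota>])
    also have "\<dots> \<noteq> 0"
      by (rule poly_fps_nonconstant_nonzero[OF h_nonconst nz])
    finally show False
      using that by simp
  qed

  have \<Theta>_F: "\<Theta> ?F = 0"
  proof -
    have "\<Theta> H = fps_const (\<iota> H)"
      unfolding H_def ring_map_simps[OF \<Theta>] ring_map_simps[OF \<iota>] ring_map_simps[OF ring_map_fps_const]
      by (intro sum.cong refl) (simp add: \<Theta>_simps)
    moreover have "\<Theta> (Var 2) ^ a 2 = fps_const (- \<iota> H) - fps_X ^ a 1"
    proof -
      have "\<Theta> (Var 2) ^ a 2 = (h ^ a 2) oo fps_X ^ a 1"
        using ring_map_power[OF comp, of h "a 2"] by (simp add: \<Theta>_simps)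
      also have "\<dots> = fps_const (- \<iota> H) - fps_X ^ a 1"
        using a1 by (simp add: h s_def \<alpha> fps_compose_sub_distrib)
      finally show ?thesis .
    qed
    ultimately show ?thesis
      by (simp add: F ring_map_simps[OF \<Theta>] \<Theta>_simps(2)[of "Suc 0"] flip: fps_const_neg)
  qed

  have \<Theta>_kernel: "?F dvd p" if p: "\<Theta> p = 0" for p
  proof -
    have uF: "univ_var 1 ?F = monom 1 (a 1) + [:Var 2 ^ a 2 + H:]"
    proof -
      have "univ_var 1 H = [:H:]"
        unfolding H_def ring_map_simps[OF ring_map_univ_var] ring_map_simps[OF ring_map_pCons_const]
        by (intro sum.cong refl) simp
      then show ?thesis
        by (simp add: F ring_map_simps[OF ring_map_univ_var] monom_altdef
            ring_map_simps[OF ring_map_pCons_const] del: pCons_0_0)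
    qed
    have "degree [:Var 2 ^ a 2 + H:] < degree (monom (1::'k mpoly) (a 1))"
      using a1 by (simp add: degree_monom_eq)
    then have deg: "degree (univ_var 1 ?F) = a 1" "lead_coeff (univ_var 1 ?F) = 1"
      unfolding uF using a1
      by (simp_all add: degree_add_eq_left lead_coeff_add_le degree_monom_eq coeff_pCons split: nat.splits)
    obtain q r where qr: "univ_var 1 p = univ_var 1 ?F * q + r" "degree r < a 1"
      using monic_division[of "univ_var 1 ?F" "univ_var 1 p"] deg a1 by metis
    \<comment> \<open>The coefficients of \<open>q\<close> and \<open>r\<close> may contain the
      first variable, those of the other two polynomials do not. Setting it to zero in all
      coefficients preserves the identity and frees the remainder's coefficients from it.\<close>
    let ?k = "map_poly (kill {1}) :: 'k mpoly poly \<Rightarrow> _"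
    have "univ_var 1 p = univ_var 1 ?F * ?k q + ?k r"
      using arg_cong[OF qr(1), of ?k]
      by (simp only: ring_map_simps[OF ring_map_map_poly[OF ring_map_kill]] map_poly_kill_univ_var)
    from arg_cong[OF this, of "\<lambda>f. poly f (Var 1)"]
    have p_eq: "p = ?F * poly (?k q) (Var 1) + poly (?k r) (Var 1)"
      by (simp add: poly_univ_var)
    define b where "b j = kill {1} (coeff r j)" for j
    have r_eq: "poly (?k r) (Var 1) = (\<Sum>j<a 1. b j * Var 1 ^ j)"
    proof -
      have "poly (?k r) (Var 1) = (\<Sum>j\<le>degree (?k r). coeff (?k r) j * Var 1 ^ j)"
        by (rule poly_altdef)
      also have "\<dots> = (\<Sum>j<a 1. coeff (?k r) j * Var 1 ^ j)"
        using qr(2) map_poly_degree_leq[of "kill {1}" r]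
        by (intro sum.mono_neutral_left) (auto intro: coeff_eq_0 simp: not_le)
      finally show ?thesis
        by (simp add: b_def coeff_map_poly ring_map_zero[OF ring_map_kill])
    qed
    have \<Theta>_b: "\<Theta> (b j) = \<rho> (b j) oo fps_X ^ a 1" for j
    proof (rule ring_map_eqI[OF \<Theta> ring_map_comp[OF comp \<rho>]])
      fix m i assume mi: "m \<in> Poly_Mapping.keys (b j)" "i \<in> Poly_Mapping.keys m"
      have "b j \<in> vars_in (UNIV - {1})"
        unfolding b_def by (rule kill_in_vars_in) (simp add: supp_on_def)
      with mi have "i \<noteq> 1"
        by (auto simp: supp_on_def)
      then show "\<Theta> (Var i) = \<rho> (Var i) oo fps_X ^ a 1"
        by (simp add: \<Theta>_simps \<rho>_simps)
    qed (simp add: \<Theta>_simps \<rho>_simps)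
    have zero: "(\<Sum>j<a 1. (\<rho> (b j) oo fps_X ^ a 1) * fps_X ^ j) = 0"
    proof -
      have "\<Theta> p = \<Theta> ?F * \<Theta> (poly (?k q) (Var 1)) + \<Theta> (\<Sum>j<a 1. b j * Var 1 ^ j)"
        using arg_cong[OF p_eq, of \<Theta>] unfolding r_eq by (simp only: ring_map_simps[OF \<Theta>])
      then have "\<Theta> (\<Sum>j<a 1. b j * Var 1 ^ j) = 0"
        using p \<Theta>_F by simp
      then show ?thesis
        by (simp add: ring_map_simps[OF \<Theta>] \<Theta>_b \<Theta>_simps(2)[of "Suc 0"])
    qed
    have "b j = 0" if j: "j < a 1" for j
    proof (rule \<rho>_inj, rule fps_ext)
      fix k
      \<comment> \<open>The summand with index \<open>i\<close> has only exponents congruent to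
        \<open>i\<close> modulo \<open>a 1\<close>, so the coefficient at \<open>a 1 * k + j\<close>
        comes from \<open>b j\<close> alone.\<close>
      have "0 = (\<Sum>j<a 1. (\<rho> (b j) oo fps_X ^ a 1) * fps_X ^ j) $ (a 1 * k + j)"
        unfolding zero by simp
      also have "\<dots> = (\<Sum>i<a 1. if i = j then \<rho> (b j) $ k else 0)"
        unfolding fps_sum_nth
      proof (intro sum.cong refl)
        fix i assume i: "i \<in> {..<a 1}"
        have "a 1 dvd a 1 * k + j - i \<and> a 1 * k + j \<ge> i \<longleftrightarrow> i = j"
        proof
          assume *: "a 1 dvd a 1 * k + j - i \<and> a 1 * k + j \<ge> i"
          then have "(a 1 * k + j) mod a 1 = i mod a 1"
            by (metis mod_eq_dvd_iff_nat)
          then show "i = j"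
            using i j by simp
        qed simp
        then show "((\<rho> (b i) oo fps_X ^ a 1) * fps_X ^ i) $ (a 1 * k + j) = (if i = j then \<rho> (b j) $ k else 0)"
          using a1 by (auto simp: fps_X_power_mult_right_nth comp_nth[unfolded One_nat_def] not_less)
      qed
      also have "\<dots> = \<rho> (b j) $ k"
        using j by simp
      finally show "\<rho> (b j) $ k = 0 $ k"
        by simp
    qed
    then have "poly (?k r) (Var 1) = 0"
      unfolding r_eq by simp
    then show ?thesis
      using p_eq by simp
  qed

  show ?thesis
  proof (rule that)
    show "ring_map (\<lambda>p. fps_to_fls (\<Theta> p))"
      by (rule ring_map_comp[OF ring_map_fps_to_fls \<Theta>])
    show "fps_to_fls (\<Theta> p) = 0 \<longleftrightarrow> ?F dvd p" for p
      using \<Theta>_kernel \<Theta>_F by (auto simp: ring_map_mult[OF \<Theta>] elim!: dvdE)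
  qed
qed

section \<open>Realizing Pham--Brieskorn rings and their Veronese subrings inside a field\<close>

lemma conjugate_lnd:
  assumes "f ` A \<subseteq> B" "g ` B \<subseteq> A" "\<And>x. x \<in> A \<Longrightarrow> g (f x) = x" "d \<in> A \<rightarrow> A" "x \<in> A"
  shows "((\<lambda>y. f (d (g y))) ^^ k) (f x) = f ((d ^^ k) x)" "(d ^^ k) x \<in> A"
proof (induction k)
  case (Suc k)
  {
    case 1
    show ?case
      using Suc assms by simp
  next
    case 2
    show ?case
      using Suc assms by auto
  }
qed (use assms in auto)

text \<open>Locally nilpotent derivations are carried along the isomorphism \<open>f\<close> by
  conjugation, in both directions.\<close>

lemma rigid_iff_rigid_on:
  fixes R :: "('r, 'm) ring_scheme" and A :: "'a::comm_ring_1 set"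
  assumes bij: "bij_betw f (carrier R) A"
    and zero: "\<zero>\<^bsub>R\<^esub> \<in> carrier R" "f \<zero>\<^bsub>R\<^esub> = 0"
    and add: "\<And>x y. x \<in> carrier R \<Longrightarrow> y \<in> carrier R \<Longrightarrow> x \<oplus>\<^bsub>R\<^esub> y \<in> carrier R \<and> f (x \<oplus>\<^bsub>R\<^esub> y) = f x + f y"
    and mult: "\<And>x y. x \<in> carrier R \<Longrightarrow> y \<in> carrier R \<Longrightarrow> x \<otimes>\<^bsub>R\<^esub> y \<in> carrier R \<and> f (x \<otimes>\<^bsub>R\<^esub> y) = f x * f y"
  shows "rigid R \<longleftrightarrow> rigid_on A"
proof -
  define g where "g = inv_into (carrier R) f"
  have fA: "f x \<in> A" and gf: "g (f x) = x" if "x \<in> carrier R" for x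
    using bij that by (auto simp: g_def bij_betw_def)
  have gR: "g y \<in> carrier R" and fg: "f (g y) = y" if "y \<in> A" for y
    using bij that by (auto simp: g_def bij_betw_def inv_into_into f_inv_into_f)
  have inj: "x = y" if "f x = f y" "x \<in> carrier R" "y \<in> carrier R" for x y
    using gf that by metis
  have g_add: "g (x + y) = g x \<oplus>\<^bsub>R\<^esub> g y" if "x \<in> A" "y \<in> A" for x y
  proof -
    have "f (g x \<oplus>\<^bsub>R\<^esub> g y) = x + y"
      using that by (simp add: add gR fg)
    then show "g (x + y) = g x \<oplus>\<^bsub>R\<^esub> g y"
      using gf add that gR by metis
  qed
  have g_mult: "g (x * y) = g x \<otimes>\<^bsub>R\<^esub> g y" and mult_A: "x * y \<in> A" if "x \<in> A" "y \<in> A" for x y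
  proof -
    have "f (g x \<otimes>\<^bsub>R\<^esub> g y) = x * y"
      using that by (simp add: mult gR fg)
    then show "g (x * y) = g x \<otimes>\<^bsub>R\<^esub> g y" "x * y \<in> A"
      using gf fA mult that gR by metis+
  qed
  have g_zero: "g 0 = \<zero>\<^bsub>R\<^esub>"
    using gf zero by metis
  show ?thesis
  proof
    assume rigid: "rigid R"
    show "rigid_on A"
      unfolding rigid_on_def
    proof (intro allI impI ballI)
      fix \<delta> x assume lnd: "lnd_on A \<delta>" and x: "x \<in> A"
      define e where "e = (\<lambda>y. g (\<delta> (f y)))"
      have \<delta>: "\<delta> \<in> A \<rightarrow> A"
        using lnd by (simp add: lnd_on_def)
      have dA: "\<delta> y \<in> A" if "y \<in> A" for y
        using \<delta> that by auto
      have "derivation R e"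
        unfolding derivation_def e_def using lnd dA
        by (simp add: lnd_on_def add mult fA gR g_add g_mult mult_A gf)
      moreover have "locally_nilpotent R e"
        unfolding locally_nilpotent_def
      proof
        fix b assume b: "b \<in> carrier R"
        obtain N where "N > 0" "(\<delta> ^^ N) (f b) = 0"
          using lnd fA[OF b] by (auto simp: lnd_on_def)
        moreover have "(e ^^ N) (g (f b)) = g ((\<delta> ^^ N) (f b))"
          unfolding e_def using fA gR fg b \<delta> by (intro conjugate_lnd(1)[of g A "carrier R" f]) auto
        ultimately show "\<exists>m>0. (e ^^ m) b = \<zero>\<^bsub>R\<^esub>"
          using g_zero gf[OF b] by auto
      qed
      ultimately have "e (g x) = \<zero>\<^bsub>R\<^esub>"
        using rigid gR[OF x] by (simp add: rigid_def)
      then have "f (g (\<delta> x)) = 0"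
        using x by (simp add: e_def fg zero)
      then show "\<delta> x = 0"
        using fg dA x by simp
    qed
  next
    assume rigid: "rigid_on A"
    show "rigid R"
      unfolding rigid_def
    proof (intro allI impI ballI, elim conjE)
      fix \<delta> x assume der: "derivation R \<delta>" and nil: "locally_nilpotent R \<delta>" and x: "x \<in> carrier R"
      define e where "e = (\<lambda>y. f (\<delta> (g y)))"
      have \<delta>: "\<delta> \<in> carrier R \<rightarrow> carrier R"
        using der by (simp add: derivation_def)
      have dR: "\<delta> y \<in> carrier R" if "y \<in> carrier R" for y
        using \<delta> that by auto
      have "lnd_on A e"
        unfolding lnd_on_def
      proof (intro conjI ballI)
        fix b assume b: "b \<in> A"
        obtain N where "N > 0" "(\<delta> ^^ N) (g b) = \<zero>\<^bsub>R\<^esub>"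
          using nil gR[OF b] by (auto simp: locally_nilpotent_def)
        moreover have "(e ^^ N) (f (g b)) = f ((\<delta> ^^ N) (g b))"
          unfolding e_def using fA gR gf b \<delta> by (intro conjugate_lnd(1)[of f "carrier R" A g]) auto
        ultimately show "\<exists>m>0. (e ^^ m) b = 0"
          using zero fg[OF b] by auto
      qed (use der dR in \<open>auto simp: derivation_def e_def add mult fA gR g_add g_mult fg\<close>)
      then have "e (f x) = 0"
        using rigid fA[OF x] unfolding rigid_on_def by blast
      then have "f (\<delta> (g (f x))) = 0"
        by (simp add: e_def)
      then show "\<delta> x = \<zero>\<^bsub>R\<^esub>"
        using gf[OF x] zero inj[of "\<delta> x" "\<zero>\<^bsub>R\<^esub>"] dR[OF x] by simp
    qed
  qed
qed

context
  fixes n :: nat and a :: "nat \<Rightarrow> nat"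
begin

definition pb_class :: "'k::field_char_0 mpoly \<Rightarrow> 'k mpoly set" where
  "pb_class p = pham_brieskorn_ideal n a +>\<^bsub>poly_ring_vars n\<^esub> p"

text \<open>Divisibility refers to the type of all polynomials, whose cofactors may contain
  variables outside \<open>{1..n}\<close>. Setting those to zero changes neither \<open>p\<close>
  nor the generator.\<close>

lemma pham_brieskorn_ideal_eq:
  "pham_brieskorn_ideal n a = {p \<in> vars_in {1..n}. pham_brieskorn_poly n a dvd (p :: 'k::field_char_0 mpoly)}"
proof (intro equalityI subsetI)
  fix p :: "'k mpoly" assume "p \<in> pham_brieskorn_ideal n a"
  then obtain q where "q \<in> vars_in {1..n}" "p = q * pham_brieskorn_poly n a"
    unfolding pham_brieskorn_ideal_def cgenideal_def carrier_poly_ring_vars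
    by (auto simp: poly_ring_vars_def)
  then show "p \<in> {p \<in> vars_in {1..n}. pham_brieskorn_poly n a dvd p}"
    using pham_brieskorn_poly_in_carrier[of n a] by (auto simp: carrier_poly_ring_vars intro: vars_in_mult)
next
  fix p :: "'k mpoly" assume "p \<in> {p \<in> vars_in {1..n}. pham_brieskorn_poly n a dvd p}"
  then obtain q where p: "p \<in> vars_in {1..n}" and q: "p = pham_brieskorn_poly n a * q"
    by auto
  have F: "pham_brieskorn_poly n a \<in> (vars_in {1..n} :: 'k mpoly set)"
    using pham_brieskorn_poly_in_carrier[of n a] by (simp add: carrier_poly_ring_vars)
  have "kill (- {1..n}) q \<in> vars_in (UNIV - - {1..n})"
    by (rule kill_in_vars_in) (simp add: supp_on_def)
  moreover have "kill (- {1..n}) p = kill (- {1..n}) (pham_brieskorn_poly n a) * kill (- {1..n}) q"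
    unfolding q by (rule ring_map_mult[OF ring_map_kill])
  ultimately have "kill (- {1..n}) q \<in> vars_in {1..n}" "p = kill (- {1..n}) q * pham_brieskorn_poly n a"
    using p F by (simp_all add: kill_id Diff_eq)
  then show "p \<in> pham_brieskorn_ideal n a"
    unfolding pham_brieskorn_ideal_def cgenideal_def carrier_poly_ring_vars
    by (auto simp: poly_ring_vars_def)
qed

lemma pham_brieskorn_ideal_ideal:
  "ideal (pham_brieskorn_ideal n a :: 'k::field_char_0 mpoly set) (poly_ring_vars n)"
  unfolding pham_brieskorn_ideal_def
  by (intro cring.cgenideal_ideal poly_ring_vars_cring pham_brieskorn_poly_in_carrier)

lemma mem_pb_class_iff:
  fixes p :: "'k::field_char_0 mpoly"
  assumes "p \<in> vars_in {1..n}"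
  shows "q \<in> pb_class p \<longleftrightarrow> q \<in> vars_in {1..n} \<and> pham_brieskorn_poly n a dvd q - p"
proof
  assume "q \<in> pb_class p"
  then show "q \<in> vars_in {1..n} \<and> pham_brieskorn_poly n a dvd q - p"
    using assms by (auto simp: pb_class_def a_r_coset_def' poly_ring_vars_def pham_brieskorn_ideal_eq
        intro: supp_on_add)
next
  assume "q \<in> vars_in {1..n} \<and> pham_brieskorn_poly n a dvd q - p"
  then have "q - p \<in> pham_brieskorn_ideal n a" "q = (q - p) + p"
    using assms by (auto simp: pham_brieskorn_ideal_eq intro: supp_on_diff)
  then show "q \<in> pb_class p"
    unfolding pb_class_def a_r_coset_def' by (auto simp: poly_ring_vars_def intro: bexI[of _ "q - p"])
qed

lemma pb_class_eq_iff:
  fixes p q :: "'k::field_char_0 mpoly"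
  assumes "p \<in> vars_in {1..n}" "q \<in> vars_in {1..n}"
  shows "pb_class p = pb_class q \<longleftrightarrow> pham_brieskorn_poly n a dvd p - q"
proof
  assume "pb_class p = pb_class q"
  moreover have "p \<in> pb_class p"
    using assms by (simp add: mem_pb_class_iff)
  ultimately show "pham_brieskorn_poly n a dvd p - q"
    using assms by (simp add: mem_pb_class_iff)
next
  assume *: "pham_brieskorn_poly n a dvd p - q"
  have "pham_brieskorn_poly n a dvd r - p \<longleftrightarrow> pham_brieskorn_poly n a dvd r - q" for r
    using dvd_add_right_iff[OF *, of "r - p"] by simp
  then show "pb_class p = pb_class q"
    using assms by (auto simp: mem_pb_class_iff)
qed

lemma pb_zero: "\<zero>\<^bsub>pham_brieskorn n a\<^esub> = (pb_class 0 :: 'k::field_char_0 mpoly set)"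
proof -
  have "pb_class 0 = (pham_brieskorn_ideal n a :: 'k mpoly set)"
    by (auto simp: mem_pb_class_iff supp_on_zero pham_brieskorn_ideal_eq)
  then show ?thesis
    by (simp add: pham_brieskorn_def FactRing_def)
qed

lemma pb_add:
  fixes p q :: "'k::field_char_0 mpoly"
  assumes "p \<in> vars_in {1..n}" "q \<in> vars_in {1..n}"
  shows "pb_class p \<oplus>\<^bsub>pham_brieskorn n a\<^esub> pb_class q = pb_class (p + q)"
proof -
  interpret ideal "pham_brieskorn_ideal n a :: 'k mpoly set" "poly_ring_vars n"
    by (rule pham_brieskorn_ideal_ideal)
  show ?thesis
    using a_rcos_sum[of p q] assms
    by (simp add: pham_brieskorn_def FactRing_def pb_class_def carrier_poly_ring_vars)
      (simp add: poly_ring_vars_def)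
qed

lemma pb_mult:
  fixes p q :: "'k::field_char_0 mpoly"
  assumes "p \<in> vars_in {1..n}" "q \<in> vars_in {1..n}"
  shows "pb_class p \<otimes>\<^bsub>pham_brieskorn n a\<^esub> pb_class q = pb_class (p * q)"
proof -
  interpret ideal "pham_brieskorn_ideal n a :: 'k mpoly set" "poly_ring_vars n"
    by (rule pham_brieskorn_ideal_ideal)
  show ?thesis
    using rcoset_mult_add[of p q] assms
    by (simp add: pham_brieskorn_def FactRing_def pb_class_def carrier_poly_ring_vars)
      (simp add: poly_ring_vars_def)
qed

lemma pb_carrier: "carrier (pham_brieskorn n a) = (pb_class ` vars_in {1..n} :: 'k::field_char_0 mpoly set set)"
  by (auto simp: pham_brieskorn_def FactRing_def A_RCOSETS_def' pb_class_def carrier_poly_ring_vars)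

lemma pb_finsum:
  fixes f :: "'i \<Rightarrow> 'k::field_char_0 mpoly"
  assumes "finite A" "\<And>i. i \<in> A \<Longrightarrow> f i \<in> vars_in {1..n}"
  shows "(\<Oplus>\<^bsub>pham_brieskorn n a\<^esub>i\<in>A. pb_class (f i)) = pb_class (sum f A)"
  using assms
proof (induction A rule: finite_induct)
  case empty
  interpret cring "pham_brieskorn n a :: 'k mpoly set ring"
    by (rule pham_brieskorn_cring)
  show ?case
    by (simp add: pb_zero)
next
  case (insert x A)
  interpret cring "pham_brieskorn n a :: 'k mpoly set ring"
    by (rule pham_brieskorn_cring)
  have "(\<Oplus>\<^bsub>pham_brieskorn n a\<^esub>i\<in>insert x A. pb_class (f i)) =
      pb_class (f x) \<oplus>\<^bsub>pham_brieskorn n a\<^esub> (\<Oplus>\<^bsub>pham_brieskorn n a\<^esub>i\<in>A. pb_class (f i))"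
    using insert by (intro finsum_insert) (auto simp: pb_carrier)
  then show ?case
    using insert by (simp add: pb_add supp_on_sum)
qed

text \<open>A class goes to the value of \<open>\<theta>\<close> at any representative in
  \<open>W\<close>; the kernel condition makes this well defined and injective. \<open>W\<close> is
  all polynomials for the full ring and a smaller set for a Veronese subring.\<close>

lemma rigid_quotient_iff:
  fixes \<theta> :: "'k::field_char_0 mpoly \<Rightarrow> 'b::comm_ring_1"
  assumes \<theta>: "ring_map \<theta>" and ker: "\<And>p. p \<in> vars_in {1..n} \<Longrightarrow> \<theta> p = 0 \<longleftrightarrow> pham_brieskorn_poly n a dvd p"
    and W: "W \<subseteq> vars_in {1..n}" "0 \<in> W" "\<And>p q. p \<in> W \<Longrightarrow> q \<in> W \<Longrightarrow> p + q \<in> W"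
      "\<And>p q. p \<in> W \<Longrightarrow> q \<in> W \<Longrightarrow> p * q \<in> W"
  shows "rigid (pham_brieskorn n a\<lparr>carrier := pb_class ` W\<rparr>) \<longleftrightarrow> rigid_on (\<theta> ` W)"
proof -
  define f where "f C = \<theta> (SOME p. p \<in> W \<and> C = pb_class p)" for C
  have eq: "\<theta> p = \<theta> q \<longleftrightarrow> pb_class p = pb_class q" if "p \<in> W" "q \<in> W" for p q
  proof -
    have "\<theta> p = \<theta> q \<longleftrightarrow> \<theta> (p - q) = 0"
      by (simp add: ring_map_diff[OF \<theta>])
    also have "\<dots> \<longleftrightarrow> pb_class p = pb_class q"
    proof -
      have "p \<in> vars_in {1..n}" "q \<in> vars_in {1..n}"
        using that W(1) by auto
      then show ?thesis
        using ker[OF supp_on_diff] pb_class_eq_iff by blast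
    qed
    finally show ?thesis .
  qed
  have f: "f (pb_class p) = \<theta> p" if "p \<in> W" for p
  proof -
    let ?q = "SOME q. q \<in> W \<and> pb_class p = pb_class q"
    have "?q \<in> W \<and> pb_class p = pb_class ?q"
      by (rule someI[of _ p]) (simp add: that)
    then have "\<theta> ?q = \<theta> p"
      using eq that by metis
    then show ?thesis
      by (simp add: f_def)
  qed
  show ?thesis
  proof (rule rigid_iff_rigid_on)
    show "bij_betw f (carrier (pham_brieskorn n a\<lparr>carrier := pb_class ` W\<rparr>)) (\<theta> ` W)"
      unfolding bij_betw_def
    proof
      show "inj_on f (carrier (pham_brieskorn n a\<lparr>carrier := pb_class ` W\<rparr>))"
        using eq by (auto simp: inj_on_def f)
      show "f ` carrier (pham_brieskorn n a\<lparr>carrier := pb_class ` W\<rparr>) = \<theta> ` W"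
        by (simp add: image_image f)
    qed
  qed (use W in \<open>auto simp: pb_zero pb_add pb_mult subset_iff f ring_map_simps[OF \<theta>]\<close>)
qed

section \<open>Veronese subrings described by representatives\<close>

definition veronese_polys :: "nat \<Rightarrow> 'k::field_char_0 mpoly set" where
  "veronese_polys d = {p \<in> vars_in {1..n}. \<forall>m\<in>Poly_Mapping.keys p. d dvd weighted_degree n a m}"

text \<open>A sum of homogeneous classes is the class of the sum of homogeneous representatives.
  Conversely a polynomial splits into its homogeneous parts.\<close>

lemma carrier_veronese:
  "carrier (veronese (pham_brieskorn n a) (pham_brieskorn_grading n a) d) =
     pb_class ` (veronese_polys d :: 'k::field_char_0 mpoly set)"
proof (intro equalityI subsetI)
  fix C :: "'k mpoly set" assume "C \<in> carrier (veronese (pham_brieskorn n a) (pham_brieskorn_grading n a) d)"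
  then obtain A x where C: "C = (\<Oplus>\<^bsub>pham_brieskorn n a\<^esub>i\<in>A. x i)" and A: "finite A"
    and x: "\<forall>i\<in>A. int d dvd i \<and> x i \<in> pham_brieskorn_grading n a i"
    by (auto simp: veronese_def)
  have "\<forall>i\<in>A. \<exists>p. p \<in> vars_in {1..n} \<and> (\<forall>m\<in>Poly_Mapping.keys p. int (weighted_degree n a m) = i) \<and> x i = pb_class p"
    using x by (auto simp: pham_brieskorn_grading_def pb_class_def carrier_poly_ring_vars)
  then obtain f where f: "\<And>i. i \<in> A \<Longrightarrow> f i \<in> vars_in {1..n}"
    "\<And>i m. i \<in> A \<Longrightarrow> m \<in> Poly_Mapping.keys (f i) \<Longrightarrow> int (weighted_degree n a m) = i"
    "\<And>i. i \<in> A \<Longrightarrow> x i = pb_class (f i)"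
    by metis
  interpret cring "pham_brieskorn n a :: 'k mpoly set ring"
    by (rule pham_brieskorn_cring)
  have "C = (\<Oplus>\<^bsub>pham_brieskorn n a\<^esub>i\<in>A. pb_class (f i))"
    unfolding C using f by (intro finsum_cong') (auto simp: pb_carrier)
  also have "\<dots> = pb_class (sum f A)"
    using A f by (intro pb_finsum) auto
  finally have "C = pb_class (sum f A)" .
  moreover have "d dvd weighted_degree n a m" if "i \<in> A" "m \<in> Poly_Mapping.keys (f i)" for i m
    using x f(2)[OF that] that(1) by (metis int_dvd_int_iff)
  then have "sum f A \<in> veronese_polys d"
    using f(1) keys_sum[of f A] by (auto simp: veronese_polys_def intro: supp_on_sum)
  ultimately show "C \<in> pb_class ` veronese_polys d"
    by blast
next
  fix C :: "'k mpoly set" assume "C \<in> pb_class ` veronese_polys d"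
  then obtain p where C: "C = pb_class p" and p: "p \<in> vars_in {1..n}"
    "\<And>m. m \<in> Poly_Mapping.keys p \<Longrightarrow> d dvd weighted_degree n a m"
    by (auto simp: veronese_polys_def)
  let ?A = "(\<lambda>m. int (weighted_degree n a m)) ` Poly_Mapping.keys p"
  let ?f = "\<lambda>i. part (\<lambda>m. int (weighted_degree n a m) = i) p"
  have "(\<Oplus>\<^bsub>pham_brieskorn n a\<^esub>i\<in>?A. pb_class (?f i)) = pb_class (sum ?f ?A)"
    using p(1) by (intro pb_finsum) (auto intro: supp_on_part)
  also have "sum ?f ?A = p"
    by (rule sum_part_residues) auto
  finally have "C = (\<Oplus>\<^bsub>pham_brieskorn n a\<^esub>i\<in>?A. pb_class (?f i))"
    by (simp add: C)
  moreover have "\<forall>i\<in>?A. int d dvd i \<and> pb_class (?f i) \<in> pham_brieskorn_grading n a i"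
  proof
    fix i assume "i \<in> ?A"
    then have "int d dvd i"
      using p(2) by auto
    moreover have "?f i \<in> vars_in {1..n}"
      using p(1) by (rule supp_on_part)
    then have "pb_class (?f i) \<in> pham_brieskorn_grading n a i"
      unfolding pham_brieskorn_grading_def pb_class_def carrier_poly_ring_vars
      by (auto simp: keys_part)
    ultimately show "int d dvd i \<and> pb_class (?f i) \<in> pham_brieskorn_grading n a i" ..
  qed
  moreover have "finite ?A"
    by simp
  ultimately show "C \<in> carrier (veronese (pham_brieskorn n a) (pham_brieskorn_grading n a) d)"
    unfolding veronese_def by fastforce
qed

lemma weighted_degree_add: "weighted_degree n a (m + m') = weighted_degree n a m + weighted_degree n a m'"
  by (simp add: weighted_degree_def lookup_add distrib_right sum.distrib)

lemma rigid_veronese_iff: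
  fixes \<theta> :: "'k::field_char_0 mpoly \<Rightarrow> 'b::comm_ring_1"
  assumes "ring_map \<theta>" "\<And>p. \<theta> p = 0 \<longleftrightarrow> pham_brieskorn_poly n a dvd p"
  shows "rigid (veronese (pham_brieskorn n a :: 'k mpoly set ring) (pham_brieskorn_grading n a) d) \<longleftrightarrow>
    rigid_on (\<theta> ` veronese_polys d)"
proof -
  have "p * q \<in> veronese_polys d" if "p \<in> veronese_polys d" "q \<in> veronese_polys d" for p q :: "'k mpoly"
  proof -
    have "d dvd weighted_degree n a m" if m: "m \<in> Poly_Mapping.keys (p * q)" for m
    proof -
      obtain u v where "m = u + v" "u \<in> Poly_Mapping.keys p" "v \<in> Poly_Mapping.keys q"
        using keys_mult[of p q] m by blast
      then show ?thesis
        using \<open>p \<in> _\<close> \<open>q \<in> _\<close> by (simp add: veronese_polys_def weighted_degree_add)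
    qed
    then show ?thesis
      using that by (simp add: veronese_polys_def vars_in_mult)
  qed
  moreover have "p + q \<in> veronese_polys d" if "p \<in> veronese_polys d" "q \<in> veronese_polys d" for p q :: "'k mpoly"
  proof -
    have "d dvd weighted_degree n a m" if "m \<in> Poly_Mapping.keys (p + q)" for m
      using keys_add[of p q] that \<open>p \<in> _\<close> \<open>q \<in> _\<close> by (auto simp: veronese_polys_def)
    then show ?thesis
      using that by (simp add: veronese_polys_def supp_on_add)
  qed
  moreover have "0 \<in> (veronese_polys d :: 'k mpoly set)" "veronese_polys d \<subseteq> (vars_in {1..n} :: 'k mpoly set)"
    by (auto simp: veronese_polys_def supp_on_zero)
  ultimately have "rigid (pham_brieskorn n a\<lparr>carrier := pb_class ` (veronese_polys d :: 'k mpoly set)\<rparr>) \<longleftrightarrow>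
      rigid_on (\<theta> ` veronese_polys d)"
    using assms by (intro rigid_quotient_iff) auto
  moreover have "veronese (pham_brieskorn n a) (pham_brieskorn_grading n a) d =
      pham_brieskorn n a\<lparr>carrier := pb_class ` (veronese_polys d :: 'k mpoly set)\<rparr>"
    using carrier_veronese[of d, where 'k='k] by (simp add: veronese_def)
  ultimately show ?thesis
    by simp
qed

lemma rigid_pham_brieskorn_iff:
  fixes \<theta> :: "'k::field_char_0 mpoly \<Rightarrow> 'b::comm_ring_1"
  assumes "ring_map \<theta>" "\<And>p. p \<in> vars_in {1..n} \<Longrightarrow> \<theta> p = 0 \<longleftrightarrow> pham_brieskorn_poly n a dvd p"
  shows "rigid (pham_brieskorn n a :: 'k mpoly set ring) \<longleftrightarrow> rigid_on (\<theta> ` vars_in {1..n})"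
  using rigid_quotient_iff[OF assms subset_refl supp_on_zero supp_on_add vars_in_mult]
  unfolding pb_carrier[symmetric] by simp

end

section \<open>Arithmetic of the exponents\<close>

lemma gcd_mult_coprime:
  fixes x y d :: nat
  assumes "coprime x y"
  shows "gcd d (x * y) = gcd d x * gcd d y"
proof (rule dvd_antisym)
  have "coprime (gcd d x) (gcd d y)"
    by (rule coprime_divisors[OF gcd_dvd2 gcd_dvd2 assms])
  then show "gcd d x * gcd d y dvd gcd d (x * y)"
    by (intro gcd_greatest mult_dvd_mono gcd_dvd2) (rule divides_mult[OF gcd_dvd1 gcd_dvd1])
  obtain u v where uv: "gcd d (x * y) = u * v" "u dvd x" "v dvd y"
    using division_decomp[of "gcd d (x * y)" x y] by auto
  have "u * v dvd d"
    unfolding uv(1)[symmetric] by (rule gcd_dvd1)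
  then have "u dvd d" "v dvd d"
    by (auto dest: dvd_mult_left dvd_mult_right)
  with uv show "gcd d (x * y) dvd gcd d x * gcd d y"
    by (simp add: mult_dvd_mono)
qed

lemma gcd_prod_coprime:
  fixes e :: "'i \<Rightarrow> nat"
  assumes "\<And>i j. i \<in> A \<Longrightarrow> j \<in> A \<Longrightarrow> i \<noteq> j \<Longrightarrow> coprime (e i) (e j)"
  shows "gcd d (\<Prod>i\<in>A. e i) = (\<Prod>i\<in>A. gcd d (e i))"
  using assms
proof (induction A rule: infinite_finite_induct)
  case (insert x A)
  have "coprime (e x) (\<Prod>i\<in>A. e i)"
    using insert by (intro prod_coprime_right) auto
  then show ?case
    using insert by (simp add: gcd_mult_coprime)
qed simp_all

text \<open>The attained residues are closed under addition and hence, being taken modulo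
  \<open>m\<close>, under all integer multiples. So they are the multiples of their least positive
  member, which divides \<open>m\<close> and all \<open>w j\<close>. Lists occur because monomials
  allow only nonnegative combinations.\<close>

lemma list_sum_residues:
  fixes w :: "'i \<Rightarrow> int" and m :: nat
  assumes m: "m > 0" and D: "\<And>D. D > 0 \<Longrightarrow> D dvd int m \<Longrightarrow> (\<And>j. j \<in> J \<Longrightarrow> D dvd w j) \<Longrightarrow> D = 1"
  shows "\<exists>js. set js \<subseteq> J \<and> [sum_list (map w js) = k] (mod int m)"
proof -
  define K where "K = {k. \<exists>js. set js \<subseteq> J \<and> [sum_list (map w js) = k] (mod int m)}"
  have add: "x + y \<in> K" if "x \<in> K" "y \<in> K" for x y
  proof -
    obtain js where "set js \<subseteq> J" "[sum_list (map w js) = x] (mod int m)"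
      using \<open>x \<in> K\<close> by (auto simp: K_def)
    moreover obtain ks where "set ks \<subseteq> J" "[sum_list (map w ks) = y] (mod int m)"
      using \<open>y \<in> K\<close> by (auto simp: K_def)
    ultimately have "set (js @ ks) \<subseteq> J" "[sum_list (map w (js @ ks)) = x + y] (mod int m)"
      by (auto intro: cong_add)
    then show ?thesis
      unfolding K_def by blast
  qed
  have cong: "y \<in> K" if "x \<in> K" "[x = y] (mod int m)" for x y
    using that cong_trans unfolding K_def by blast
  have zero: "0 \<in> K"
    unfolding K_def by (auto intro!: exI[of _ "[]"])
  have w: "w j \<in> K" if "j \<in> J" for j
    unfolding K_def using that by (auto intro!: exI[of _ "[j]"])
  have nat_mult: "int q * x \<in> K" if "x \<in> K" for q x
  proof (induction q)
    case (Suc q)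
    then show ?case
      using add[OF that Suc] by (simp add: algebra_simps)
  qed (simp add: zero)
  have mult: "q * x \<in> K" if "x \<in> K" for q x
  proof (rule cong[OF nat_mult[OF that]])
    have "[q mod int m * x = q * x] (mod int m)"
      by (simp add: cong_def mod_mult_left_eq)
    then show "[int (nat (q mod int m)) * x = q * x] (mod int m)"
      using m by simp
  qed
  have m_in: "int m \<in> K"
    by (rule cong[OF zero]) (simp add: cong_def)
  define D where "D = (LEAST q. q > 0 \<and> int q \<in> K)"
  have "m > 0 \<and> int m \<in> K"
    using m m_in ..
  then have "D > 0 \<and> int D \<in> K"
    unfolding D_def by (rule LeastI)
  then have D_in: "D > 0" "int D \<in> K"
    by auto
  have D_dvd: "int D dvd x" if "x \<in> K" for x
  proof (rule ccontr)
    assume "\<not> int D dvd x"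
    then have pos: "x mod int D > 0"
      using D_in(1) pos_mod_sign[of "int D" x] mod_0_imp_dvd[of x "int D"] by linarith
    have "x mod int D = x + (- (x div int D)) * int D"
      using div_mult_mod_eq[of x "int D"] by linarith
    also have "\<dots> \<in> K"
      by (intro add mult that D_in)
    finally have "nat (x mod int D) > 0 \<and> int (nat (x mod int D)) \<in> K"
      using pos by simp
    then have "D \<le> nat (x mod int D)"
      unfolding D_def by (rule Least_le)
    moreover have "x mod int D < int D"
      using D_in(1) by simp
    ultimately show False
      using pos by linarith
  qed
  have "int D = 1"
    using D_in(1) by (intro D D_dvd m_in w) auto
  then have "k * 1 \<in> K"
    using D_in mult by metis
  then show ?thesis
    by (simp add: K_def)
qed

section \<open>The substitution of powers of the variables\<close>

definition scale_exp :: "(nat \<Rightarrow> nat) \<Rightarrow> (nat \<Rightarrow>\<^sub>0 nat) \<Rightarrow> (nat \<Rightarrow>\<^sub>0 nat)" where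
  "scale_exp g m = (\<Sum>i\<in>Poly_Mapping.keys m. Poly_Mapping.single i (g i * Poly_Mapping.lookup m i))"

lemma lookup_scale_exp: "Poly_Mapping.lookup (scale_exp g m) i = g i * Poly_Mapping.lookup m i"
  by (auto simp: scale_exp_def lookup_sum lookup_single when_def in_keys_iff)

lemma keys_scale_exp: "(\<And>i. g i > 0) \<Longrightarrow> Poly_Mapping.keys (scale_exp g m) = Poly_Mapping.keys m"
  by (auto simp: in_keys_iff lookup_scale_exp)

lemma scale_exp_inj: "(\<And>i. g i > 0) \<Longrightarrow> scale_exp g m = scale_exp g m' \<longleftrightarrow> m = m'"
  by (simp add: poly_mapping_eq_iff fun_eq_iff lookup_scale_exp) (metis less_irrefl)

lemma scale_exp_surj:
  assumes "\<And>i. g i dvd Poly_Mapping.lookup m i" "\<And>i. g i > 0"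
  shows "\<exists>m'. m = scale_exp g m'"
proof -
  define m' where "m' = (\<Sum>i\<in>Poly_Mapping.keys m. Poly_Mapping.single i (Poly_Mapping.lookup m i div g i))"
  have "Poly_Mapping.lookup m' i = Poly_Mapping.lookup m i div g i" for i
    by (auto simp: m'_def lookup_sum lookup_single when_def in_keys_iff)
  then have "m = scale_exp g m'"
    using assms(1) by (intro poly_mapping_eqI) (simp add: lookup_scale_exp)
  then show ?thesis ..
qed

definition power_subst :: "(nat \<Rightarrow> nat) \<Rightarrow> 'k::field mpoly \<Rightarrow> 'k mpoly" where
  "power_subst g = insertion Const (\<lambda>i. Var i ^ g i)"

lemma ring_map_power_subst: "ring_map (power_subst g)"
  unfolding power_subst_def by (rule ring_map_insertion[OF ring_map_Const])

lemma power_subst_eq: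
  "power_subst g p = (\<Sum>m\<in>Poly_Mapping.keys p. Poly_Mapping.single (scale_exp g m) (Poly_Mapping.lookup p m))"
proof -
  have "mono_val (\<lambda>i. Var i ^ g i) m = (mono_val Var (scale_exp g m) :: 'a mpoly)" for m
  proof -
    have "mono_val Var (scale_exp g m) = Poly_Mapping.single (scale_exp g m) (1 :: 'a)"
      by (rule mono_val_Var)
    then show ?thesis
      by (simp add: scale_exp_def single_sum_exponents mono_val_def flip: power_mult) (simp add: Var_power)
  qed
  then show ?thesis
    by (simp add: power_subst_def insertion_def single_eq_mono)
qed

lemma keys_power_subst: "Poly_Mapping.keys (power_subst g p) \<subseteq> scale_exp g ` Poly_Mapping.keys p"
proof
  fix m assume "m \<in> Poly_Mapping.keys (power_subst g p)"
  then have "m \<in> (\<Union>m'\<in>Poly_Mapping.keys p.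
      Poly_Mapping.keys (Poly_Mapping.single (scale_exp g m') (Poly_Mapping.lookup p m')))"
    unfolding power_subst_eq by (rule subsetD[OF keys_sum])
  then obtain m' where m': "m' \<in> Poly_Mapping.keys p"
    "m \<in> Poly_Mapping.keys (Poly_Mapping.single (scale_exp g m') (Poly_Mapping.lookup p m'))"
    by blast
  then show "m \<in> scale_exp g ` Poly_Mapping.keys p"
    by (cases "Poly_Mapping.lookup p m' = 0") simp_all
qed

lemma lookup_power_subst:
  assumes "\<And>i. g i > 0"
  shows "Poly_Mapping.lookup (power_subst g p) (scale_exp g m) = Poly_Mapping.lookup p m"
  by (auto simp: power_subst_eq lookup_sum lookup_single when_def scale_exp_inj[OF assms] in_keys_iff)

lemma power_subst_inj:
  assumes "\<And>i. g i > 0" "power_subst g p = power_subst g q"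
  shows "p = q"
proof (rule poly_mapping_eqI)
  fix m
  show "Poly_Mapping.lookup p m = Poly_Mapping.lookup q m"
    using lookup_power_subst[of g, OF assms(1), where p=p and m=m] lookup_power_subst[of g, OF assms(1), where p=q and m=m] assms(2) by simp
qed

lemma power_subst_surj:
  fixes p :: "'k::field mpoly"
  assumes g: "\<And>i. g i > 0" and p: "\<And>m i. m \<in> Poly_Mapping.keys p \<Longrightarrow> g i dvd Poly_Mapping.lookup m i"
  obtains q where "p = power_subst g q" "Poly_Mapping.keys p = scale_exp g ` Poly_Mapping.keys q"
proof -
  have "\<exists>m'. m = scale_exp g m'" if "m \<in> Poly_Mapping.keys p" for m
    using p[OF that] g by (rule scale_exp_surj)
  then obtain h where h: "\<And>m. m \<in> Poly_Mapping.keys p \<Longrightarrow> m = scale_exp g (h m)"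
    by metis
  define q where "q = (\<Sum>m\<in>Poly_Mapping.keys p. Poly_Mapping.single (h m) (Poly_Mapping.lookup p m))"
  have single: "power_subst g (Poly_Mapping.single m c) = Poly_Mapping.single (scale_exp g m) c" for m and c :: 'k
    by (cases "c = 0") (simp_all add: power_subst_eq)
  have "power_subst g q = (\<Sum>m\<in>Poly_Mapping.keys p. Poly_Mapping.single m (Poly_Mapping.lookup p m))"
    unfolding q_def ring_map_sum[OF ring_map_power_subst] using h by (intro sum.cong) (simp_all add: single)
  then have eq: "p = power_subst g q"
    by (simp only: sum_single_keys)
  moreover have "Poly_Mapping.keys p = scale_exp g ` Poly_Mapping.keys q"
  proof
    show "Poly_Mapping.keys p \<subseteq> scale_exp g ` Poly_Mapping.keys q"
      unfolding eq by (rule keys_power_subst)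
    show "scale_exp g ` Poly_Mapping.keys q \<subseteq> Poly_Mapping.keys p"
      unfolding eq by (auto simp: in_keys_iff lookup_power_subst[OF g])
  qed
  ultimately show ?thesis
    using that by blast
qed

section \<open>The numbers e_i = L / L_i and the degrees of the variables\<close>

locale exponents =
  fixes n :: nat and a :: "nat \<Rightarrow> nat"
  assumes n3: "n \<ge> 3" and a_pos: "i \<in> {1..n} \<Longrightarrow> a i > 0"
begin

abbreviation "L \<equiv> L_all n a"

definition e :: "nat \<Rightarrow> nat" where "e i = L div L_omit n a i"

lemma L_pos: "L > 0"
proof -
  have "0 \<notin> a ` {1..n}"
    using a_pos by force
  then have "L \<noteq> 0"
    unfolding L_all_def by (subst Lcm_0_iff) auto
  then show ?thesis
    by simp
qed

lemma a_dvd_L: "i \<in> {1..n} \<Longrightarrow> a i dvd L"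
  by (simp add: L_all_def dvd_Lcm)

lemma L_eq_lcm: "i \<in> {1..n} \<Longrightarrow> L = lcm (a i) (L_omit n a i)"
  unfolding L_all_def L_omit_def by (simp flip: Lcm_insert image_insert add: insert_absorb)

lemma L_omit_dvd: "L_omit n a i dvd L"
  unfolding L_all_def L_omit_def by (intro Lcm_subset image_mono) auto

lemma e_mult: "e i * L_omit n a i = L"
  using L_omit_dvd by (simp add: e_def)

lemma e_pos: "e i > 0"
  using e_mult[of i] L_pos by (auto intro!: Nat.gr0I)

lemma L_omit_pos: "L_omit n a i > 0"
  using e_mult[of i] L_pos by (auto intro!: Nat.gr0I)

lemma e_outside: "i \<notin> {1..n} \<Longrightarrow> e i = 1"
proof -
  assume "i \<notin> {1..n}"
  then have "L_omit n a i = L"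
    by (simp add: L_omit_def L_all_def del: atLeastAtMost_iff)
  then show ?thesis
    using L_pos by (simp add: e_def)
qed

text \<open>The product of gcd and lcm of a_i and L_i is a_i L_i, and the lcm is L = e_i L_i; then
  L_i cancels.\<close>

lemma e_mult_gcd:
  assumes "i \<in> {1..n}"
  shows "e i * gcd (a i) (L_omit n a i) = a i"
proof -
  have "e i * L_omit n a i * gcd (a i) (L_omit n a i) = a i * L_omit n a i"
    using prod_gcd_lcm_nat[of "a i" "L_omit n a i"]
    unfolding e_mult L_eq_lcm[OF assms, symmetric] by (simp only: mult.commute)
  then have "L_omit n a i * (e i * gcd (a i) (L_omit n a i)) = L_omit n a i * a i"
    by (simp add: ac_simps)
  then show ?thesis
    using L_omit_pos[of i] by simp
qed

text \<open>For \<open>j\<close> other than \<open>i\<close>, a_j divides L_i, so L / a_j is a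
  multiple of L / L_i.\<close>

lemma e_dvd_weight:
  assumes "i \<in> {1..n}" "j \<in> {1..n}" "i \<noteq> j"
  shows "e i dvd L div a j"
proof -
  have "a j dvd L_omit n a i"
    using assms by (auto simp: L_omit_def intro: dvd_Lcm)
  then obtain c where "L_omit n a i = a j * c" ..
  then have "L = e i * c * a j"
    using e_mult[of i] by (simp add: ac_simps)
  then show ?thesis
    using a_pos[OF assms(2)] by simp
qed

text \<open>The two numbers are a_i and L_i, each divided by their greatest common divisor.\<close>

lemma coprime_e_weight:
  assumes "i \<in> {1..n}"
  shows "coprime (e i) (L div a i)"
proof -
  let ?g = "gcd (a i) (L_omit n a i)"
  have "?g > 0"
    using a_pos[OF assms] by simp
  have "e i = a i div ?g"
    using e_mult_gcd[OF assms] \<open>?g > 0\<close> by (metis nonzero_mult_div_cancel_right less_irrefl)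
  moreover have "L div a i = L_omit n a i div ?g"
  proof -
    have "a i * (L_omit n a i div ?g) = L"
      using L_eq_lcm[OF assms] by (simp add: lcm_nat_def div_mult_swap)
    then show ?thesis
      using a_pos[OF assms] by (metis nonzero_mult_div_cancel_left less_irrefl)
  qed
  ultimately show ?thesis
    using \<open>?g > 0\<close> div_gcd_coprime[of "a i" "L_omit n a i"] a_pos[OF assms] by simp
qed

lemma coprime_e:
  assumes "i \<in> {1..n}" "j \<in> {1..n}" "i \<noteq> j"
  shows "coprime (e i) (e j)"
  by (rule coprime_divisors[OF dvd_refl e_dvd_weight coprime_e_weight]) (use assms in auto)

text \<open>Together with \<open>e_dvd_weight\<close> this makes \<open>e i\<close> the greatest
  common divisor of the degrees of the other variables. If \<open>x\<close> divides every L / a_j,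
  then every a_j divides L / \<open>x\<close>, and hence so does L_i.\<close>

lemma dvd_e:
  assumes "\<And>j. j \<in> {1..n} - {i} \<Longrightarrow> x dvd L div a j" "i \<in> {1..n}"
  shows "x dvd e i"
proof -
  have ax: "x * a j dvd L" if "j \<in> {1..n} - {i}" for j
    using assms(1)[OF that] a_dvd_L that a_pos[of j] by (simp add: dvd_div_iff_mult)
  obtain j where "j \<in> {1..n} - {i}"
    using n3 by (cases "i = 1") force+
  with ax have "x dvd L"
    by (meson dvd_mult_left)
  then obtain y where y: "L = x * y" ..
  have "x > 0"
    using y L_pos by (auto intro!: Nat.gr0I)
  have "L_omit n a i dvd y"
    unfolding L_omit_def
  proof (rule Lcm_least)
    fix z assume "z \<in> a ` ({1..n} - {i})"
    then show "z dvd y"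
      using ax \<open>x > 0\<close> by (auto simp only: y nat_mult_dvd_cancel_disj)
  qed
  then have "x * L_omit n a i dvd e i * L_omit n a i"
    by (simp add: e_mult y)
  then show ?thesis
    using L_omit_pos[of i] by simp
qed

end

section \<open>The numbers attached to a fixed d\<close>

locale veronese_exponents = exponents +
  fixes d :: nat
  assumes d_pos: "d > 0"
begin

definition g :: "nat \<Rightarrow> nat" where "g i = gcd d (e i)"
definition G :: nat where "G = (\<Prod>i=1..n. g i)"
definition b :: "nat \<Rightarrow> nat" where "b = f_map n a d"
text \<open>The degree of X_i ^ g_i divided by \<open>G\<close>, which is the degree of the
  corresponding variable of B'.\<close>

definition w :: "nat \<Rightarrow> nat" where "w i = g i * (L div a i) div G"

lemma g_pos: "g i > 0"
  using d_pos by (simp add: g_def)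

lemma g_dvd_d: "g i dvd d" and g_dvd_e: "g i dvd e i"
  by (simp_all add: g_def)

lemma G_pos: "G > 0"
  unfolding G_def using g_pos by (intro prod_pos)

lemma coprime_g:
  assumes "i \<in> {1..n}" "j \<in> {1..n}" "i \<noteq> j"
  shows "coprime (g i) (g j)"
  by (rule coprime_divisors[OF g_dvd_e g_dvd_e coprime_e[OF assms]])

text \<open>The \<open>e i\<close> are pairwise coprime. Consequently \<open>G\<close> divides
  \<open>d\<close>, and the two are equal exactly when \<open>d\<close> lies in D.\<close>

lemma G_eq_gcd: "G = gcd d (\<Prod>i=1..n. e i)"
  unfolding G_def g_def using coprime_e by (intro gcd_prod_coprime[symmetric])

lemma G_dvd: "G dvd d"
  by (simp add: G_eq_gcd)

lemma G_split: "i \<in> {1..n} \<Longrightarrow> G = g i * (\<Prod>j\<in>{1..n} - {i}. g j)"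
  unfolding G_def by (intro prod.remove) auto

lemma prod_g_dvd:
  assumes "A \<subseteq> {1..n}" "\<And>i. i \<in> A \<Longrightarrow> g i dvd x"
  shows "(\<Prod>i\<in>A. g i) dvd x"
proof -
  have "finite A"
    using assms(1) finite_subset by blast
  then show ?thesis
    using assms
  proof (induction A rule: finite_induct)
    case (insert i A)
    have "coprime (g i) (\<Prod>j\<in>A. g j)"
      using insert by (intro prod_coprime_right coprime_g) auto
    then show ?case
      using insert by (simp add: divides_mult)
  qed simp
qed

text \<open>The \<open>g j\<close> with \<open>j\<close> other than \<open>i\<close> are pairwise
  coprime divisors of L / a_i, so their product divides it and the division in \<open>w\<close> is
  exact.\<close>

lemma G_mult_w: "i \<in> {1..n} \<Longrightarrow> G * w i = g i * (L div a i)"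
proof -
  assume i: "i \<in> {1..n}"
  have "(\<Prod>j\<in>{1..n} - {i}. g j) dvd L div a i"
    using i by (intro prod_g_dvd dvd_trans[OF g_dvd_e e_dvd_weight]) auto
  then have "G dvd g i * (L div a i)"
    using G_split[OF i] by simp
  then show ?thesis
    by (simp add: w_def)
qed

lemma b_mult_g: "i \<in> {1..n} \<Longrightarrow> b i * g i = a i"
proof -
  assume i: "i \<in> {1..n}"
  have "b i * g i = (e i div g i * g i) * gcd (a i) (L_omit n a i)"
    by (simp add: b_def f_map_def flip: e_def g_def)
  also have "e i div g i * g i = e i"
    by (simp add: g_def)
  finally show ?thesis
    using e_mult_gcd[OF i] by simp
qed

lemma b_pos: "i \<in> {1..n} \<Longrightarrow> b i > 0"
  using b_mult_g[of i] a_pos[of i] by (auto intro!: Nat.gr0I)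

lemma b_mult_w: "i \<in> {1..n} \<Longrightarrow> G * (b i * w i) = L"
proof -
  assume i: "i \<in> {1..n}"
  have "G * (b i * w i) = b i * (G * w i)"
    by (simp only: ac_simps)
  also have "\<dots> = (b i * g i) * (L div a i)"
    by (simp only: G_mult_w[OF i] ac_simps)
  also have "\<dots> = L"
    using b_mult_g[OF i] a_dvd_L[OF i] by simp
  finally show ?thesis .
qed

text \<open>Each L / a_j with \<open>j\<close> other than \<open>i\<close> is a multiple of
  \<open>g i * D\<close>, hence so is \<open>e i\<close> by \<open>dvd_e\<close>. As
  \<open>g i * D\<close> also divides \<open>d\<close>, it divides gcd(d, e_i), which is
  \<open>g i\<close>.\<close>

lemma weights_coprime:
  assumes i: "i \<in> {1..n}" and D: "D dvd d div G" "\<And>j. j \<in> {1..n} - {i} \<Longrightarrow> D dvd w j"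
  shows "D = 1"
proof -
  have GD: "G * D dvd d"
    using D(1) G_dvd G_pos by (simp add: dvd_div_iff_mult mult.commute)
  have "g i * D dvd L div a j" if j: "j \<in> {1..n} - {i}" for j
  proof -
    have "G * D dvd g j * (L div a j)"
    proof -
      have "G * D dvd G * w j"
        by (rule mult_dvd_mono[OF dvd_refl D(2)[OF j]])
      also have "G * w j = g j * (L div a j)"
        using j by (intro G_mult_w) simp
      finally show ?thesis .
    qed
    then have "g j * ((\<Prod>k\<in>{1..n} - {j}. g k) * D) dvd g j * (L div a j)"
      using G_split[of j] j by (simp add: mult.assoc)
    then have "(\<Prod>k\<in>{1..n} - {j}. g k) * D dvd L div a j"
      using g_pos[of j] by simp
    moreover have "g i dvd (\<Prod>k\<in>{1..n} - {j}. g k)"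
      using i j by (intro dvd_prodI) auto
    ultimately show ?thesis
      using dvd_trans[OF mult_dvd_mono[OF _ dvd_refl]] by blast
  qed
  then have "g i * D dvd e i"
    using i by (intro dvd_e)
  moreover have "g i * D dvd d"
  proof (rule dvd_trans[OF mult_dvd_mono[OF _ dvd_refl] GD])
    show "g i dvd G"
      unfolding G_split[OF i] by (rule dvd_triv_left)
  qed
  ultimately have "g i * D dvd g i * 1"
    unfolding g_def by simp
  then show ?thesis
    using g_pos[of i] by simp
qed

text \<open>Modulo \<open>g i\<close> only the variable \<open>i\<close> contributes to the degree,
  and its degree is coprime to \<open>g i\<close>.\<close>

lemma dvd_exponent:
  assumes "d dvd weighted_degree n a m" "i \<in> {1..n}"
  shows "g i dvd Poly_Mapping.lookup m i"
proof -
  have "weighted_degree n a m = Poly_Mapping.lookup m i * (L div a i) +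
      (\<Sum>j\<in>{1..n} - {i}. Poly_Mapping.lookup m j * (L div a j))"
    unfolding weighted_degree_def using assms(2) by (intro sum.remove) auto
  moreover have "g i dvd (\<Sum>j\<in>{1..n} - {i}. Poly_Mapping.lookup m j * (L div a j))"
    using assms(2) by (intro dvd_sum dvd_mult dvd_trans[OF g_dvd_e e_dvd_weight]) auto
  moreover have "g i dvd weighted_degree n a m"
    by (rule dvd_trans[OF g_dvd_d assms(1)])
  ultimately have "g i dvd Poly_Mapping.lookup m i * (L div a i)"
    by (metis dvd_add_left_iff)
  moreover have "coprime (g i) (L div a i)"
    by (rule coprime_divisors[OF g_dvd_e dvd_refl coprime_e_weight[OF assms(2)]])
  ultimately show ?thesis
    by (simp add: coprime_dvd_mult_left_iff)
qed

definition wdeg :: "(nat \<Rightarrow>\<^sub>0 nat) \<Rightarrow> nat" where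
  "wdeg m = (\<Sum>i=1..n. Poly_Mapping.lookup m i * w i)"

lemma wdeg_add: "wdeg (m + m') = wdeg m + wdeg m'"
  by (simp add: wdeg_def lookup_add distrib_right sum.distrib)

lemma wdeg_single: "i \<in> {1..n} \<Longrightarrow> wdeg (Poly_Mapping.single i k) = k * w i"
  by (simp add: wdeg_def lookup_single when_def if_distrib[of "\<lambda>x. x * _"] cong: if_cong)

lemma weighted_degree_scale_exp: "weighted_degree n a (scale_exp g m) = G * wdeg m"
  unfolding weighted_degree_def wdeg_def sum_distrib_left lookup_scale_exp
  by (intro sum.cong refl) (use G_mult_w in \<open>simp add: ac_simps\<close>)

lemma d_dvd_iff: "d dvd G * k \<longleftrightarrow> d div G dvd k"
proof -
  have "d dvd G * k \<longleftrightarrow> G * (d div G) dvd G * k"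
    using G_dvd by simp
  then show ?thesis
    using G_pos by simp
qed

text \<open>
  The monomials of degree divisible by \<open>d\<close> are monomials in the powers \<open>X\<^sub>i ^ g\<^sub>i\<close>, and
  these powers satisfy the Pham--Brieskorn relation with exponents \<open>f(d)\<close>.
\<close>

lemma veronese_polys_eq:
  "veronese_polys n a d =
     power_subst g ` {p \<in> vars_in {1..n}. \<forall>m\<in>Poly_Mapping.keys p. d div G dvd wdeg m}"
proof (intro equalityI subsetI)
  fix p :: "'a mpoly" assume p: "p \<in> veronese_polys n a d"
  have "g i dvd Poly_Mapping.lookup m i" if "m \<in> Poly_Mapping.keys p" for m i
  proof (cases "i \<in> {1..n}")
    case True
    then show ?thesis
      using p that by (intro dvd_exponent) (auto simp: veronese_polys_def)
  next
    case False
    then show ?thesis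
      by (simp add: g_def e_outside)
  qed
  from power_subst_surj[OF g_pos this] obtain q where
    q: "p = power_subst g q" "Poly_Mapping.keys p = scale_exp g ` Poly_Mapping.keys q"
    by blast
  then have "q \<in> {p \<in> vars_in {1..n}. \<forall>m\<in>Poly_Mapping.keys p. d div G dvd wdeg m}"
    using p by (simp add: veronese_polys_def supp_on_def keys_scale_exp g_pos
        weighted_degree_scale_exp d_dvd_iff)
  with q show "p \<in> power_subst g ` {p \<in> vars_in {1..n}. \<forall>m\<in>Poly_Mapping.keys p. d div G dvd wdeg m}"
    by blast
next
  fix p :: "'a mpoly"
  assume "p \<in> power_subst g ` {p \<in> vars_in {1..n}. \<forall>m\<in>Poly_Mapping.keys p. d div G dvd wdeg m}"
  then obtain q where q: "p = power_subst g q" "q \<in> vars_in {1..n}"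
    "\<And>m. m \<in> Poly_Mapping.keys q \<Longrightarrow> d div G dvd wdeg m"
    by blast
  have "Poly_Mapping.keys m \<subseteq> {1..n} \<and> d dvd weighted_degree n a m" if "m \<in> Poly_Mapping.keys p" for m
  proof -
    obtain m' where "m = scale_exp g m'" "m' \<in> Poly_Mapping.keys q"
      using keys_power_subst[of g q] \<open>m \<in> Poly_Mapping.keys p\<close> q(1) by blast
    then show ?thesis
      using q by (simp add: supp_on_def keys_scale_exp g_pos weighted_degree_scale_exp d_dvd_iff)
  qed
  then show "p \<in> veronese_polys n a d"
    by (simp add: veronese_polys_def supp_on_def)
qed

lemma power_subst_pham_brieskorn_poly:
  "power_subst g (pham_brieskorn_poly n b) = (pham_brieskorn_poly n a :: 'k::field_char_0 mpoly)"
  unfolding pham_brieskorn_poly_eq ring_map_simps[OF ring_map_power_subst]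
  by (intro sum.cong refl) (use b_mult_g in \<open>simp add: power_subst_def ring_map_Const mult.commute flip: power_mult\<close>)

text \<open>All exponents in both substituted polynomials are multiples of the \<open>g i\<close>.
  So the cofactor may be replaced by its part with such exponents, which is itself a substituted
  polynomial.\<close>

lemma power_subst_dvd_iff:
  fixes p :: "'k::field_char_0 mpoly"
  shows "pham_brieskorn_poly n a dvd power_subst g p \<longleftrightarrow> pham_brieskorn_poly n b dvd p"
proof
  assume "pham_brieskorn_poly n b dvd p"
  then show "pham_brieskorn_poly n a dvd power_subst g p"
    by (auto simp: power_subst_pham_brieskorn_poly ring_map_mult[OF ring_map_power_subst])
next
  let ?Q = "\<lambda>m. \<forall>i. g i dvd Poly_Mapping.lookup m i"
  have Q: "?Q m" if "m \<in> Poly_Mapping.keys (power_subst g r)" for m and r :: "'k mpoly"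
    using that keys_power_subst[of g r] by (auto simp: lookup_scale_exp)
  assume "pham_brieskorn_poly n a dvd power_subst g p"
  then obtain q where q: "power_subst g p = power_subst g (pham_brieskorn_poly n b) * q"
    by (auto simp: power_subst_pham_brieskorn_poly)
  have "power_subst g p = part ?Q (power_subst g (pham_brieskorn_poly n b) * q)"
    unfolding q[symmetric] using Q by (intro part_id[symmetric]) (simp add: supp_on_def)
  also have "\<dots> = power_subst g (pham_brieskorn_poly n b) * part ?Q q"
    using Q by (intro part_mult) (simp add: lookup_add dvd_add_right_iff)
  finally have eq: "power_subst g p = power_subst g (pham_brieskorn_poly n b) * part ?Q q" .
  have "g i dvd Poly_Mapping.lookup m i" if "m \<in> Poly_Mapping.keys (part ?Q q)" for m i
    using that by (simp add: keys_part)
  from power_subst_surj[OF g_pos this] obtain r where r: "part ?Q q = power_subst g r"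
    by blast
  have "power_subst g p = power_subst g (pham_brieskorn_poly n b * r)"
    by (simp add: eq r ring_map_mult[OF ring_map_power_subst])
  then have "p = pham_brieskorn_poly n b * r"
    by (rule power_subst_inj[OF g_pos])
  then show "pham_brieskorn_poly n b dvd p"
    by simp
qed

end

section \<open>Explicit locally nilpotent derivations\<close>

lemma vars_in_induct [consumes 1, case_names Const Var add mult]:
  assumes "p \<in> vars_in V" "\<And>c. P (Const c)" "\<And>i. i \<in> V \<Longrightarrow> P (Var i)"
    and add: "\<And>p q. P p \<Longrightarrow> P q \<Longrightarrow> P (p + q)" and mult: "\<And>p q. P p \<Longrightarrow> P q \<Longrightarrow> P (p * q)"
  shows "P p"
proof -
  have one: "P 1"
    using assms(2)[of 1] by (simp add: Const_def)
  have zero: "P 0"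
    using assms(2)[of 0] by (simp add: Const_def)
  have power: "P (q ^ k)" if "P q" for q k
    by (induction k) (simp_all add: one mult that)
  have prod: "P (prod f A)" if "\<And>i. i \<in> A \<Longrightarrow> P (f i)" for f :: "nat \<Rightarrow> _" and A
    using that by (induction A rule: infinite_finite_induct) (simp_all add: one mult)
  have sum: "P (sum f A)" if "\<And>i. i \<in> A \<Longrightarrow> P (f i)" for f :: "(nat \<Rightarrow>\<^sub>0 nat) \<Rightarrow> _" and A
    using that by (induction A rule: infinite_finite_induct) (simp_all add: zero add)
  have "P (\<Sum>m\<in>Poly_Mapping.keys p. Poly_Mapping.single m (Poly_Mapping.lookup p m))"
  proof (rule sum)
    fix m assume "m \<in> Poly_Mapping.keys p"
    then have "Poly_Mapping.keys m \<subseteq> V"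
      using assms(1) by (simp add: supp_on_def)
    then show "P (Poly_Mapping.single m (Poly_Mapping.lookup p m))"
      unfolding single_eq_mono mono_val_def by (intro mult assms(2) prod power assms(3)) auto
  qed
  then show ?thesis
    by (simp only: sum_single_keys)
qed

text \<open>The linear term in \<open>t\<close> of the substitution \<open>X\<^sub>i \<mapsto> X\<^sub>i + t q\<^sub>i\<close>.\<close>

definition deriv_of :: "(nat \<Rightarrow> 'k::field mpoly) \<Rightarrow> 'k mpoly \<Rightarrow> 'k mpoly" where
  "deriv_of q p = coeff (insertion (\<lambda>c. [:Const c:]) (\<lambda>i. [:Var i, q i:]) p) 1"

lemma deriv_of_add: "deriv_of q (p + r) = deriv_of q p + deriv_of q r"
  by (simp add: deriv_of_def insertion_add ring_map_pCons_Const)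

lemma deriv_of_mult: "deriv_of q (p * r) = deriv_of q p * r + p * deriv_of q r"
proof -
  let ?f = "insertion (\<lambda>c. [:Const c:]) (\<lambda>i. [:Var i, q i:])"
  have "poly (?f p) 0 = p" for p
    by (rule ring_map_eqI[OF ring_map_comp[OF ring_map_poly_at ring_map_insertion[OF ring_map_pCons_Const]], of "\<lambda>p. p"])
      (simp_all add: ring_map_def[of "\<lambda>p. p"] ring_map_pCons_Const)
  then have "coeff (?f p) 0 = p" for p
    by (simp add: poly_0_coeff_0)
  then show ?thesis
    by (simp add: deriv_of_def insertion_mult ring_map_pCons_Const coeff_mult algebra_simps)
qed

lemma deriv_of_Const: "deriv_of q (Const c) = 0"
  by (simp add: deriv_of_def ring_map_pCons_Const)

lemma deriv_of_Var: "deriv_of q (Var i) = q i"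
  by (simp add: deriv_of_def ring_map_pCons_Const)

lemma deriv_of_zero: "deriv_of q 0 = 0"
  using deriv_of_add[of q 0 0] by (simp only: add_0_left add_cancel_right_right)

lemma deriv_of_one: "deriv_of q 1 = 0"
  using deriv_of_mult[of q 1 1] by (simp only: mult_1_left mult_1_right add_cancel_right_right)

lemma deriv_of_sum: "deriv_of q (sum f A) = (\<Sum>i\<in>A. deriv_of q (f i))"
  by (induction A rule: infinite_finite_induct) (simp_all add: deriv_of_zero deriv_of_add)

lemma deriv_of_power: "deriv_of q (p ^ k) = of_nat k * p ^ (k - 1) * deriv_of q p"
proof (induction k)
  case (Suc k)
  then show ?case
    by (cases k) (simp_all add: deriv_of_mult deriv_of_one algebra_simps)
qed (simp add: deriv_of_one)

lemma deriv_of_pham_brieskorn_poly: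
  "deriv_of q (pham_brieskorn_poly n b) = (\<Sum>i=1..n. of_nat (b i) * Var i ^ (b i - 1) * q i)"
  by (simp add: pham_brieskorn_poly_eq deriv_of_sum deriv_of_power deriv_of_Var)

lemma deriv_of_in_vars_in:
  assumes "p \<in> vars_in V" "\<And>i. i \<in> V \<Longrightarrow> q i \<in> vars_in V"
  shows "deriv_of q p \<in> vars_in V"
proof -
  have "p \<in> vars_in V \<and> deriv_of q p \<in> vars_in V"
    using assms(1)
  proof (induction p rule: vars_in_induct)
    case (Const c)
    show ?case
      by (simp add: deriv_of_Const vars_in_Const supp_on_zero)
  next
    case (Var i)
    then show ?case
      by (simp add: deriv_of_Var vars_in_Var assms(2))
  next
    case (add p r)
    then show ?case
      by (simp add: deriv_of_add supp_on_add)
  next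
    case (mult p r)
    then show ?case
      by (simp add: deriv_of_mult supp_on_add vars_in_mult)
  qed
  then show ?thesis ..
qed

definition dnil :: "(nat \<Rightarrow> 'k::field mpoly) \<Rightarrow> 'k mpoly \<Rightarrow> bool" where
  "dnil q p \<longleftrightarrow> (\<exists>N. (deriv_of q ^^ N) p = 0)"

lemma deriv_of_iter_zero: "(deriv_of q ^^ N) 0 = 0"
  by (induction N) (simp_all add: deriv_of_zero)

lemma deriv_of_iter_mono:
  fixes q :: "nat \<Rightarrow> 'k::field mpoly"
  assumes "(deriv_of q ^^ N) p = 0" "N \<le> M"
  shows "(deriv_of q ^^ M) p = 0"
proof -
  have "(deriv_of q ^^ M) p = (deriv_of q ^^ (M - N)) ((deriv_of q ^^ N) p)"
    using assms(2) by (simp flip: funpow_add comp_apply[of "deriv_of q ^^ (M - N)"])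
  then show ?thesis
    using assms(1) by (simp add: deriv_of_iter_zero)
qed

lemma deriv_of_iter_add: "(deriv_of q ^^ N) (p + r) = (deriv_of q ^^ N) p + (deriv_of q ^^ N) r"
  by (induction N) (simp_all add: deriv_of_add)

lemma dnil_add: "dnil q p \<Longrightarrow> dnil q r \<Longrightarrow> dnil q (p + r)"
  unfolding dnil_def
proof (elim exE)
  fix N M assume "(deriv_of q ^^ N) p = 0" "(deriv_of q ^^ M) r = 0"
  then have "(deriv_of q ^^ max N M) (p + r) = 0"
    by (simp add: deriv_of_iter_add deriv_of_iter_mono[where N = N and M = "max N M"] deriv_of_iter_mono[where N = M and M = "max N M"])
  then show "\<exists>N. (deriv_of q ^^ N) (p + r) = 0" ..
qed

lemma dnil_deriv_of: "dnil q (deriv_of q p) \<Longrightarrow> dnil q p"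
  unfolding dnil_def by (metis comp_apply funpow_Suc_right)

text \<open>By induction on \<open>N + M\<close>: the derivative of the product is a sum of two
  products with smaller total order.\<close>

lemma dnil_mult:
  assumes "dnil q p" "dnil q r"
  shows "dnil q (p * r)"
proof -
  have "dnil q (p * r)" if "(deriv_of q ^^ N) p = 0" "(deriv_of q ^^ M) r = 0" for N M
    using that
  proof (induction "N + M" arbitrary: N M p r)
    case 0
    then show ?case
      by (auto simp: dnil_def intro: exI[of _ 0])
  next
    case (Suc k)
    have zero: "dnil q 0"
      unfolding dnil_def using deriv_of_iter_zero by blast
    show ?case
    proof (cases "N = 0 \<or> M = 0")
      case True
      then have "p = 0 \<or> r = 0"
        using Suc.prems by auto
      then show ?thesis
        using zero by auto
    next
      case False
      then obtain N' M' where NM: "N = Suc N'" "M = Suc M'"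
        by (metis not0_implies_Suc)
      have "(deriv_of q ^^ N') (deriv_of q p) = 0" "(deriv_of q ^^ M') (deriv_of q r) = 0"
        using Suc.prems by (simp_all add: NM funpow_swap1)
      then have "dnil q (deriv_of q p * r)" "dnil q (p * deriv_of q r)"
        using Suc.hyps Suc.prems NM by (metis add_Suc nat.inject, metis add_Suc_right nat.inject)
      then have "dnil q (deriv_of q (p * r))"
        by (simp add: deriv_of_mult dnil_add)
      then show ?thesis
        by (rule dnil_deriv_of)
    qed
  qed
  then show ?thesis
    using assms by (auto simp: dnil_def)
qed

lemma dnil_Const: "dnil q (Const c)"
  unfolding dnil_def by (rule exI[of _ 1]) (simp add: deriv_of_Const)

lemma dnil_one: "dnil q 1"
  using dnil_Const[of q 1] by (simp add: Const_def)

lemma dnil_power: "dnil q p \<Longrightarrow> dnil q (p ^ k)"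
  by (induction k) (simp_all add: dnil_one dnil_mult)

text \<open>A derivation that kills the generator maps the ideal into itself and descends to the
  quotient. Nilpotence on the variables suffices, since the elements killed by some iterate are
  closed under sums and products.\<close>

lemma not_rigid_if_derivation:
  fixes \<theta> :: "'k::field_char_0 mpoly \<Rightarrow> 'b::comm_ring_1" and q :: "nat \<Rightarrow> 'k mpoly"
  assumes \<theta>: "ring_map \<theta>" and ker: "\<And>p. \<theta> p = 0 \<longleftrightarrow> pham_brieskorn_poly n b dvd p"
    and q: "\<And>i. i \<in> {1..n} \<Longrightarrow> q i \<in> vars_in {1..n}"
    and F: "deriv_of q (pham_brieskorn_poly n b) = 0"
    and nil: "\<And>i. i \<in> {1..n} \<Longrightarrow> dnil q (Var i)"
    and k: "k \<in> {1..n}" "\<not> pham_brieskorn_poly n b dvd q k"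
  shows "\<not> rigid_on (\<theta> ` vars_in {1..n})"
proof
  assume rigid: "rigid_on (\<theta> ` vars_in {1..n})"
  let ?P = "vars_in {1..n} :: 'k mpoly set"
  define \<delta> where "\<delta> t = \<theta> (deriv_of q (SOME p. p \<in> ?P \<and> t = \<theta> p))" for t
  have wd: "\<theta> (deriv_of q p) = \<theta> (deriv_of q r)" if "\<theta> p = \<theta> r" for p r
  proof -
    have "\<theta> (p - r) = 0"
      using that by (simp add: ring_map_diff[OF \<theta>])
    then obtain s where "p - r = pham_brieskorn_poly n b * s"
      unfolding ker by blast
    then have "p = r + pham_brieskorn_poly n b * s"
      by (simp add: algebra_simps)
    then have "deriv_of q p = deriv_of q r + pham_brieskorn_poly n b * deriv_of q s"
      by (simp add: deriv_of_add deriv_of_mult F)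
    moreover have "\<theta> (pham_brieskorn_poly n b) = 0"
      by (simp add: ker)
    ultimately show ?thesis
      by (simp add: ring_map_simps[OF \<theta>])
  qed
  have \<delta>: "\<delta> (\<theta> p) = \<theta> (deriv_of q p)" if "p \<in> ?P" for p
  proof -
    let ?r = "SOME r. r \<in> ?P \<and> \<theta> p = \<theta> r"
    have "?r \<in> ?P \<and> \<theta> p = \<theta> ?r"
      by (rule someI[of _ p]) (use that in simp)
    then have "\<theta> (deriv_of q ?r) = \<theta> (deriv_of q p)"
      using wd by metis
    then show ?thesis
      by (simp add: \<delta>_def)
  qed
  have D: "deriv_of q p \<in> ?P" if "p \<in> ?P" for p
    using that q by (rule deriv_of_in_vars_in)
  have iter: "(deriv_of q ^^ N) p \<in> ?P \<and> (\<delta> ^^ N) (\<theta> p) = \<theta> ((deriv_of q ^^ N) p)" if "p \<in> ?P" for p N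
    by (induction N) (simp_all add: that D \<delta> del: One_nat_def)
  have "lnd_on (\<theta> ` ?P) \<delta>"
    unfolding lnd_on_def
  proof (intro conjI ballI)
    show "\<delta> \<in> \<theta> ` ?P \<rightarrow> \<theta> ` ?P"
      using D by (auto simp: \<delta>)
    fix x assume "x \<in> \<theta> ` ?P"
    then obtain p where p: "p \<in> ?P" "x = \<theta> p"
      by blast
    have "dnil q p"
      using p(1) by (induction p rule: vars_in_induct) (simp_all add: nil dnil_Const dnil_add dnil_mult)
    then obtain N where "(deriv_of q ^^ N) p = 0"
      by (auto simp: dnil_def)
    then have "(deriv_of q ^^ Suc N) p = 0"
      by (simp add: deriv_of_zero)
    then have "(\<delta> ^^ Suc N) x = 0"
      using iter[OF p(1), of "Suc N"] p(2) by (simp only: ring_map_zero[OF \<theta>])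
    then show "\<exists>N>0. (\<delta> ^^ N) x = 0"
      by blast
    fix y assume "y \<in> \<theta> ` ?P"
    then obtain r where r: "r \<in> ?P" "y = \<theta> r"
      by blast
    have "\<delta> (\<theta> (p + r)) = \<delta> (\<theta> p) + \<delta> (\<theta> r)"
      using p(1) r(1) by (simp add: \<delta> supp_on_add deriv_of_add ring_map_add[OF \<theta>, of "deriv_of q p"])
    then show "\<delta> (x + y) = \<delta> x + \<delta> y"
      by (simp add: p r ring_map_add[OF \<theta>])
    have "\<delta> (\<theta> (p * r)) = \<delta> (\<theta> p) * \<theta> r + \<theta> p * \<delta> (\<theta> r)"
      using p(1) r(1) by (simp add: \<delta> vars_in_mult deriv_of_mult ring_map_add[OF \<theta>] ring_map_mult[OF \<theta>, of "deriv_of q p"]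
          ring_map_mult[OF \<theta>, of p "deriv_of q r"])
    then show "\<delta> (x * y) = \<delta> x * y + x * \<delta> y"
      by (simp add: p r ring_map_mult[OF \<theta>])
  qed
  moreover have "\<theta> (Var k) \<in> \<theta> ` ?P"
    using k(1) by (intro imageI vars_in_Var)
  ultimately have "\<delta> (\<theta> (Var k)) = 0"
    using rigid unfolding rigid_on_def by blast
  then have "\<theta> (q k) = 0"
    using k(1) by (simp add: \<delta> vars_in_Var deriv_of_Var)
  then show False
    using k(2) ker by simp
qed

lemma of_nat_mpoly: "of_nat k = (Const (of_nat k) :: 'k::field mpoly)"
  by (induction k) (simp_all add: ring_map_simps[OF ring_map_Const])

text \<open>The equation can be solved for X_i, so the quotient is a polynomial ring in the
  remaining variables. The derivation is that with respect to X_j; the value \<open>u\<close> at X_i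
  keeps the equation intact.\<close>

lemma not_rigid_linear:
  fixes \<theta> :: "'k::field_char_0 mpoly \<Rightarrow> 'b::comm_ring_1"
  assumes \<theta>: "ring_map \<theta>" and ker: "\<And>p. \<theta> p = 0 \<longleftrightarrow> pham_brieskorn_poly n b dvd p"
    and ij: "i \<in> {1..n}" "j \<in> {1..n}" "i \<noteq> j" "b i = 1"
  shows "\<not> rigid_on (\<theta> ` vars_in {1..n})"
proof -
  define u where "u = - (of_nat (b j) * Var j ^ (b j - 1) :: 'k mpoly)"
  have u: "u = Const (- of_nat (b j)) * Var j ^ (b j - 1)"
    by (simp add: u_def of_nat_mpoly ring_map_simps[OF ring_map_Const])
  define q where "q = (\<lambda>l. if l = j then 1 else if l = i then u else 0)"
  have nj: "dnil q (Var j)"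
    by (rule dnil_deriv_of) (simp add: deriv_of_Var q_def dnil_one)
  have ni: "dnil q (Var i)"
    by (rule dnil_deriv_of) (use ij nj in \<open>simp add: deriv_of_Var q_def[THEN fun_cong, of i] u dnil_mult dnil_Const dnil_power\<close>)
  show ?thesis
  proof (rule not_rigid_if_derivation[OF \<theta> ker])
    show "q l \<in> vars_in {1..n}" for l
      using ij by (simp add: q_def u vars_in_one supp_on_zero vars_in_mult vars_in_Const vars_in_power vars_in_Var)
    show "dnil q (Var l)" for l
    proof (cases "l = i \<or> l = j")
      case False
      then have "deriv_of q (Var l) = 0"
        by (simp add: deriv_of_Var q_def)
      then show ?thesis
        unfolding dnil_def by (intro exI[of _ 1]) simp
    qed (use ni nj in auto)
    have "deriv_of q (pham_brieskorn_poly n b) = (\<Sum>l\<in>{i, j}. of_nat (b l) * Var l ^ (b l - 1) * q l)"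
      unfolding deriv_of_pham_brieskorn_poly using ij
      by (intro sum.mono_neutral_right) (auto simp: q_def)
    also have "\<dots> = 0"
      using ij by (simp add: q_def u_def)
    finally show "deriv_of q (pham_brieskorn_poly n b) = 0" .
    show "\<not> pham_brieskorn_poly n b dvd q j"
      using ker[of 1] ring_map_one[OF \<theta>] by (simp add: q_def)
  qed (fact ij(2))
qed

text \<open>
  With \<open>U = X\<^sub>i + \<i> X\<^sub>j\<close> and \<open>V = X\<^sub>i - \<i> X\<^sub>j\<close> the equation becomes \<open>U V + X\<^sub>k ^ c + \<dots> = 0\<close>,
  and the derivation is \<open>U \<mapsto> 0\<close>, \<open>V \<mapsto> - c X\<^sub>k ^ (c - 1)\<close>, \<open>X\<^sub>k \<mapsto> U\<close>.
\<close>

lemma not_rigid_two_squares: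
  fixes \<theta> :: "complex mpoly \<Rightarrow> 'b::comm_ring_1"
  assumes \<theta>: "ring_map \<theta>" and ker: "\<And>p. \<theta> p = 0 \<longleftrightarrow> pham_brieskorn_poly n b dvd p"
    and ijk: "i \<in> {1..n}" "j \<in> {1..n}" "k \<in> {1..n}" "i \<noteq> j" "i \<noteq> k" "j \<noteq> k" "b i = 2" "b j = 2"
    and b: "\<And>l. l \<in> {1..n} \<Longrightarrow> b l > 0"
  shows "\<not> rigid_on (\<theta> ` vars_in {1..n})"
proof -
  let ?c = "b k"
  define y where "y = (Var k ^ (?c - 1) :: complex mpoly)"
  define U where "U = Var i + Const \<i> * Var j"
  \<comment> \<open>The values at X_i and X_j follow from X_i = (U + V) / 2 and X_j = (U - V) / (2
    \<i>).\<close>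
  define q where "q = (\<lambda>l. if l = i then Const (- of_nat ?c / 2) * y else
    if l = j then Const (- \<i> * of_nat ?c / 2) * y else if l = k then U else 0)"
  have q: "q i = Const (- of_nat ?c / 2) * y" "q j = Const (- \<i> * of_nat ?c / 2) * y" "q k = U"
    using ijk by (simp_all add: q_def)
  have qj: "Const \<i> * q j = - q i"
  proof -
    have "Const \<i> * q j = Const (\<i> * (- \<i> * of_nat ?c / 2)) * y"
      unfolding q by (simp only: ring_map_mult[OF ring_map_Const] mult.assoc)
    also have "\<dots> = Const (- (- of_nat ?c / 2)) * y"
      by simp
    also have "\<dots> = - q i"
      unfolding q by (simp only: ring_map_uminus[OF ring_map_Const] mult_minus_left)
    finally show ?thesis .
  qed
  have "deriv_of q U = q i + Const \<i> * q j"
    by (simp add: U_def deriv_of_add deriv_of_mult deriv_of_Const deriv_of_Var)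
  then have "deriv_of q U = 0"
    by (simp add: qj)
  then have nU: "dnil q U"
    unfolding dnil_def by (intro exI[of _ 1]) simp
  have nk: "dnil q (Var k)"
    by (rule dnil_deriv_of) (simp add: deriv_of_Var q nU)
  have nij: "dnil q (Var i)" "dnil q (Var j)"
    by (rule dnil_deriv_of, simp add: deriv_of_Var q y_def dnil_mult dnil_Const dnil_power nk)+
  show ?thesis
  proof (rule not_rigid_if_derivation[OF \<theta> ker])
    show "q l \<in> vars_in {1..n}" for l
      using ijk by (simp add: q_def U_def y_def supp_on_zero supp_on_add vars_in_mult vars_in_Const vars_in_power vars_in_Var)
    show "dnil q (Var l)" for l
    proof (cases "l = i \<or> l = j \<or> l = k")
      case False
      then have "deriv_of q (Var l) = 0"
        by (simp add: deriv_of_Var q_def)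
      then show ?thesis
        unfolding dnil_def by (intro exI[of _ 1]) simp
    qed (use nij nk in auto)
    have "deriv_of q (pham_brieskorn_poly n b) = (\<Sum>l\<in>{i, j, k}. of_nat (b l) * Var l ^ (b l - 1) * q l)"
      unfolding deriv_of_pham_brieskorn_poly using ijk
      by (intro sum.mono_neutral_right) (auto simp: q_def)
    also have "\<dots> = 2 * Var i * q i + 2 * Var j * q j + of_nat ?c * y * U"
      using ijk by (simp add: q(3) y_def)
    also have "\<dots> = 0"
    proof -
      have "2 * q i = - (of_nat ?c * y)" "2 * q j = - (Const \<i> * (of_nat ?c * y))"
      proof -
        have two: "2 * (Const z * y) = Const (2 * z) * y" for z
          using of_nat_mpoly[of 2, where 'k=complex] by (simp add: ring_map_mult[OF ring_map_Const] mult.assoc)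
        show "2 * q i = - (of_nat ?c * y)" "2 * q j = - (Const \<i> * (of_nat ?c * y))"
          unfolding q two of_nat_mpoly
          by (simp_all add: ring_map_simps[OF ring_map_Const])
      qed
      then have "2 * Var i * q i = - (of_nat ?c * y) * Var i" "2 * Var j * q j = - (Const \<i> * (of_nat ?c * y)) * Var j"
        by (metis mult.assoc mult.commute)+
      then show ?thesis
        by (simp add: U_def algebra_simps)
    qed
    finally show "deriv_of q (pham_brieskorn_poly n b) = 0" .
    show "\<not> pham_brieskorn_poly n b dvd q k"
    proof
      assume "pham_brieskorn_poly n b dvd q k"
      then obtain r where r: "U = pham_brieskorn_poly n b * r"
        unfolding q by blast
      \<comment> \<open>Evaluation at a point where the defining polynomial vanishes and
        \<open>U\<close> does not.\<close>
      let ?f = "insertion (\<lambda>c. c) (\<lambda>l. if l = i then 1 else if l = j then - \<i> else 0)"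
      have id: "ring_map (\<lambda>c :: complex. c)"
        by (simp add: ring_map_def)
      have f: "ring_map ?f"
        by (rule ring_map_insertion[OF id])
      have "?f (pham_brieskorn_poly n b) = (\<Sum>l=1..n. (if l = i then 1 else if l = j then - \<i> else 0) ^ b l)"
        unfolding pham_brieskorn_poly_eq ring_map_simps[OF f] by (simp add: id)
      also have "\<dots> = (\<Sum>l\<in>{i, j}. (if l = i then 1 else if l = j then - \<i> else 0) ^ b l)"
        using ijk b by (intro sum.mono_neutral_right) (auto simp: power_0_left)
      also have "\<dots> = 0"
        using ijk by simp
      finally have "?f U = 0"
        by (simp add: r ring_map_mult[OF f])
      moreover have "?f U = 2"
        using ijk by (simp add: U_def ring_map_simps[OF f] id)
      ultimately show False
        by simp
    qed
  qed (fact ijk(3))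
qed

section \<open>Two distinct variables form a regular sequence\<close>

lemma Var_dvd_diff_kill: "Var i dvd p - kill {i} (p :: 'k::field mpoly)"
proof -
  have "poly (univ_var i p) 0 = kill {i} p"
    by (rule ring_map_eqI[OF ring_map_comp[OF ring_map_poly_at ring_map_univ_var] ring_map_kill]) simp_all
  moreover have "Var i - 0 dvd poly (univ_var i p) (Var i) - poly (univ_var i p) 0"
  proof -
    obtain c f where cf: "univ_var i p = pCons c f"
      by (rule pCons_cases)
    show ?thesis
      unfolding cf by simp
  qed
  ultimately show ?thesis
    by (simp add: poly_univ_var)
qed

lemma kill_pham_brieskorn_poly:
  assumes "\<And>i. i \<in> {1..n} \<Longrightarrow> b i > 0"
  shows "kill A (pham_brieskorn_poly n b :: 'k::field_char_0 mpoly) = (\<Sum>i\<in>{1..n} - A. Var i ^ b i)"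
proof -
  have "kill A (pham_brieskorn_poly n b :: 'k mpoly) = (\<Sum>i=1..n. if i \<in> A then 0 else Var i ^ b i)"
    unfolding pham_brieskorn_poly_eq ring_map_simps[OF ring_map_kill]
    by (intro sum.cong refl) (use assms in \<open>force simp: power_0_left\<close>)
  also have "\<dots> = (\<Sum>i\<in>{1..n} - A. Var i ^ b i)"
    by (intro sum.mono_neutral_cong_right) auto
  finally show ?thesis .
qed

text \<open>Modulo X_i the relation says that X_j times \<open>p\<close> is a multiple of the
  reduced defining polynomial. As a third variable exists, the latter is not divisible by X_j, so
  X_j divides the cofactor and can be cancelled.\<close>

lemma regular_variables:
  fixes p q :: "'k::field_char_0 mpoly"
  assumes n: "n \<ge> 3" and b: "\<And>i. i \<in> {1..n} \<Longrightarrow> b i > 0"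
    and ij: "i \<in> {1..n}" "j \<in> {1..n}" "i \<noteq> j"
    and dvd: "pham_brieskorn_poly n b dvd Var j * p - Var i * q"
  shows "\<exists>r. pham_brieskorn_poly n b dvd p - Var i * r"
proof -
  let ?F = "pham_brieskorn_poly n b :: 'k mpoly"
  have kF: "kill A ?F = (\<Sum>i\<in>{1..n} - A. Var i ^ b i)" for A
    using b by (rule kill_pham_brieskorn_poly)
  obtain s where s: "Var j * p - Var i * q = ?F * s"
    using dvd by blast
  from arg_cong[OF s, of "kill {i}"]
  have eq: "Var j * kill {i} p = kill {i} ?F * kill {i} s"
    using ij by (simp add: ring_map_simps[OF ring_map_kill])
  have "kill {j} (kill {i} ?F) = (\<Sum>l\<in>{1..n} - {i, j}. Var l ^ b l)"
  proof -
    have "kill {j} (kill {i} ?F) = (\<Sum>l\<in>{1..n} - {i}. if l = j then 0 else Var l ^ b l)"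
      unfolding kF ring_map_simps[OF ring_map_kill]
    proof (intro sum.cong refl)
      fix l assume "l \<in> {1..n} - {i}"
      then show "kill {j} (Var l) ^ b l = (if l = j then 0 else Var l ^ b l)"
        using b[of l] by (auto simp: power_0_left)
    qed
    also have "\<dots> = (\<Sum>l\<in>{1..n} - {i, j}. Var l ^ b l)"
      by (intro sum.mono_neutral_cong_right) auto
    finally show ?thesis .
  qed
  also have "\<dots> \<noteq> 0"
  proof (rule power_sum_nonzero)
    have "card {i, j} < card {1..n}"
      using n ij by simp
    then show "{1..n} - {i, j} \<noteq> {}"
      by (metis Diff_eq_empty_iff card_mono finite.emptyI finite.insertI leD)
  qed (use b in auto)
  finally have "kill {j} (kill {i} ?F) \<noteq> 0" .
  moreover have "kill {j} (kill {i} ?F) * kill {j} (kill {i} s) = 0"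
    using arg_cong[OF eq, of "kill {j}"] by (simp add: ring_map_simps[OF ring_map_kill])
  ultimately have "kill {j} (kill {i} s) = 0"
    by simp
  then obtain t where t: "kill {i} s = Var j * t"
    using Var_dvd_diff_kill[of j "kill {i} s"] by auto
  have "Var j \<noteq> (0 :: 'k mpoly)"
    by (metis Var_def lookup_single_eq lookup_zero zero_neq_one)
  moreover have "Var j * kill {i} p = Var j * (kill {i} ?F * t)"
    by (simp add: eq t ac_simps)
  ultimately have p: "kill {i} p = kill {i} ?F * t"
    by simp
  obtain u v where uv: "p - kill {i} p = Var i * u" "?F - kill {i} ?F = Var i * v"
    using Var_dvd_diff_kill[of i p] Var_dvd_diff_kill[of i ?F] by (auto elim!: dvdE)
  \<comment> \<open>Lifts the relation modulo X_i: \<open>u\<close> and \<open>v\<close> are the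
    quotients by X_i of what the reduction removed from \<open>p\<close> and from the defining
    polynomial.\<close>
  have "p - Var i * (u - v * t) = (p - Var i * u) + (Var i * v) * t"
    by (simp add: algebra_simps)
  also have "\<dots> = kill {i} p + (?F - kill {i} ?F) * t"
    by (simp flip: uv)
  also have "\<dots> = ?F * t"
    by (simp add: p algebra_simps)
  finally have "p - Var i * (u - v * t) = ?F * t" .
  then show ?thesis
    by (metis dvd_triv_left)
qed

text \<open>If the defining polynomial divided X_i, then reduction modulo X_i would force X_i to
  divide the cofactor. The defining polynomial would then be a unit.\<close>

lemma Var_not_dvd:
  fixes \<theta> :: "'k::field_char_0 mpoly \<Rightarrow> 'b::comm_ring_1"
  assumes \<theta>: "ring_map \<theta>" and ker: "\<And>p. \<theta> p = 0 \<longleftrightarrow> pham_brieskorn_poly n b dvd p"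
    and n: "n \<ge> 3" and b: "\<And>i. i \<in> {1..n} \<Longrightarrow> b i > 0" and i: "i \<in> {1..n}"
  shows "\<theta> (Var i) \<noteq> 0"
proof
  let ?F = "pham_brieskorn_poly n b :: 'k mpoly"
  have kF: "kill A ?F = (\<Sum>i\<in>{1..n} - A. Var i ^ b i)" for A
    using b by (rule kill_pham_brieskorn_poly)
  assume "\<theta> (Var i) = 0"
  then obtain h where h: "Var i = ?F * h"
    unfolding ker by blast
  from arg_cong[OF h, of "kill {i}"] have "kill {i} ?F * kill {i} h = 0"
    by (simp add: ring_map_simps[OF ring_map_kill])
  moreover have "kill {i} ?F \<noteq> 0"
    unfolding kF
  proof (rule power_sum_nonzero)
    have "card {i} < card {1..n}"
      using n by simp
    then show "{1..n} - {i} \<noteq> {}"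
      by (metis Diff_eq_empty_iff card_mono finite.emptyI finite.insertI leD)
  qed (use b in auto)
  ultimately have "kill {i} h = 0"
    by simp
  then obtain h' where h': "h = Var i * h'"
    using Var_dvd_diff_kill[of i h] by auto
  have "Var i \<noteq> (0 :: 'k mpoly)"
    by (metis Var_def lookup_single_eq lookup_zero zero_neq_one)
  moreover have "Var i * 1 = Var i * (?F * h')"
    using h unfolding h' by (simp add: ac_simps)
  ultimately have "1 = ?F * h'"
    by (metis mult_left_cancel)
  then have "\<theta> 1 = 0"
    unfolding ker by (metis dvd_triv_left)
  then show False
    by (simp add: ring_map_one[OF \<theta>])
qed

section \<open>Rigidity of Veronese subrings\<close>

context veronese_exponents
begin

lemma ex_other_index: "\<exists>j\<in>{1..n}. j \<noteq> i"
proof (cases "i = 1")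
  case True
  then show ?thesis
    using n3 by (intro bexI[of _ 2]) auto
next
  case False
  then show ?thesis
    using n3 by (intro bexI[of _ 1]) auto
qed

lemma wdeg_pham_brieskorn_poly:
  assumes "m \<in> Poly_Mapping.keys (pham_brieskorn_poly n b :: 'k::field_char_0 mpoly)"
  shows "wdeg m = L div G"
proof -
  have "m \<in> (\<lambda>i. Poly_Mapping.single i (b i)) ` {1..n}"
    using assms keys_power_sum[of "{1..n}" b, where 'k='k] b_pos
    unfolding pham_brieskorn_poly_eq by simp
  then obtain i where i: "i \<in> {1..n}" "m = Poly_Mapping.single i (b i)"
    by blast
  then show ?thesis
    using b_mult_w[OF i(1)] G_pos by (metis nonzero_mult_div_cancel_left not_less_zero wdeg_single)
qed

section \<open>The grading of B' modulo d / G\<close>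

definition residue_class :: "int \<Rightarrow> (nat \<Rightarrow>\<^sub>0 nat) \<Rightarrow> bool" where
  "residue_class k m \<longleftrightarrow> [int (wdeg m) = k] (mod int (d div G))"

definition graded_polys :: "int \<Rightarrow> 'k::field_char_0 mpoly set" where
  "graded_polys k = {p \<in> vars_in {1..n}. p \<in> supp_on (residue_class k)}"

lemma modulus_pos: "d div G > 0"
  using G_dvd d_pos G_pos by (simp add: div_greater_zero_iff dvd_imp_le)

lemma part_residue_mult:
  assumes "\<And>m. m \<in> Poly_Mapping.keys f \<Longrightarrow> int (wdeg m) = c"
  shows "part (residue_class k) (f * q) = f * part (residue_class (k - c)) q"
proof (rule part_mult)
  fix m m' assume "m \<in> Poly_Mapping.keys f"
  then have "int (wdeg (m + m')) = int (wdeg m') + c"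
    using assms by (simp add: wdeg_add)
  then show "residue_class k (m + m') \<longleftrightarrow> residue_class (k - c) m'"
    unfolding residue_class_def by (simp add: cong_iff_dvd_diff algebra_simps)
qed

lemma part_graded_polys:
  assumes "p \<in> graded_polys k"
  shows "part (residue_class l) p = (if [k = l] (mod int (d div G)) then p else 0)"
proof (rule poly_mapping_eqI)
  fix m
  have "Poly_Mapping.lookup p m = 0 \<or> residue_class k m"
    using assms by (auto simp: graded_polys_def supp_on_def in_keys_iff)
  then show "Poly_Mapping.lookup (part (residue_class l) p) m =
      Poly_Mapping.lookup (if [k = l] (mod int (d div G)) then p else 0) m"
    by (auto simp: lookup_part residue_class_def) (metis cong_sym cong_trans)+
qed

context
  fixes \<theta> :: "'k::field_char_0 mpoly \<Rightarrow> 'b::field_char_0"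
  assumes \<theta>: "ring_map \<theta>" and ker: "\<And>p. \<theta> p = 0 \<longleftrightarrow> pham_brieskorn_poly n b dvd p"
begin

lemma cyclic_grading_graded_polys: "cyclic_grading (\<lambda>k. \<theta> ` graded_polys k) (d div G)"
proof
  show "d div G > 0"
    by (rule modulus_pos)
  show "\<theta> ` graded_polys (k mod int (d div G)) = \<theta> ` graded_polys k" for k
  proof -
    have "residue_class (k mod int (d div G)) = residue_class k"
      by (simp add: residue_class_def cong_def fun_eq_iff)
    then show ?thesis
      by (simp only: graded_polys_def)
  qed
  show "0 \<in> \<theta> ` graded_polys k" for k
    by (rule image_eqI[of _ _ 0]) (simp_all add: graded_polys_def supp_on_zero ring_map_zero[OF \<theta>])
  have "1 \<in> (graded_polys 0 :: 'k mpoly set)"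
    using supp_on_single[of "residue_class 0" 0 "1::'k"]
    by (simp add: graded_polys_def vars_in_one residue_class_def wdeg_def)
  then show "1 \<in> \<theta> ` graded_polys 0"
    using ring_map_one[OF \<theta>] by (metis imageI)
next
  fix x y k l assume "x \<in> \<theta> ` graded_polys k" "y \<in> \<theta> ` graded_polys l"
  then obtain p q where pq: "x = \<theta> p" "p \<in> graded_polys k" "y = \<theta> q" "q \<in> graded_polys l"
    by blast
  have "p * q \<in> supp_on (residue_class (k + l))"
    using pq by (intro supp_on_mult[of p "residue_class k" q "residue_class l"])
      (auto simp: graded_polys_def residue_class_def wdeg_add intro: cong_add)
  then have "p * q \<in> graded_polys (k + l)"
    using pq by (simp add: graded_polys_def vars_in_mult)
  then show "x * y \<in> \<theta> ` graded_polys (k + l)"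
    unfolding pq using ring_map_mult[OF \<theta>] by (metis imageI)
next
  fix x y k assume "x \<in> \<theta> ` graded_polys k" "y \<in> \<theta> ` graded_polys k"
  then obtain p q where pq: "x = \<theta> p" "p \<in> graded_polys k" "y = \<theta> q" "q \<in> graded_polys k"
    by blast
  then have "p + q \<in> graded_polys k" "p - q \<in> graded_polys k"
    by (auto simp: graded_polys_def supp_on_add supp_on_diff)
  then show "x + y \<in> \<theta> ` graded_polys k" "x - y \<in> \<theta> ` graded_polys k"
    unfolding pq ring_map_add[OF \<theta>, symmetric] ring_map_diff[OF \<theta>, symmetric] by blast+
next
  fix x k assume "x \<in> \<theta> ` graded_polys k"
  then obtain p where p: "x = \<theta> p" "p \<in> graded_polys k"
    by blast
  let ?c = "Const (1 / of_nat (d div G)) :: 'k mpoly"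
  have c: "int (wdeg m) = 0" if "m \<in> Poly_Mapping.keys ?c" for m
    using that by (simp add: Const_def wdeg_def split: if_splits)
  have "part (residue_class k) (?c * p) = ?c * part (residue_class (k - 0)) p"
    by (rule part_residue_mult) (rule c)
  then have "part (residue_class k) (?c * p) = ?c * p"
    using p(2) part_id[of p "residue_class k"] by (simp add: graded_polys_def)
  then have "?c * p \<in> graded_polys k"
    using p(2) part_in_supp_on[of "residue_class k" "?c * p"]
    by (simp add: graded_polys_def vars_in_mult vars_in_Const)
  moreover have "\<theta> (?c * p) = x / of_nat (d div G)"
  proof -
    have "\<theta> ?c * of_nat (d div G) = \<theta> (?c * of_nat (d div G))"
      using ring_map_sum[OF \<theta>, of "\<lambda>_. 1" "{..<d div G}"] by (simp add: ring_map_simps[OF \<theta>])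
    also have "?c * of_nat (d div G) = 1"
      using modulus_pos by (simp add: of_nat_mpoly flip: ring_map_mult[OF ring_map_Const] ring_map_one[OF ring_map_Const])
    finally show ?thesis
      using modulus_pos by (simp add: p(1) ring_map_simps[OF \<theta>] field_simps)
  qed
  ultimately show "x / of_nat (d div G) \<in> \<theta> ` graded_polys k"
    by (metis imageI)
next
  fix s :: "int \<Rightarrow> 'b" and l
  assume sum: "(\<Sum>k\<in>{0..<int (d div G)}. s k) = 0" and s: "\<And>k. s k \<in> \<theta> ` graded_polys k"
    and l: "l \<in> {0..<int (d div G)}"
  have "\<forall>k. \<exists>p. s k = \<theta> p \<and> p \<in> graded_polys k"
    using s by blast
  then obtain p where p: "\<And>k. s k = \<theta> (p k)" "\<And>k. p k \<in> graded_polys k"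
    by metis
  have "\<theta> (\<Sum>k\<in>{0..<int (d div G)}. p k) = 0"
    using sum by (simp add: p ring_map_sum[OF \<theta>])
  then obtain q where q: "(\<Sum>k\<in>{0..<int (d div G)}. p k) = pham_brieskorn_poly n b * q"
    unfolding ker by blast
  \<comment> \<open>Directness holds since the defining polynomial is homogeneous: each component of
    a multiple of it is again a multiple.\<close>
  have "part (residue_class l) (\<Sum>k\<in>{0..<int (d div G)}. p k) =
      (\<Sum>k\<in>{0..<int (d div G)}. if k = l then p l else 0)"
    unfolding part_sum
  proof (intro sum.cong refl)
    fix k assume "k \<in> {0..<int (d div G)}"
    then have "[k = l] (mod int (d div G)) \<longleftrightarrow> k = l"
      using l by (simp add: cong_def)
    then show "part (residue_class l) (p k) = (if k = l then p l else 0)"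
      by (simp add: part_graded_polys[OF p(2)])
  qed
  also have "\<dots> = p l"
    using l by simp
  finally have "p l = part (residue_class l) (pham_brieskorn_poly n b * q)"
    by (simp add: q)
  also have "\<dots> = pham_brieskorn_poly n b * part (residue_class (l - int (L div G))) q"
    by (rule part_residue_mult) (simp add: wdeg_pham_brieskorn_poly)
  finally show "s l = 0"
    unfolding p ker by simp
qed

lemma total_graded_polys: "cyclic_grading.total (\<lambda>k. \<theta> ` graded_polys k) (d div G) = \<theta> ` vars_in {1..n}"
proof -
  interpret cyclic_grading "\<lambda>k. \<theta> ` graded_polys k" "d div G"
    by (rule cyclic_grading_graded_polys)
  let ?K = "{0..<int (d div G)}"
  show ?thesis
  proof (intro equalityI subsetI)
    fix x assume "x \<in> total"
    then obtain s where s: "x = (\<Sum>k\<in>?K. s k)" "\<forall>k. s k \<in> \<theta> ` graded_polys k"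
      by (auto simp: total_def)
    then have "\<forall>k. \<exists>p. s k = \<theta> p \<and> p \<in> graded_polys k"
      by blast
    then obtain p where p: "\<And>k. s k = \<theta> (p k)" "\<And>k. p k \<in> graded_polys k"
      by metis
    have "x = \<theta> (\<Sum>k\<in>?K. p k)"
      by (simp add: s(1) p(1) ring_map_sum[OF \<theta>])
    moreover have "(\<Sum>k\<in>?K. p k) \<in> vars_in {1..n}"
      using p(2) by (intro supp_on_sum) (auto simp: graded_polys_def)
    ultimately show "x \<in> \<theta> ` vars_in {1..n}"
      by blast
  next
    fix x assume "x \<in> \<theta> ` vars_in {1..n}"
    then obtain p where p: "x = \<theta> p" "p \<in> vars_in {1..n}"
      by blast
    let ?s = "\<lambda>k. part (\<lambda>m. int (wdeg m) mod int (d div G) = k) p"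
    have "(\<Sum>k\<in>?K. ?s k) = p"
      by (rule sum_part_residues) (use modulus_pos in auto)
    then have "x = (\<Sum>k\<in>?K. \<theta> (?s k))"
      by (simp add: p(1) flip: ring_map_sum[OF \<theta>])
    also have "\<dots> \<in> total"
    proof (intro total_sum)
      fix k assume "k \<in> ?K"
      then have "?s k \<in> graded_polys k"
        using p(2) unfolding graded_polys_def
        by (auto simp: supp_on_part) (auto simp: supp_on_def keys_part residue_class_def cong_def)
      then show "\<theta> (?s k) \<in> total"
        using S_subset_total by blast
    qed
    finally show "x \<in> total" .
  qed
qed

text \<open>\<open>regular_variables\<close> yields some quotient \<open>r\<close>. It becomes
  homogeneous in the right variables after setting foreign variables to zero and taking the
  component of degree \<open>k - w i\<close>.\<close>

lemma regular_graded_polys: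
  assumes ij: "i \<in> {1..n}" "j \<in> {1..n}" "i \<noteq> j"
    and x: "x \<in> \<theta> ` graded_polys k" and y: "y \<in> \<theta> ` graded_polys l" and eq: "\<theta> (Var j) * x = \<theta> (Var i) * y"
  shows "x / \<theta> (Var i) \<in> \<theta> ` graded_polys (k - int (w i))"
proof -
  let ?F = "pham_brieskorn_poly n b :: 'k mpoly"
  let ?kill = "kill (- {1..n}) :: 'k mpoly \<Rightarrow> _"
  obtain p q where p: "x = \<theta> p" "p \<in> graded_polys k" and q: "y = \<theta> q" "q \<in> graded_polys l"
    using x y by blast
  have "\<theta> (Var j * p - Var i * q) = 0"
    using eq by (simp add: p q ring_map_simps[OF \<theta>])
  then obtain r h where "p - Var i * r = ?F * h"
    using regular_variables[of n b i j p q, OF n3 b_pos ij] unfolding ker by blast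
  from arg_cong[OF this, of ?kill] have rh: "p - Var i * ?kill r = ?F * ?kill h"
  proof -
    have "?kill ?F = ?F" "?kill p = p" "?kill (Var i) = Var i"
      using pham_brieskorn_poly_in_carrier[of n b] p(2) ij(1)
      by (auto simp: carrier_poly_ring_vars graded_polys_def intro!: kill_id[where V = "{1..n}"] vars_in_Var)
    then show ?thesis
      using \<open>?kill (p - Var i * r) = ?kill (?F * h)\<close> by (simp only: ring_map_simps[OF ring_map_kill])
  qed
  define r' where "r' = part (residue_class (k - int (w i))) (?kill r)"
  have "part (residue_class k) p - part (residue_class k) (Var i * ?kill r) = part (residue_class k) (?F * ?kill h)"
    unfolding rh[symmetric] part_diff ..
  also have "part (residue_class k) p = p"
    using p(2) by (simp add: part_id graded_polys_def)
  also have "part (residue_class k) (Var i * ?kill r) = Var i * r'"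
    unfolding r'_def using ij(1) by (intro part_residue_mult) (simp add: Var_def wdeg_single)
  also have "part (residue_class k) (?F * ?kill h) = ?F * part (residue_class (k - int (L div G))) (?kill h)"
    by (rule part_residue_mult) (simp add: wdeg_pham_brieskorn_poly)
  finally have "\<theta> (p - Var i * r') = 0"
    unfolding ker by simp
  then have "x = \<theta> (Var i) * \<theta> r'"
    by (simp add: p(1) ring_map_simps[OF \<theta>])
  then have "x / \<theta> (Var i) = \<theta> r'"
    using Var_not_dvd[OF \<theta> ker n3 b_pos ij(1)] by simp
  moreover have "?kill r \<in> vars_in {1..n}"
    using kill_in_vars_in[of r UNIV "- {1..n}"] by (simp add: supp_on_def Diff_eq)
  then have "r' \<in> graded_polys (k - int (w i))"
    by (simp add: r'_def graded_polys_def supp_on_part part_in_supp_on)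
  ultimately show ?thesis
    by simp
qed

lemma rigid_on_graded_polys:
  assumes rigid: "rigid_on (\<theta> ` vars_in {1..n})"
  shows "rigid_on (\<theta> ` graded_polys 0)"
  unfolding rigid_on_def
proof (intro allI impI)
  fix \<delta> assume lnd: "lnd_on (\<theta> ` graded_polys 0) \<delta>"
  interpret cyclic_grading "\<lambda>k. \<theta> ` graded_polys k" "d div G"
    by (rule cyclic_grading_graded_polys)
  interpret cyclic_grading_lnd "\<lambda>k. \<theta> ` graded_polys k" "d div G" \<delta> "{1..n}" "\<lambda>i. \<theta> (Var i)" "\<lambda>i. int (w i)"
  proof
    show "x * y \<in> \<theta> ` graded_polys 0" if "x \<in> \<theta> ` graded_polys 0" "y \<in> \<theta> ` graded_polys 0" for x y
      using S_mult[OF that] by simp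
    show "{1..n} \<noteq> {}"
      using n3 by simp
    show "\<exists>j\<in>{1..n}. j \<noteq> i" for i
      by (rule ex_other_index)
    show "\<theta> (Var i) \<in> \<theta> ` graded_polys (int (w i))" if "i \<in> {1..n}" for i
    proof (rule imageI)
      show "Var i \<in> graded_polys (int (w i))"
        using that unfolding graded_polys_def
        by (simp add: vars_in_Var) (simp add: Var_def supp_on_def residue_class_def wdeg_single)
    qed
    show "\<theta> (Var i) \<noteq> 0" if "i \<in> {1..n}" for i
      by (rule Var_not_dvd[OF \<theta> ker n3 b_pos that])
    show "\<exists>js. set js \<subseteq> {1..n} - {i} \<and> [sum_list (map (\<lambda>i. int (w i)) js) = k] (mod int (d div G))"
      if i: "i \<in> {1..n}" for i k
    proof (rule list_sum_residues[OF modulus_pos])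
      fix D :: int
      assume D: "D > 0" "D dvd int (d div G)" "\<And>j. j \<in> {1..n} - {i} \<Longrightarrow> D dvd int (w j)"
      then have "nat D = 1"
        using i by (intro weights_coprime[of i]) (auto simp: nat_dvd_iff simp flip: int_dvd_int_iff)
      then show "D = 1"
        by simp
    qed
  qed (use S_zero S_one S_add lnd regular_graded_polys in auto)
  show "\<forall>x\<in>\<theta> ` graded_polys 0. \<delta> x = 0"
    using rigid_on_total_imp_delta_zero rigid by (simp add: total_graded_polys)
qed

end

text \<open>Composing the embedding for the exponents \<open>a\<close> with the substitution of
  powers gives a map whose kernel belongs to the exponents \<open>b\<close>. So B' and the Veronese
  subring, its degree zero part, lie in the same field.\<close>

lemma realization:
  obtains \<theta> :: "'k::field_char_0 mpoly \<Rightarrow> 'k mpoly fract alg_closure fls"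
  where "ring_map \<theta>" "\<And>p. \<theta> p = 0 \<longleftrightarrow> pham_brieskorn_poly n b dvd p"
    "rigid (pham_brieskorn n b :: 'k mpoly set ring) \<longleftrightarrow> rigid_on (\<theta> ` vars_in {1..n})"
    "rigid (veronese (pham_brieskorn n a :: 'k mpoly set ring) (pham_brieskorn_grading n a) d) \<longleftrightarrow>
       rigid_on (\<theta> ` graded_polys 0)"
proof -
  obtain \<theta>0 :: "'k mpoly \<Rightarrow> 'k mpoly fract alg_closure fls"
    where \<theta>0: "ring_map \<theta>0" "\<And>p. \<theta>0 p = 0 \<longleftrightarrow> pham_brieskorn_poly n a dvd p"
    using pham_brieskorn_embedding[of n a, OF n3 a_pos] by blast
  define \<theta> where "\<theta> p = \<theta>0 (power_subst g p)" for p
  have \<theta>: "ring_map \<theta>"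
    unfolding \<theta>_def by (rule ring_map_comp[OF \<theta>0(1) ring_map_power_subst])
  have ker: "\<theta> p = 0 \<longleftrightarrow> pham_brieskorn_poly n b dvd p" for p
    by (simp add: \<theta>_def \<theta>0(2) power_subst_dvd_iff)
  have "\<theta>0 ` veronese_polys n a d = \<theta> ` graded_polys 0"
    unfolding veronese_polys_eq image_image \<theta>_def
    by (simp add: graded_polys_def supp_on_def residue_class_def cong_0_iff)
  then show ?thesis
    using that[OF \<theta> ker] rigid_pham_brieskorn_iff[OF \<theta> ker] rigid_veronese_iff[OF \<theta>0, of d] by simp
qed

lemma rigid_veronese:
  assumes "rigid (pham_brieskorn n b :: 'k::field_char_0 mpoly set ring)"
  shows "rigid (veronese (pham_brieskorn n a :: 'k mpoly set ring) (pham_brieskorn_grading n a) d)"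
proof -
  obtain \<theta> :: "'k mpoly \<Rightarrow> 'k mpoly fract alg_closure fls"
    where \<theta>: "ring_map \<theta>" "\<And>p. \<theta> p = 0 \<longleftrightarrow> pham_brieskorn_poly n b dvd p"
    and rigid: "rigid (pham_brieskorn n b :: 'k mpoly set ring) \<longleftrightarrow> rigid_on (\<theta> ` vars_in {1..n})"
    "rigid (veronese (pham_brieskorn n a :: 'k mpoly set ring) (pham_brieskorn_grading n a) d) \<longleftrightarrow>
       rigid_on (\<theta> ` graded_polys 0)"
    by (rule realization) (rule that)
  show ?thesis
    using rigid_on_graded_polys[OF \<theta>] rigid assms by simp
qed

text \<open>For \<open>d\<close> in D the modulus d / G is 1, so the degree zero part is all of B'.
  Outside Gamma_n some exponent is 1 or two exponents are 2, and an explicit derivation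
  exists.\<close>

lemma not_rigid_veronese:
  assumes "d dvd (\<Prod>i=1..n. e i)" "b \<notin> Gamma_tuples n"
  shows "\<not> rigid (veronese (pham_brieskorn n a :: complex mpoly set ring) (pham_brieskorn_grading n a) d)"
proof -
  obtain \<theta> :: "complex mpoly \<Rightarrow> complex mpoly fract alg_closure fls"
    where \<theta>: "ring_map \<theta>" "\<And>p. \<theta> p = 0 \<longleftrightarrow> pham_brieskorn_poly n b dvd p"
    and rigid: "rigid (veronese (pham_brieskorn n a :: complex mpoly set ring) (pham_brieskorn_grading n a) d) \<longleftrightarrow>
       rigid_on (\<theta> ` graded_polys 0)"
    by (rule realization) (rule that)
  have "G = d"
    using assms(1) by (simp add: G_eq_gcd)
  then have "residue_class 0 m" for m
    using d_pos by (simp add: residue_class_def cong_0_iff)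
  then have "graded_polys 0 = (vars_in {1..n} :: complex mpoly set)"
    by (auto simp: graded_polys_def supp_on_def)
  moreover have "\<not> rigid_on (\<theta> ` vars_in {1..n})"
  proof (cases "\<exists>i\<in>{1..n}. b i = 1")
    case True
    then obtain i where i: "i \<in> {1..n}" "b i = 1"
      by blast
    obtain j where j: "j \<in> {1..n}" "i \<noteq> j"
      using ex_other_index[of i] by auto
    show ?thesis
      using \<theta> i(1) j i(2) by (rule not_rigid_linear)
  next
    case False
    then have "\<forall>i\<in>{1..n}. b i > 1"
      using b_pos by (metis One_nat_def Suc_lessI)
    then obtain i j where ij: "i \<in> {1..n}" "b i = 2" "j \<in> {1..n}" "b j = 2" "i \<noteq> j"
      using assms(2) by (auto simp: Gamma_tuples_def Uniq_def)
    have "card {i, j} < card {1..n}"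
      using n3 ij by simp
    then have "{1..n} - {i, j} \<noteq> {}"
      by (metis Diff_eq_empty_iff card_mono finite.emptyI finite.insertI leD)
    then obtain k where "k \<in> {1..n}" "i \<noteq> k" "j \<noteq> k"
      by blast
    then show ?thesis
      using ij b_pos by (intro not_rigid_two_squares[OF \<theta>, of i j k]) auto
  qed
  ultimately show ?thesis
    using rigid by simp
qed

text \<open>\<open>G\<close> is the gcd of \<open>d\<close> with the product of all
  \<open>e i\<close>, so it has the same gcd with each \<open>e i\<close> as \<open>d\<close>
  has.\<close>

lemma f_map_G: "f_map n a G = b"
proof
  fix i
  have "gcd G (e i) = gcd d (e i)"
  proof (cases "i \<in> {1..n}")
    case True
    then have "gcd (\<Prod>i=1..n. e i) (e i) = e i"
      by (intro gcd_nat.absorb2 dvd_prodI) auto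
    then show ?thesis
      by (simp add: G_eq_gcd gcd.assoc)
  qed (simp add: e_outside)
  then show "f_map n a G i = b i"
    by (simp add: b_def f_map_def flip: e_def)
qed

lemma b_eq_1_iff:
  assumes "i \<in> {1..n}"
  shows "b i = 1 \<longleftrightarrow> i \<in> I_set n a 1 \<and> e i dvd d"
proof -
  have "b i = gcd (a i) (L_omit n a i) * (e i div g i)"
    by (simp add: b_def f_map_def g_def flip: e_def)
  moreover have "e i div g i = 1 \<longleftrightarrow> e i dvd d"
    using g_dvd_e[of i] g_pos[of i] e_pos[of i] unfolding g_def
    by (metis div_self dvd_div_mult_self gcd_nat.absorb_iff2 less_irrefl mult_1)
  ultimately show ?thesis
    using assms by (simp add: I_set_def)
qed

end

section \<open>Minimal elements\<close>

context veronese_exponents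
begin

lemma b_eq: "b i = gcd (a i) (L_omit n a i) * (e i div g i)"
  by (simp add: b_def f_map_def g_def flip: e_def)

lemma b_eq_2_if:
  assumes "i \<in> I_set n a 2" "e i dvd d"
  shows "b i = 2"
proof -
  have "g i = e i"
    using assms(2) by (simp add: g_def gcd_nat.absorb2)
  then show ?thesis
    using assms(1) e_pos[of i] by (simp add: b_eq I_set_def)
qed

text \<open>A single \<open>b i = 2\<close> could also arise from gcd(a_i, L_i) = 1. A second index
  makes \<open>a j\<close> even, so 2 divides this gcd, which divides
  \<open>b i = 2\<close>.\<close>

lemma b_eq_2_imp:
  assumes ij: "i \<in> {1..n}" "j \<in> {1..n}" "i \<noteq> j" and b: "b i = 2" "b j = 2"
  shows "i \<in> I_set n a 2 \<and> e i dvd d"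
proof -
  let ?h = "gcd (a i) (L_omit n a i)"
  have "even (a i)" "even (a j)"
    using b_mult_g[OF ij(1)] b_mult_g[OF ij(2)] b by (metis dvd_triv_left)+
  moreover have "a j dvd L_omit n a i"
    using ij by (auto simp: L_omit_def intro: dvd_Lcm)
  ultimately have "2 dvd ?h"
    using dvd_trans[of 2 "a j" "L_omit n a i"] by simp
  moreover have "?h dvd 2"
    using b(1) unfolding b_eq by (metis dvd_triv_left)
  ultimately have h: "?h = 2"
    by (rule dvd_antisym[rotated])
  then have "e i div g i = 1"
    using b(1) unfolding b_eq by simp
  then have "e i = g i"
    using g_dvd_e[of i] by (metis dvd_div_mult_self mult_1)
  then show ?thesis
    using h ij(1) g_dvd_d[of i] by (simp add: I_set_def)
qed

lemma b_not_in_Gamma_iff: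
  "b \<notin> Gamma_tuples n \<longleftrightarrow> (\<exists>i\<in>I_set n a 1. e i dvd d) \<or>
     (\<exists>i\<in>I_set n a 2. \<exists>j\<in>I_set n a 2. i \<noteq> j \<and> e i dvd d \<and> e j dvd d)"
proof -
  have "b \<notin> Gamma_tuples n \<longleftrightarrow> (\<exists>i\<in>{1..n}. b i = 1) \<or> (\<exists>i\<in>{1..n}. \<exists>j\<in>{1..n}. i \<noteq> j \<and> b i = 2 \<and> b j = 2)"
  proof -
    have "b i > 1 \<longleftrightarrow> b i \<noteq> 1" if "i \<in> {1..n}" for i
      using b_pos[OF that] by linarith
    then show ?thesis
      unfolding Gamma_tuples_def Uniq_def by blast
  qed
  also have "(\<exists>i\<in>{1..n}. b i = 1) \<longleftrightarrow> (\<exists>i\<in>I_set n a 1. e i dvd d)"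
  proof -
    have "I_set n a 1 \<subseteq> {1..n}"
      by (auto simp: I_set_def)
    then show ?thesis
      using b_eq_1_iff by blast
  qed
  also have "(\<exists>i\<in>{1..n}. \<exists>j\<in>{1..n}. i \<noteq> j \<and> b i = 2 \<and> b j = 2) \<longleftrightarrow>
      (\<exists>i\<in>I_set n a 2. \<exists>j\<in>I_set n a 2. i \<noteq> j \<and> e i dvd d \<and> e j dvd d)"
  proof -
    have "I_set n a 2 \<subseteq> {1..n}"
      by (auto simp: I_set_def)
    then show ?thesis
      using b_eq_2_if b_eq_2_imp by blast
  qed
  finally show ?thesis .
qed

end

context exponents
begin

lemma e_I1: "i \<in> I_set n a 1 \<Longrightarrow> e i = a i"
  and e_I2: "i \<in> I_set n a 2 \<Longrightarrow> a i = 2 * e i"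
  using e_mult_gcd[of i] by (simp_all add: I_set_def)

text \<open>The \<open>e i\<close> are pairwise coprime, and those over \<open>A\<close> exceed 1,
  so a factor from \<open>A\<close> can only divide the second product by occurring in it.\<close>

lemma prod_e_dvd_iff:
  assumes "A \<subseteq> {1..n}" "B \<subseteq> {1..n}" "\<And>i. i \<in> A \<Longrightarrow> e i > 1"
  shows "(\<Prod>i\<in>A. e i) dvd (\<Prod>i\<in>B. e i) \<longleftrightarrow> A \<subseteq> B"
proof
  assume dvd: "(\<Prod>i\<in>A. e i) dvd (\<Prod>i\<in>B. e i)"
  show "A \<subseteq> B"
  proof
    fix i assume i: "i \<in> A"
    show "i \<in> B"
    proof (rule ccontr)
      assume "i \<notin> B"
      then have "coprime (e i) (\<Prod>i\<in>B. e i)"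
        using i assms by (intro prod_coprime_right coprime_e) auto
      moreover have "e i dvd (\<Prod>i\<in>A. e i)"
        using i assms(1) finite_subset by (intro dvd_prodI) auto
      then have "e i dvd (\<Prod>i\<in>B. e i)"
        using dvd by (rule dvd_trans)
      ultimately have "e i dvd 1"
        by (metis coprime_common_divisor dvd_refl)
      then show False
        using assms(3)[OF i] by simp
    qed
  qed
next
  assume "A \<subseteq> B"
  then show "(\<Prod>i\<in>A. e i) dvd (\<Prod>i\<in>B. e i)"
    using assms(2) finite_subset by (intro prod_dvd_prod_subset) auto
qed

text \<open>Divisibility among the products mirrors inclusion of the index sets, so an antichain of
  sets gives pairwise incomparable, hence minimal, products.\<close>

lemma minimal_products:
  assumes \<A>: "\<And>A. A \<in> \<A> \<Longrightarrow> A \<subseteq> {1..n}" "\<And>A i. A \<in> \<A> \<Longrightarrow> i \<in> A \<Longrightarrow> e i > 1"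
    and antichain: "\<And>A B. A \<in> \<A> \<Longrightarrow> B \<in> \<A> \<Longrightarrow> A \<subseteq> B \<Longrightarrow> A = B"
    and mem: "\<And>A. A \<in> \<A> \<Longrightarrow> (\<Prod>i\<in>A. e i) \<in> N"
    and below: "\<And>d. d \<in> N \<Longrightarrow> \<exists>A\<in>\<A>. (\<Prod>i\<in>A. e i) dvd d"
  shows "{d \<in> N. \<forall>c\<in>N. c dvd d \<longrightarrow> c = d} = (\<lambda>A. \<Prod>i\<in>A. e i) ` \<A>"
proof (intro equalityI subsetI)
  fix d assume "d \<in> {d \<in> N. \<forall>c\<in>N. c dvd d \<longrightarrow> c = d}"
  then show "d \<in> (\<lambda>A. \<Prod>i\<in>A. e i) ` \<A>"
    using below mem by blast
next
  fix d assume "d \<in> (\<lambda>A. \<Prod>i\<in>A. e i) ` \<A>"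
  then obtain A where A: "A \<in> \<A>" "d = (\<Prod>i\<in>A. e i)"
    by blast
  have "c = d" if c: "c \<in> N" "c dvd d" for c
  proof -
    obtain B where B: "B \<in> \<A>" "(\<Prod>i\<in>B. e i) dvd c"
      using below[OF c(1)] by blast
    then have "(\<Prod>i\<in>B. e i) dvd (\<Prod>i\<in>A. e i)"
      using c(2) A(2) dvd_trans by blast
    then have "B \<subseteq> A"
      using prod_e_dvd_iff[of B A] \<A> A(1) B(1) by blast
    then have "B = A"
      using antichain A(1) B(1) by blast
    then show ?thesis
      using A(2) B(2) c(2) by (simp add: dvd_antisym)
  qed
  then show "d \<in> {d \<in> N. \<forall>c\<in>N. c dvd d \<longrightarrow> c = d}"
    using A mem by blast
qed

end

theorem theorem8p7:
  fixes n :: nat and a :: "nat \<Rightarrow> nat"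
  assumes "n \<ge> 3"
    and "a \<in> Gamma_tuples n"
    and "P_statement n \<or>
         (\<forall>d\<in>D_set n a. f_map n a d \<in> Gamma_tuples n \<longrightarrow>
            rigid (pham_brieskorn n (f_map n a d) :: complex mpoly set ring))"
  shows "(\<exists>\<^sub>\<le>\<^sub>1 i\<^sub>0. i\<^sub>0 \<in> I_set n a 2 \<and> a i\<^sub>0 = 2) \<and>
    ((\<nexists>i\<^sub>0. i\<^sub>0 \<in> I_set n a 2 \<and> a i\<^sub>0 = 2) \<longrightarrow>
       M_set (pham_brieskorn n a :: complex mpoly set ring) (pham_brieskorn_grading n a) =
         {a i | i. i \<in> I_set n a 1} \<union>
         {a i * a j div 4 | i j. i \<in> I_set n a 2 \<and> j \<in> I_set n a 2 \<and> i \<noteq> j}) \<and>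
    (\<forall>i\<^sub>0. i\<^sub>0 \<in> I_set n a 2 \<and> a i\<^sub>0 = 2 \<longrightarrow>
       M_set (pham_brieskorn n a :: complex mpoly set ring) (pham_brieskorn_grading n a) =
         {a i | i. i \<in> I_set n a 1} \<union>
         {a i div 2 | i. i \<in> I_set n a 2 - {i\<^sub>0}})"
proof -
  have a_gt_1: "a i > 1" if "i \<in> {1..n}" for i
    using assms(2) that by (simp add: Gamma_tuples_def)
  have a_2: "i = j" if "i \<in> {1..n}" "a i = 2" "j \<in> {1..n}" "a j = 2" for i j
    using assms(2) that by (auto simp: Gamma_tuples_def Uniq_def)
  interpret exponents n a
    using assms(1) by unfold_locales (use a_gt_1 in force)+
  let ?I1 = "I_set n a 1" and ?I2 = "I_set n a 2"
  let ?N = "NR (pham_brieskorn n a :: complex mpoly set ring) (pham_brieskorn_grading n a)"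
  \<comment> \<open>By \<open>b_not_in_Gamma_iff\<close> this says that f(d) lies outside
    Gamma_n.\<close>
  let ?bad = "\<lambda>d. (\<exists>i\<in>?I1. e i dvd d) \<or> (\<exists>i\<in>?I2. \<exists>j\<in>?I2. i \<noteq> j \<and> e i dvd d \<and> e j dvd d)"
  have I_sub: "?I1 \<subseteq> {1..n}" "?I2 \<subseteq> {1..n}" and I_disj: "?I1 \<inter> ?I2 = {}"
    by (auto simp: I_set_def)

  have rigid: "rigid (pham_brieskorn n (f_map n a d) :: complex mpoly set ring)"
    if "d \<in> D_set n a" "f_map n a d \<in> Gamma_tuples n" for d
    using assms(3) P_statement_imp_f_map_rigid that by blast
  have N_imp_bad: "?bad d" if d: "d \<in> ?N" for d
  proof -
    interpret veronese_exponents n a d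
      by unfold_locales (use d in \<open>simp add: NR_def\<close>)
    have "\<not> rigid (pham_brieskorn n b :: complex mpoly set ring)"
      using rigid_veronese d by (auto simp: NR_def)
    \<comment> \<open>The hypothesis concerns only elements of D. \<open>G\<close> is one of them
      and has the same image under f as \<open>d\<close>.\<close>
    moreover have "G \<in> D_set n a"
      unfolding D_set_def e_def[symmetric] using G_pos by (simp add: G_eq_gcd)
    ultimately have "b \<notin> Gamma_tuples n"
      using rigid[of G] by (auto simp: f_map_G)
    then show ?thesis
      by (simp only: b_not_in_Gamma_iff)
  qed
  have bad_imp_N: "(\<Prod>i\<in>A. e i) \<in> ?N" if A: "A \<subseteq> {1..n}" and bad: "?bad (\<Prod>i\<in>A. e i)" for A
  proof -
    have pos: "(\<Prod>i\<in>A. e i) > 0"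
      using e_pos by (intro prod_pos) auto
    interpret veronese_exponents n a "\<Prod>i\<in>A. e i"
      by unfold_locales (rule pos)
    have "b \<notin> Gamma_tuples n"
      using bad by (simp only: b_not_in_Gamma_iff)
    moreover have "(\<Prod>i\<in>A. e i) dvd (\<Prod>i=1..n. e i)"
      using A by (intro prod_dvd_prod_subset) auto
    ultimately show ?thesis
      unfolding NR_def using not_rigid_veronese pos by blast
  qed
  \<comment> \<open>\<open>e i\<close> is a_i on I_1 and a_i / 2 on I_2.\<close>
  have e_gt_1: "e i > 1" if "i \<in> ?I1 \<or> i \<in> ?I2 \<and> a i \<noteq> 2" for i
    using that a_gt_1[of i] e_I1[of i] e_I2[of i] e_pos[of i] I_sub by (cases "e i = 1") auto
  have dvd_prod: "e i dvd (\<Prod>j\<in>A. e j)" if "finite A" "i \<in> A" for i A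
    using that by (intro dvd_prodI)
  have M: "M_set R \<G> = {d \<in> NR R \<G>. \<forall>c\<in>NR R \<G>. c dvd d \<longrightarrow> c = d}" for R :: "complex mpoly set ring" and \<G>
    by (simp add: M_set_def)

  have uniq: "\<exists>\<^sub>\<le>\<^sub>1 i\<^sub>0. i\<^sub>0 \<in> ?I2 \<and> a i\<^sub>0 = 2"
    unfolding Uniq_def using a_2 I_sub(2) by blast
  moreover have "M_set (pham_brieskorn n a :: complex mpoly set ring) (pham_brieskorn_grading n a) =
      {a i | i. i \<in> ?I1} \<union> {a i * a j div 4 | i j. i \<in> ?I2 \<and> j \<in> ?I2 \<and> i \<noteq> j}"
    if no: "\<nexists>i\<^sub>0. i\<^sub>0 \<in> ?I2 \<and> a i\<^sub>0 = 2"
  proof -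
    \<comment> \<open>The minimal sets of indices whose \<open>e i\<close> must all divide
      \<open>d\<close> for f(d) to leave Gamma_n.\<close>
    define \<A> where "\<A> = (\<lambda>i. {i}) ` ?I1 \<union> {{i, j} | i j. i \<in> ?I2 \<and> j \<in> ?I2 \<and> i \<noteq> j}"
    have "M_set (pham_brieskorn n a :: complex mpoly set ring) (pham_brieskorn_grading n a) =
        (\<lambda>A. \<Prod>i\<in>A. e i) ` \<A>"
      unfolding M
    proof (rule minimal_products)
      show sub: "A \<subseteq> {1..n}" if "A \<in> \<A>" for A
        using that I_sub by (auto simp: \<A>_def)
      show "e i > 1" if "A \<in> \<A>" "i \<in> A" for A i
        using that no by (intro e_gt_1) (auto simp: \<A>_def)
      show "A = B" if "A \<in> \<A>" "B \<in> \<A>" "A \<subseteq> B" for A B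
        using that I_disj by (auto simp: \<A>_def)
      show "(\<Prod>i\<in>A. e i) \<in> ?N" if A: "A \<in> \<A>" for A
      proof (rule bad_imp_N[OF sub[OF A]])
        show "?bad (\<Prod>i\<in>A. e i)"
          using A unfolding \<A>_def by (auto intro!: dvd_prod)
      qed
      show "\<exists>A\<in>\<A>. (\<Prod>i\<in>A. e i) dvd d" if "d \<in> ?N" for d
        using N_imp_bad[OF that]
      proof (elim disjE bexE conjE)
        fix i assume "i \<in> ?I1" "e i dvd d"
        then show ?thesis
          by (intro bexI[of _ "{i}"]) (auto simp: \<A>_def)
      next
        fix i j assume ij: "i \<in> ?I2" "j \<in> ?I2" "i \<noteq> j" "e i dvd d" "e j dvd d"
        then have "e i * e j dvd d"
          using I_sub by (intro divides_mult coprime_e) auto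
        then show ?thesis
          using ij by (intro bexI[of _ "{i, j}"]) (auto simp: \<A>_def)
      qed
    qed
    also have "\<dots> = {a i | i. i \<in> ?I1} \<union> {a i * a j div 4 | i j. i \<in> ?I2 \<and> j \<in> ?I2 \<and> i \<noteq> j}"
    proof -
      have pair: "(\<Prod>l\<in>{i, j}. e l) = a i * a j div 4" if "i \<in> ?I2" "j \<in> ?I2" "i \<noteq> j" for i j
        using that by (simp add: e_I2)
      have "(\<lambda>A. \<Prod>i\<in>A. e i) ` {{i, j} | i j. i \<in> ?I2 \<and> j \<in> ?I2 \<and> i \<noteq> j} =
          {a i * a j div 4 | i j. i \<in> ?I2 \<and> j \<in> ?I2 \<and> i \<noteq> j}"
      proof (intro equalityI subsetI)
        fix x assume "x \<in> (\<lambda>A. \<Prod>i\<in>A. e i) ` {{i, j} | i j. i \<in> ?I2 \<and> j \<in> ?I2 \<and> i \<noteq> j}"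
        then obtain i j where "i \<in> ?I2" "j \<in> ?I2" "i \<noteq> j" "x = (\<Prod>l\<in>{i, j}. e l)"
          by blast
        then show "x \<in> {a i * a j div 4 | i j. i \<in> ?I2 \<and> j \<in> ?I2 \<and> i \<noteq> j}"
          using pair[of i j] by blast
      next
        fix x assume "x \<in> {a i * a j div 4 | i j. i \<in> ?I2 \<and> j \<in> ?I2 \<and> i \<noteq> j}"
        then obtain i j where "i \<in> ?I2" "j \<in> ?I2" "i \<noteq> j" "x = a i * a j div 4"
          by blast
        then show "x \<in> (\<lambda>A. \<Prod>i\<in>A. e i) ` {{i, j} | i j. i \<in> ?I2 \<and> j \<in> ?I2 \<and> i \<noteq> j}"
          using pair[of i j] by (intro image_eqI[of _ _ "{i, j}"]) auto
      qed
      moreover have "(\<lambda>A. \<Prod>i\<in>A. e i) ` (\<lambda>i. {i}) ` ?I1 = {a i | i. i \<in> ?I1}"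
        by (auto simp: e_I1 image_iff)
      ultimately show ?thesis
        unfolding \<A>_def image_Un by simp
    qed
    finally show ?thesis .
  qed
  moreover have "M_set (pham_brieskorn n a :: complex mpoly set ring) (pham_brieskorn_grading n a) =
      {a i | i. i \<in> ?I1} \<union> {a i div 2 | i. i \<in> ?I2 - {i\<^sub>0}}"
    if i0: "i\<^sub>0 \<in> ?I2 \<and> a i\<^sub>0 = 2" for i\<^sub>0
  proof -
    have ei0: "e i\<^sub>0 = 1"
      using i0 e_I2[of i\<^sub>0] by simp
    \<comment> \<open>Since \<open>e i\<^sub>0\<close> is 1, a pair containing
      \<open>i\<^sub>0\<close> only imposes a condition on its other index, so single indices
      replace the pairs.\<close>
    define \<A> where "\<A> = (\<lambda>i. {i}) ` (?I1 \<union> (?I2 - {i\<^sub>0}))"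
    have "M_set (pham_brieskorn n a :: complex mpoly set ring) (pham_brieskorn_grading n a) =
        (\<lambda>A. \<Prod>i\<in>A. e i) ` \<A>"
      unfolding M
    proof (rule minimal_products)
      show sub: "A \<subseteq> {1..n}" if "A \<in> \<A>" for A
        using that I_sub by (auto simp: \<A>_def)
      show "e i > 1" if "A \<in> \<A>" "i \<in> A" for A i
      proof (rule e_gt_1)
        have "i \<in> ?I1 \<or> i \<in> ?I2 \<and> i \<noteq> i\<^sub>0"
          using that by (auto simp: \<A>_def)
        then show "i \<in> ?I1 \<or> i \<in> ?I2 \<and> a i \<noteq> 2"
          using a_2 i0 I_sub(2) by blast
      qed
      show "A = B" if "A \<in> \<A>" "B \<in> \<A>" "A \<subseteq> B" for A B
        using that by (auto simp: \<A>_def)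
      show "(\<Prod>i\<in>A. e i) \<in> ?N" if A: "A \<in> \<A>" for A
      proof (rule bad_imp_N[OF sub[OF A]])
        obtain i where i: "A = {i}" "i \<in> ?I1 \<or> i \<in> ?I2 \<and> i \<noteq> i\<^sub>0"
          using A by (auto simp: \<A>_def)
        have "e i dvd (\<Prod>i\<in>A. e i)" "e i\<^sub>0 dvd (\<Prod>i\<in>A. e i)"
          by (simp_all add: i(1) ei0)
        then show "?bad (\<Prod>i\<in>A. e i)"
          using i(2) i0 by blast
      qed
      show "\<exists>A\<in>\<A>. (\<Prod>i\<in>A. e i) dvd d" if "d \<in> ?N" for d
      proof -
        \<comment> \<open>Of two distinct indices at least one differs from
          \<open>i\<^sub>0\<close>.\<close>
        have "\<exists>i. i \<in> ?I1 \<union> (?I2 - {i\<^sub>0}) \<and> e i dvd d"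
          using N_imp_bad[OF that] by blast
        then show ?thesis
          by (auto simp: \<A>_def)
      qed
    qed
    also have "\<dots> = {a i | i. i \<in> ?I1} \<union> {a i div 2 | i. i \<in> ?I2 - {i\<^sub>0}}"
      unfolding \<A>_def image_Un image_image Setcompr_eq_image
      by (intro arg_cong2[of _ _ _ _ "(\<union>)"] image_cong refl) (simp_all add: e_I1 e_I2)
    finally show ?thesis .
  qed
  ultimately show ?thesis
    by blast
qed

end
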